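(* Let $A,B\in\mathbb{Z}$ with $4A^3+27B^2\neq 0$ and let $E/\mathbb{Q}$ be the elliptic curve $y^2=x^3+Ax+B$. Then there are infinitely many primes $p$ of good reduction for $E$ such that $$r(E,p)>0.72\,\log\log p .$$
   Context: Here $\log$ is the natural logarithm. A prime of good reduction is a prime $p$ for which the reduction modulo $p$ of the given equation $y^2=x^3+Ax+B$ is nonsingular, i.e. $p\nmid 2(4A^3+27B^2)$; in that case $E(\mathbb{F}_p)$ denotes the finite abelian group of $\mathbb{F}_p$-points of the reduced curve (including the point at infinity). There are unique positive integers $L\mid M$ with $E(\mathbb{F}_p)\cong \mathbb{Z}/L\mathbb{Z}\times\mathbb{Z}/M\mathbb{Z}$, and $M$ is the maximal order of an element of $E(\mathbb{F}_p)$; a point of order $M$ is called a point of maximal order. For a prime $p$ of good reduction, $r(E,p)$ is the smallest non-negative integer $n$ such that there is a point $(x,y)\in E(\mathbb{F}_p)$ (not the point at infinity) of maximal order with $x\equiv n \pmod p$. (Such an $n$ exists whenever $E(\mathbb{F}_p)$ is nontrivial, in particular for all $p\ge 5$.) *)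

theory Defs
  imports Complex_Main "HOL-Number_Theory.Number_Theory"
begin

datatype 'a point = Infinity | Point 'a 'a

context
  fixes R :: "('a, 'b) ring_scheme" (structure)
begin

definition ell_points :: "'a \<Rightarrow> 'a \<Rightarrow> 'a point set" where
  "ell_points a b = insert Infinity
     {Point x y | x y. x \<in> carrier R \<and> y \<in> carrier R \<and>
        y [^] (2::nat) = x [^] (3::nat) \<oplus> a \<otimes> x \<oplus> b}"

text \<open>The chord-and-tangent law, with \<open>l\<close> the slope of the line through the two points.
  The constant term \<open>b\<close> of the equation does not occur in these formulas.\<close>

definition ell_add :: "'a \<Rightarrow> 'a point \<Rightarrow> 'a point \<Rightarrow> 'a point" where
  "ell_add a P Q = (case P of Infinity \<Rightarrow> Q | Point x1 y1 \<Rightarrow>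
     (case Q of Infinity \<Rightarrow> P | Point x2 y2 \<Rightarrow>
       if x1 = x2 \<and> y1 = \<ominus> y2 then Infinity
       else
         let l = (if x1 = x2
                  then ([(3::nat)] \<cdot> (x1 [^] (2::nat)) \<oplus> a) \<otimes> inv ([(2::nat)] \<cdot> y1)
                  else (y2 \<ominus> y1) \<otimes> inv (x2 \<ominus> x1));
             x3 = l [^] (2::nat) \<ominus> x1 \<ominus> x2
         in Point x3 (l \<otimes> (x1 \<ominus> x3) \<ominus> y1)))"

definition ell_group :: "'a \<Rightarrow> 'a \<Rightarrow> 'a point monoid" where
  "ell_group a b = \<lparr>carrier = ell_points a b, monoid.mult = ell_add a, one = Infinity\<rparr>"

end

definition good_reduction :: "int \<Rightarrow> int \<Rightarrow> nat \<Rightarrow> bool" where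
  "good_reduction A B p \<longleftrightarrow> prime p \<and> \<not> int p dvd 2 * (4 * A ^ 3 + 27 * B ^ 2)"

definition ell_Fp :: "int \<Rightarrow> int \<Rightarrow> nat \<Rightarrow> int point monoid" where
  "ell_Fp A B p = ell_group (residue_ring (int p)) (A mod int p) (B mod int p)"

definition maximal_order_point :: "('a, 'b) monoid_scheme \<Rightarrow> 'a \<Rightarrow> bool" where
  "maximal_order_point G P \<longleftrightarrow>
     P \<in> carrier G \<and> group.ord G P = Max (group.ord G ` carrier G)"

text \<open>The value is unspecified when the group of points is trivial, which can only happen
  for \<open>p < 5\<close>.\<close>

definition least_maximal_x :: "int \<Rightarrow> int \<Rightarrow> nat \<Rightarrow> nat" where
  "least_maximal_x A B p =
     (LEAST n. \<exists>x y. maximal_order_point (ell_Fp A B p) (Point x y) \<and> [x = int n] (mod int p))"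

end

theory Submission
  imports Defs "HOL-Analysis.Analysis" "HOL-Library.Function_Algebras"
    "HOL-Computational_Algebra.Fundamental_Theorem_Algebra" "HOL-Real_Asymp.Real_Asymp"
begin

text \<open>
  Let \<open>e1, e2, e3\<close> be the roots of \<open>f = x\<^sup>3 + A x + B\<close>.  Suppose that \<open>p\<close> is a prime modulo which the
  \<open>e\<^sub>i\<close> are rational and \<open>n - e1\<close>, \<open>n - e2\<close> are squares for all \<open>n \<le> N\<close> with \<open>f n \<noteq> 0\<close>.  Then a point with abscissa
  \<open>n \<le> N\<close> is either 2-torsion or the double of another point, and since all the 2-torsion is rational it does
  not have maximal order.  Hence \<open>r(E, p) > N\<close>.

  To find such a prime with \<open>log p\<close> at most \<open>4\<^sup>N\<close> times a polynomial in \<open>N\<close>, consider the order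
  \<open>\<O> = \<int>[e1, e2, \<surd>(n - e1), \<surd>(n - e2), \<dots>]\<close> of rank \<open>d = O(4\<^sup>N)\<close>; a ring homomorphism
  \<open>\<O> \<rightarrow> \<int>/p\<close> is what is needed.  If there were none for \<open>p \<le> T\<close>, every maximal ideal of index at most \<open>T\<close>
  would have index at least \<open>p\<^sup>2\<close>, so as in the Euler product for \<open>\<zeta>(3/2)\<close> there would be at most
  \<open>C\<^sup>d T\<^bsup>3/4\<^esup>\<close> ideals of index at most \<open>T\<close>.  But the principal ideals generated by the elements
  \<open>Y + \<eta>\<close>, \<open>\<eta>\<close> small, with \<open>Y\<^sup>d\<close> about \<open>T\<close>, are more numerous than that.  As \<open>0.72 \<cdot> log 4 < 1\<close>, the
  bound on \<open>p\<close> gives the claim.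
\<close>

section \<open>Orders with coordinate boxes\<close>

text \<open>Two square roots per \<open>n\<close> suffice: for a point \<open>(n, y)\<close> with
  \<open>y\<close> nonzero, \<open>n - e3\<close> is \<open>y ^ 2 / ((n - e1) (n - e2))\<close>,
  hence a square too. Three roots would give rank of order \<open>8 ^ N\<close> and spoil the
  constant 0.72. One further root, of \<open>n0 - e3\<close> for a single \<open>n0\<close>,
  provides a point of order greater than 2: in a group of exponent 2 the 2-torsion points would have
  maximal order.

  The order is made of functions on all orderings of the roots and all choices of signs. Its
  generators are independent by construction, even if the cubic is reducible or some
  \<open>n - e1\<close> is already a square, so the rank is known. The price is that zero divisors
  may occur and the order need not be maximal; factorisation is confined to ideals prime to
  \<open>\<Delta>\<close>, where the order is reduced modulo the primes involved.

  The structure constants must stay moderate, as \<open>log p\<close> is about the rank times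
  \<open>log K\<close>. Bounding the new products through \<open>K\<close> would square
  \<open>K\<close> at every step and make \<open>log p\<close> of order \<open>16 ^ N\<close>.
  Operator bounds that do not change along the tower let \<open>K\<close> grow only
  geometrically.\<close>

text \<open>An order of rank \<open>d\<close>, given through the sets \<open>Box n\<close> of elements whose coordinates in some
  \<open>\<int>\<close>-basis are at most \<open>n\<close> in absolute value; \<open>K\<close> absorbs the structure constants.\<close>

locale box_order =
  fixes Box :: "nat \<Rightarrow> 'a::comm_ring_1 set" and d K :: nat
  assumes finite_Box: "finite (Box n)"
    and card_Box: "card (Box n) = (2 * n + 1) ^ d"
    and zero_Box: "0 \<in> Box 0"
    and one_Box: "1 \<in> Box 1"
    and uminus_Box: "x \<in> Box n \<Longrightarrow> - x \<in> Box n"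
    and add_Box: "x \<in> Box m \<Longrightarrow> y \<in> Box n \<Longrightarrow> x + y \<in> Box (m + n)"
    and mult_Box: "x \<in> Box m \<Longrightarrow> y \<in> Box n \<Longrightarrow> x * y \<in> Box (K * m * n)"
    and Box_mono: "m \<le> n \<Longrightarrow> Box m \<subseteq> Box n"
    and div_Box: "x \<in> Box n \<Longrightarrow> m > 0 \<Longrightarrow> \<exists>q\<in>Box (n div m). \<exists>r\<in>Box m. x = of_nat m * q + r"
    and scale_Box: "x \<in> Box n \<Longrightarrow> of_nat m * x \<in> Box (m * n)"
    and descale_Box: "x \<in> (\<Union>k. Box k) \<Longrightarrow> m > 0 \<Longrightarrow> of_nat m * x \<in> Box n \<Longrightarrow> x \<in> Box (n div m)"
begin

definition R :: "'a set" where "R = (\<Union>n. Box n)"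

lemma R_I: "x \<in> Box n \<Longrightarrow> x \<in> R"
  by (auto simp: R_def)

lemma zero_R [simp]: "0 \<in> R" using zero_Box R_I by blast
lemma one_R [simp]: "1 \<in> R" using one_Box R_I by blast
lemma add_R [simp]: "x \<in> R \<Longrightarrow> y \<in> R \<Longrightarrow> x + y \<in> R"
  unfolding R_def using add_Box by blast
lemma mult_R [simp]: "x \<in> R \<Longrightarrow> y \<in> R \<Longrightarrow> x * y \<in> R"
  unfolding R_def using mult_Box by blast
lemma uminus_R [simp]: "x \<in> R \<Longrightarrow> - x \<in> R"
  unfolding R_def using uminus_Box by blast
lemma diff_R [simp]: "x \<in> R \<Longrightarrow> y \<in> R \<Longrightarrow> x - y \<in> R"
  using add_R[of x "- y"] by simp
lemma of_nat_Box: "of_nat m \<in> Box m"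
  using scale_Box[OF one_Box, of m] by simp
lemma of_nat_R [simp]: "of_nat m \<in> R"
  using of_nat_Box R_I by blast
lemma power_R [simp]: "x \<in> R \<Longrightarrow> x ^ n \<in> R"
  by (induction n) auto

lemma Box_0: "Box 0 = {0}"
proof -
  have "card (Box 0) = 1" by (simp add: card_Box)
  with zero_Box show ?thesis by (metis card_1_singletonE singletonD)
qed

lemma torsion_free: "x \<in> R \<Longrightarrow> m > 0 \<Longrightarrow> of_nat m * x = 0 \<Longrightarrow> x = 0"
  using descale_Box[of x m 0] zero_Box Box_0 by (auto simp: R_def)

lemma of_nat_cancel:
  assumes "x \<in> R" "y \<in> R" "m > 0" "of_nat m * x = of_nat m * y"
  shows "x = y"
  using torsion_free[of "x - y" m] assms by (simp add: algebra_simps)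

definition is_ideal :: "'a set \<Rightarrow> bool" where
  "is_ideal I \<longleftrightarrow> I \<subseteq> R \<and> 0 \<in> I \<and> (\<forall>x\<in>I. \<forall>y\<in>I. x + y \<in> I) \<and> (\<forall>r\<in>R. \<forall>x\<in>I. r * x \<in> I)"

lemma idealD:
  assumes "is_ideal I"
  shows "I \<subseteq> R" "0 \<in> I" "x \<in> I \<Longrightarrow> y \<in> I \<Longrightarrow> x + y \<in> I" "r \<in> R \<Longrightarrow> x \<in> I \<Longrightarrow> r * x \<in> I"
    "x \<in> I \<Longrightarrow> x \<in> R" "r \<in> R \<Longrightarrow> x \<in> I \<Longrightarrow> x * r \<in> I" "x \<in> I \<Longrightarrow> - x \<in> I"
    "x \<in> I \<Longrightarrow> y \<in> I \<Longrightarrow> x - y \<in> I"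
proof -
  show a: "I \<subseteq> R" "0 \<in> I" "x \<in> I \<Longrightarrow> y \<in> I \<Longrightarrow> x + y \<in> I" "r \<in> R \<Longrightarrow> x \<in> I \<Longrightarrow> r * x \<in> I" for x y r
    using assms by (auto simp: is_ideal_def)
  then show "x \<in> I \<Longrightarrow> x \<in> R" by auto
  show "r \<in> R \<Longrightarrow> x \<in> I \<Longrightarrow> x * r \<in> I" using a(4)[of r x] by (simp add: mult.commute)
  show m: "x \<in> I \<Longrightarrow> - x \<in> I" for x using a(4)[of "- 1" x] by simp
  show "x \<in> I \<Longrightarrow> y \<in> I \<Longrightarrow> x - y \<in> I" using a(3)[of x "- y"] m[of y] by simp
qed

text \<open>\<open>index_le I t\<close> says that the index of \<open>I\<close> in \<open>R\<close> is at most \<open>t\<close>.\<close>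

definition incong :: "'a set \<Rightarrow> 'a set \<Rightarrow> bool" where
  "incong I S \<longleftrightarrow> finite S \<and> S \<subseteq> R \<and> (\<forall>x\<in>S. \<forall>y\<in>S. x - y \<in> I \<longrightarrow> x = y)"

definition index_le :: "'a set \<Rightarrow> nat \<Rightarrow> bool" where
  "index_le I t \<longleftrightarrow> (\<forall>S. incong I S \<longrightarrow> card S \<le> t)"

lemma index_le_mono: "index_le I t \<Longrightarrow> I \<subseteq> J \<Longrightarrow> index_le J t"
  by (auto simp: index_le_def incong_def subset_iff)

lemma index_leI:
  assumes "\<And>x. x \<in> R \<Longrightarrow> \<exists>r\<in>F. x - r \<in> I" "finite F" "is_ideal I"
  shows "index_le I (card F)"
  unfolding index_le_def
proof (intro allI impI)
  fix S assume S: "incong I S"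
  define g where "g x = (SOME r. r \<in> F \<and> x - r \<in> I)" for x
  have g: "g x \<in> F" "x - g x \<in> I" if "x \<in> S" for x
  proof -
    have "\<exists>r. r \<in> F \<and> x - r \<in> I" using assms(1)[of x] S that by (auto simp: incong_def)
    from someI_ex[OF this] show "g x \<in> F" "x - g x \<in> I" by (auto simp: g_def)
  qed
  have "inj_on g S"
  proof (rule inj_onI)
    fix x y assume "x \<in> S" "y \<in> S" "g x = g y"
    then have "(x - g x) - (y - g y) \<in> I" using g idealD(8)[OF assms(3)] by blast
    with \<open>g x = g y\<close> have "x - y \<in> I" by simp
    with S \<open>x \<in> S\<close> \<open>y \<in> S\<close> show "x = y" by (auto simp: incong_def)
  qed
  with g(1) assms(2) show "card S \<le> card F" by (meson card_inj_on_le image_subsetI)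
qed

definition mulI :: "'a \<Rightarrow> 'a set" where "mulI x = (\<lambda>y. x * y) ` R"

lemma is_ideal_mulI: "x \<in> R \<Longrightarrow> is_ideal (mulI x)"
  unfolding is_ideal_def
proof (intro conjI ballI)
  assume x: "x \<in> R"
  show "mulI x \<subseteq> R" using x by (auto simp: mulI_def)
  have "x * 0 \<in> mulI x" unfolding mulI_def by (rule imageI) simp
  then show "0 \<in> mulI x" by simp
  fix a assume "a \<in> mulI x"
  then obtain u where u: "a = x * u" "u \<in> R" by (auto simp: mulI_def)
  {
    fix b assume "b \<in> mulI x"
    then obtain v where v: "b = x * v" "v \<in> R" by (auto simp: mulI_def)
    have "x * (u + v) \<in> mulI x" unfolding mulI_def using u v by (intro imageI) simp
    then show "a + b \<in> mulI x" by (simp add: u v distrib_left)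
  }
  fix r assume "r \<in> R"
  then have "x * (r * u) \<in> mulI x" unfolding mulI_def using u by (intro imageI) simp
  then show "r * a \<in> mulI x" by (simp add: u mult.left_commute)
qed

lemma mulI_I: "y \<in> R \<Longrightarrow> x * y \<in> mulI x" by (auto simp: mulI_def)

lemma is_ideal_R: "is_ideal R" by (auto simp: is_ideal_def)

lemma ideal_eq_R: "is_ideal I \<Longrightarrow> 1 \<in> I \<Longrightarrow> I = R"
  using idealD(6)[of I _ 1] idealD(1)[of I] by fastforce

text \<open>Makes \<open>R / m\<close> finite with explicit representatives; the finiteness
  arguments modulo an integer below rest on it.\<close>

lemma R_mod: "x \<in> R \<Longrightarrow> m > 0 \<Longrightarrow> \<exists>r\<in>Box m. x - r \<in> mulI (of_nat m)"
proof -
  assume "x \<in> R" "m > 0"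
  then obtain n where "x \<in> Box n" by (auto simp: R_def)
  from div_Box[OF this \<open>m > 0\<close>] obtain q r where "q \<in> Box (n div m)" "r \<in> Box m" "x = of_nat m * q + r" by blast
  then show ?thesis by (intro bexI[of _ r]) (auto simp: mulI_def intro: R_I)
qed

text \<open>Near-scalar elements \<open>Y + \<eta>\<close>: reduction modulo them contracts boxes, which replaces
  the determinant estimate for the norm.\<close>

lemma near_scalar_rep:
  assumes "Y > 0" "\<eta> \<in> Box H" "2 * K * H \<le> Y"
  shows "x \<in> Box n \<Longrightarrow> \<exists>r\<in>Box (2 * Y). x - r \<in> mulI (of_nat Y + \<eta>)"
proof (induction n arbitrary: x rule: less_induct)
  case (less n)
  show ?case
  proof (cases "n \<le> 2 * Y")
    case True
    with less.prems Box_mono have "x \<in> Box (2 * Y)" by blast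
    moreover have "x - x \<in> mulI (of_nat Y + \<eta>)" by (auto simp: mulI_def intro: image_eqI[of _ _ 0])
    ultimately show ?thesis by blast
  next
    case False
    obtain q r where q: "q \<in> Box (n div Y)" and r: "r \<in> Box Y" and x: "x = of_nat Y * q + r"
      using div_Box[OF less.prems assms(1)] by blast
    \<comment> \<open>Modulo \<open>Y + \<eta>\<close> the summand \<open>Y q\<close> becomes
      \<open>- \<eta> q\<close>. As \<open>2 K H \<le> Y\<close>, the new size is at most
      \<open>Y + n / 2\<close>, which is below \<open>n\<close> once \<open>n > 2 Y\<close>.\<close>
    have "\<eta> * q \<in> Box (K * H * (n div Y))" by (rule mult_Box[OF assms(2) q])
    then have z: "r + - (\<eta> * q) \<in> Box (Y + K * H * (n div Y))"
      by (intro add_Box uminus_Box r)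
    have "2 * (K * H * (n div Y)) \<le> Y * (n div Y)" using mult_le_mono1[OF assms(3), of "n div Y"] by (simp add: mult.assoc)
    also have "\<dots> \<le> n" by (rule times_div_less_eq_dividend)
    finally have "Y + K * H * (n div Y) < n" using False by linarith
    from less.IH[OF this z] obtain s where s: "s \<in> Box (2 * Y)" "r + - (\<eta> * q) - s \<in> mulI (of_nat Y + \<eta>)" by blast
    have "is_ideal (mulI (of_nat Y + \<eta>))" using assms(2) by (intro is_ideal_mulI add_R of_nat_R) (rule R_I)
    moreover have "(of_nat Y + \<eta>) * q \<in> mulI (of_nat Y + \<eta>)" using R_I[OF q] by (rule mulI_I)
    ultimately have "(r + - (\<eta> * q) - s) + (of_nat Y + \<eta>) * q \<in> mulI (of_nat Y + \<eta>)"
      using s(2) idealD(3) by blast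
    then have "x - s \<in> mulI (of_nat Y + \<eta>)" by (simp add: x algebra_simps)
    with s(1) show ?thesis by blast
  qed
qed

lemma near_scalar_index:
  assumes "Y > 0" "\<eta> \<in> Box H" "2 * K * H \<le> Y"
  shows "index_le (mulI (of_nat Y + \<eta>)) ((4 * Y + 1) ^ d)"
proof -
  have "index_le (mulI (of_nat Y + \<eta>)) (card (Box (2 * Y)))"
  proof (rule index_leI)
    show "\<exists>r\<in>Box (2 * Y). x - r \<in> mulI (of_nat Y + \<eta>)" if "x \<in> R" for x
      using that near_scalar_rep[OF assms] by (auto simp: R_def)
    show "is_ideal (mulI (of_nat Y + \<eta>))" using R_I[OF assms(2)] by (intro is_ideal_mulI) simp
  qed (rule finite_Box)
  then show ?thesis by (simp add: card_Box)
qed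

text \<open>Comparing sizes in \<open>Y u = Y + \<eta>' - \<eta> u\<close> bounds the coordinates of
  \<open>u\<close>. Hence a principal ideal has at most \<open>card (Box 3) = 7 ^ d\<close>
  generators of this shape, which is all the control of units that the count requires.\<close>

lemma near_scalar_unit:
  assumes "Y > 0" "\<eta> \<in> Box H" "\<eta>' \<in> Box H" "2 * K * H \<le> Y" "H \<le> Y"
    and "u \<in> R" "of_nat Y + \<eta>' = (of_nat Y + \<eta>) * u"
  shows "u \<in> Box 3"
proof -
  define n where "n = (LEAST n. u \<in> Box n)"
  have un: "u \<in> Box n" using assms(6) unfolding n_def R_def by (auto intro: LeastI)
  have le: "n \<le> m" if "u \<in> Box m" for m using that unfolding n_def by (rule Least_le)
  have "\<eta> * u \<in> Box (K * H * n)" by (rule mult_Box[OF assms(2) un])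
  then have "(of_nat Y + \<eta>') + - (\<eta> * u) \<in> Box ((Y + H) + K * H * n)"
    by (intro add_Box uminus_Box of_nat_Box assms)
  moreover have "(of_nat Y + \<eta>') + - (\<eta> * u) = of_nat Y * u" by (simp add: assms(7) distrib_right)
  ultimately have "u \<in> Box (((Y + H) + K * H * n) div Y)"
    using descale_Box[of u Y] assms(1,6) by (simp add: R_def)
  from le[OF this] have "n \<le> ((Y + H) + K * H * n) div Y" .
  then have "n * Y \<le> (Y + H) + K * H * n" using assms(1) by (simp add: less_eq_div_iff_mult_less_eq)
  moreover have "2 * (K * H * n) \<le> Y * n" using mult_le_mono1[OF assms(4), of n] by (simp add: mult.assoc)
  moreover have "Y * n = n * Y" by simp
  ultimately have "n * Y \<le> 4 * Y" using assms(5) by linarith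
  then have n4: "n \<le> 4" using assms(1) by simp
  \<comment> \<open>The size comparison alone gives 4. Equality would force \<open>2 K H = Y\<close>
    and \<open>H = Y\<close>, which is impossible by parity.\<close>
  have "n \<noteq> 4"
  proof
    assume "n = 4"
    with \<open>n * Y \<le> (Y + H) + K * H * n\<close> \<open>2 * (K * H * n) \<le> Y * n\<close> assms(4,5,1)
    have "2 * K * H = Y" "H = Y" by auto
    then have "2 * K * Y = 1 * Y" by simp
    with assms(1) have "2 * K = 1" by (simp del: One_nat_def)
    then show False by presburger
  qed
  with n4 have "n \<le> 3" by simp
  then show ?thesis using un Box_mono by blast
qed

section \<open>Maximal ideals and the primes below them\<close>

definition is_maximal :: "'a set \<Rightarrow> bool" where
  "is_maximal M \<longleftrightarrow> is_ideal M \<and> 1 \<notin> M \<and> (\<forall>J. is_ideal J \<longrightarrow> M \<subseteq> J \<longrightarrow> 1 \<notin> J \<longrightarrow> J = M)"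

lemma maximal_comax:
  assumes "is_maximal M" "a \<in> R" "a \<notin> M"
  shows "\<exists>r\<in>R. 1 - a * r \<in> M"
proof -
  have M: "is_ideal M" using assms by (simp add: is_maximal_def)
  note D = idealD[OF M]
  define J where "J = {a * r + m | r m. r \<in> R \<and> m \<in> M}"
  have "is_ideal J"
    unfolding is_ideal_def
  proof (intro conjI ballI)
    show "J \<subseteq> R" using assms(2) D(5) by (auto simp: J_def)
    show "0 \<in> J" unfolding J_def using D(2) by (intro CollectI exI[of _ 0]) auto
    fix x y assume "x \<in> J" "y \<in> J"
    then obtain r m r' m' where "x = a * r + m" "y = a * r' + m'" "r \<in> R" "r' \<in> R" "m \<in> M" "m' \<in> M"
      by (auto simp: J_def)
    then show "x + y \<in> J" unfolding J_def
      by (intro CollectI exI[of _ "r + r'"] exI[of _ "m + m'"]) (auto simp: algebra_simps D)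
  next
    fix s x assume "s \<in> R" "x \<in> J"
    then obtain r m where "x = a * r + m" "r \<in> R" "m \<in> M" by (auto simp: J_def)
    then show "s * x \<in> J" unfolding J_def using \<open>s \<in> R\<close>
      by (intro CollectI exI[of _ "s * r"] exI[of _ "s * m"]) (auto simp: algebra_simps D)
  qed
  moreover have "M \<subseteq> J"
  proof
    fix x assume "x \<in> M"
    then show "x \<in> J" unfolding J_def by (intro CollectI exI[of _ 0] exI[of _ x]) auto
  qed
  moreover have "a \<in> J" unfolding J_def using D(2) by (intro CollectI exI[of _ 1] exI[of _ 0]) auto
  ultimately have "1 \<in> J" using assms by (auto simp: is_maximal_def)
  then obtain r m where "1 = a * r + m" "r \<in> R" "m \<in> M" by (auto simp: J_def)
  then have "1 - a * r = m" by (simp add: algebra_simps)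
  with \<open>r \<in> R\<close> \<open>m \<in> M\<close> show ?thesis by auto
qed

lemma maximal_prime:
  assumes "is_maximal M" "a \<in> R" "b \<in> R" "a * b \<in> M"
  shows "a \<in> M \<or> b \<in> M"
proof (rule disjCI, rule ccontr)
  assume "b \<notin> M" "a \<notin> M"
  then obtain r where r: "r \<in> R" "1 - a * r \<in> M" using maximal_comax assms by blast
  have M: "is_ideal M" using assms by (simp add: is_maximal_def)
  have "b * (1 - a * r) + r * (a * b) \<in> M"
    using idealD(3)[OF M idealD(4)[OF M assms(3) r(2)] idealD(4)[OF M r(1) assms(4)]] .
  moreover have "b * (1 - a * r) + r * (a * b) = b" by (simp add: right_diff_distrib mult_ac)
  ultimately show False using \<open>b \<notin> M\<close> by simp
qed

text \<open>\<open>R = Box n + n R\<close>, so an ideal containing \<open>n\<close> is determined by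
  its trace on the finite set \<open>Box n\<close>.\<close>

lemma finite_ideals_containing:
  assumes "n > 0"
  shows "finite {J. is_ideal J \<and> of_nat n \<in> J}"
proof -
  have "inj_on (\<lambda>J. J \<inter> Box n) {J. is_ideal J \<and> of_nat n \<in> J}"
  proof (rule inj_onI)
    fix J J' assume JJ: "J \<in> {J. is_ideal J \<and> of_nat n \<in> J}" "J' \<in> {J. is_ideal J \<and> of_nat n \<in> J}"
      and eq: "J \<inter> Box n = J' \<inter> Box n"
    have sub: "A \<subseteq> B" if A: "is_ideal A" "of_nat n \<in> A" and B: "is_ideal B" "of_nat n \<in> B"
      and e: "A \<inter> Box n = B \<inter> Box n" for A B
    proof
      fix x assume x: "x \<in> A"
      then obtain r where r: "r \<in> Box n" "x - r \<in> mulI (of_nat n)"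
        using R_mod[OF idealD(5)[OF A(1) x] assms] by blast
      have "mulI (of_nat n) \<subseteq> A \<inter> B" using A B by (auto simp: mulI_def intro: idealD(6))
      then have "x - r \<in> A" "x - r \<in> B" using r by auto
      then have "x - (x - r) \<in> A" using x A idealD(8) by blast
      then have "r \<in> A" by simp
      with r e have "r \<in> B" by auto
      with \<open>x - r \<in> B\<close> have "(x - r) + r \<in> B" using B idealD(3) by blast
      then show "x \<in> B" by simp
    qed
    show "J = J'" using sub[of J J'] sub[of J' J] JJ eq by auto
  qed
  moreover have "(\<lambda>J. J \<inter> Box n) ` {J. is_ideal J \<and> of_nat n \<in> J} \<subseteq> Pow (Box n)" by auto
  ultimately show ?thesis using finite_Box[of n] by (meson finite_Pow_iff finite_imageD finite_subset)
qed

text \<open>A proper ideal maximal over \<open>I\<close> exists because only finitely many ideals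
  contain the integer \<open>n\<close>.\<close>

lemma maximal_exists:
  assumes "is_ideal I" "of_nat n \<in> I" "n > 0" "1 \<notin> I"
  shows "\<exists>M. is_maximal M \<and> I \<subseteq> M"
proof -
  define A where "A = {J. is_ideal J \<and> I \<subseteq> J \<and> 1 \<notin> J}"
  have "A \<subseteq> {J. is_ideal J \<and> of_nat n \<in> J}" using assms by (auto simp: A_def)
  then have "finite A" using finite_ideals_containing[OF assms(3)] finite_subset by blast
  moreover have "I \<in> A" using assms by (auto simp: A_def)
  ultimately obtain M where M: "M \<in> A" "I \<subseteq> M" "\<forall>J\<in>A. M \<subseteq> J \<longrightarrow> M = J"
    using finite_has_maximal2[of A I] by meson
  have "J = M" if "is_ideal J" "M \<subseteq> J" "1 \<notin> J" for J
    using M that by (auto simp: A_def)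
  then have "is_maximal M" using M(1) by (auto simp: is_maximal_def A_def)
  with M(2) show ?thesis by (intro exI[of _ M] conjI)
qed

lemma maximal_prime_number:
  assumes "is_maximal M"
  shows "n > 0 \<Longrightarrow> of_nat n \<in> M \<Longrightarrow> \<exists>p. prime p \<and> p dvd n \<and> of_nat p \<in> M"
proof (induction n rule: less_induct)
  case (less n)
  show ?case
  proof (cases "n = 1")
    case True
    with less.prems assms show ?thesis by (auto simp: is_maximal_def)
  next
    case False
    then obtain q where q: "prime q" "q dvd n" using prime_factor_nat by blast
    then obtain m where m: "n = q * m" by blast
    have "of_nat q \<in> M \<or> of_nat m \<in> M"
      using less.prems(2) unfolding m by (intro maximal_prime[OF assms]) auto
    moreover have "m < n" "m > 0" using m q less.prems(1) prime_gt_1_nat[OF q(1)] by auto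
    ultimately show ?thesis using less.IH[of m] q unfolding m by (meson dvd_mult)
  qed
qed

section \<open>Idempotents in the reduced finite ring R / p\<close>

lemma reduced_power:
  assumes red: "\<And>x. x \<in> R \<Longrightarrow> x * x \<in> mulI (of_nat p) \<Longrightarrow> x \<in> mulI (of_nat p)"
  shows "y \<in> R \<Longrightarrow> k > 0 \<Longrightarrow> y ^ k \<in> mulI (of_nat p) \<Longrightarrow> y \<in> mulI (of_nat p)"
proof (induction k rule: less_induct)
  case (less k)
  show ?case
  proof (cases "k = 1")
    case True then show ?thesis using less.prems by simp
  next
    case False
    define m where "m = (k + 1) div 2"
    have m: "m < k" "m > 0" "k \<le> m + m" using False less.prems unfolding m_def by auto
    have "y ^ (m + m) = y ^ (m + m - k) * y ^ k" using m by (simp flip: power_add)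
    also have "\<dots> \<in> mulI (of_nat p)"
      using less.prems by (intro idealD(4)[OF is_ideal_mulI]) auto
    finally have "y ^ m * y ^ m \<in> mulI (of_nat p)" by (simp add: power_add)
    then have "y ^ m \<in> mulI (of_nat p)" using less.prems(1) red[of "y ^ m"] power_R by blast
    then show ?thesis by (rule less.IH[OF m(1) less.prems(1) m(2)])
  qed
qed

text \<open>The powers of \<open>x\<close> repeat in the finite ring \<open>R / p\<close>, so
  \<open>x ^ a * (1 - x ^ c)\<close> vanishes there. Then \<open>(1 - x ^ c) * x\<close> is
  nilpotent modulo \<open>p\<close>, hence zero by reducedness. In other words, \<open>x ^ c\<close>
  is an idempotent generating the same ideal as \<open>x\<close> modulo \<open>p\<close>.\<close>

lemma annihilating_unit:
  assumes red: "\<And>x. x \<in> R \<Longrightarrow> x * x \<in> mulI (of_nat p) \<Longrightarrow> x \<in> mulI (of_nat p)"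
    and "p > 0" "x \<in> R"
  shows "\<exists>c. c > 0 \<and> (1 - x ^ c) * x \<in> mulI (of_nat p)"
proof -
  define P where "P = mulI (of_nat p)"
  have P: "is_ideal P" unfolding P_def by (intro is_ideal_mulI) simp
  have "\<exists>r. r \<in> Box p \<and> x ^ k - r \<in> P" for k
    using R_mod[of "x ^ k" p] assms by (auto simp: P_def)
  then obtain r where r: "\<And>k. r k \<in> Box p" "\<And>k. x ^ k - r k \<in> P" by metis
  have "\<not> inj r"
    using finite_Box[of p] r(1) by (meson finite_imageD finite_subset image_subsetI infinite_UNIV_nat)
  then obtain a b where ab: "r a = r b" "a < b" by (metis injI linorder_neqE_nat)
  have "(x ^ a - r a) - (x ^ b - r b) \<in> P" using r idealD(8)[OF P] by blast
  then have "x ^ a - x ^ b \<in> P" using ab by simp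
  moreover have "x ^ b = x ^ a * x ^ (b - a)" using ab by (simp flip: power_add)
  ultimately have *: "x ^ a * (1 - x ^ (b - a)) \<in> P" by (simp add: algebra_simps)
  have "((1 - x ^ (b - a)) * x) ^ (a + 1) = ((1 - x ^ (b - a)) ^ a * x) * (x ^ a * (1 - x ^ (b - a)))"
    unfolding power_add power_mult_distrib by (simp only: mult_ac power_one_right)
  also have "\<dots> \<in> P" using * assms(3) by (intro idealD(4)[OF P _ *]) auto
  finally have "(1 - x ^ (b - a)) * x \<in> P"
    unfolding P_def by - (rule reduced_power[of p _ "a + 1", OF red], assumption+, use assms(3) in simp_all)
  then show ?thesis using ab by (auto simp: P_def intro!: exI[of _ "b - a"])
qed

text \<open>Modulo \<open>p\<close> the order is a finite product of fields, and
  \<open>\<epsilon>\<close> is the idempotent of the factor \<open>R / M\<close>. It is obtained by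
  multiplying the elements \<open>1 - x ^ c\<close> that annihilate the members \<open>x\<close> of
  \<open>M\<close>.\<close>

lemma local_idempotent:
  assumes red: "\<And>x. x \<in> R \<Longrightarrow> x * x \<in> mulI (of_nat p) \<Longrightarrow> x \<in> mulI (of_nat p)"
    and p: "p > 0" "of_nat p \<in> M" and M: "is_maximal M"
  shows "\<exists>\<epsilon>\<in>R. 1 - \<epsilon> \<in> M \<and> (\<forall>x\<in>M. \<epsilon> * x \<in> mulI (of_nat p))"
proof -
  define P where "P = mulI (of_nat p)"
  have P: "is_ideal P" unfolding P_def by (intro is_ideal_mulI) simp
  have MI: "is_ideal M" using M by (simp add: is_maximal_def)
  have "\<forall>x\<in>R. \<exists>c. c > 0 \<and> (1 - x ^ c) * x \<in> P"
    using annihilating_unit[OF red p(1)] unfolding P_def by blast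
  then obtain c where c: "\<And>x. x \<in> R \<Longrightarrow> c x > 0 \<and> (1 - x ^ c x) * x \<in> P" by metis
  have gen: "finite F \<Longrightarrow> F \<subseteq> M \<Longrightarrow> (\<Prod>x\<in>F. 1 - x ^ c x) \<in> R \<and> 1 - (\<Prod>x\<in>F. 1 - x ^ c x) \<in> M
     \<and> (\<forall>x\<in>F. (\<Prod>x\<in>F. 1 - x ^ c x) * x \<in> P)" for F
  proof (induction F rule: finite_induct)
    case empty
    then show ?case using idealD(2)[OF MI] by simp
  next
    case (insert a F)
    define e where "e = (\<Prod>x\<in>F. 1 - x ^ c x)"
    have e: "e \<in> R" "1 - e \<in> M" "\<forall>x\<in>F. e * x \<in> P" using insert e_def by auto
    have a: "a \<in> M" "a \<in> R" using insert.prems idealD(5)[OF MI] by auto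
    have ca: "c a > 0" "(1 - a ^ c a) * a \<in> P" using c[OF a(2)] by auto
    have "a ^ c a = a ^ (c a - 1) * a" using ca(1) by (metis power_minus_mult)
    then have am: "a ^ c a \<in> M" using a idealD(4)[OF MI, of "a ^ (c a - 1)" a] by simp
    have pr: "(\<Prod>x\<in>insert a F. 1 - x ^ c x) = (1 - a ^ c a) * e" using insert by (simp add: e_def)
    have "1 - (1 - a ^ c a) * e = (1 - e) + a ^ c a * e" by (simp add: algebra_simps)
    also have "\<dots> \<in> M" using e am by (intro idealD(3)[OF MI] idealD(6)[OF MI])
    finally have 1: "1 - (1 - a ^ c a) * e \<in> M" .
    have 2: "(1 - a ^ c a) * e * x \<in> P" if "x \<in> insert a F" for x
    proof (cases "x = a")
      case True
      have "(1 - a ^ c a) * e * x = e * ((1 - a ^ c a) * a)" using True by (simp add: algebra_simps)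
      then show ?thesis using idealD(4)[OF P e(1) ca(2)] by simp
    next
      case False
      then have "e * x \<in> P" using that e by auto
      then show ?thesis using idealD(4)[OF P, of "1 - a ^ c a" "e * x"] a by (simp add: mult.assoc)
    qed
    show ?case unfolding pr using e(1) a(2) 1 2 by auto
  qed
  \<comment> \<open>Since \<open>p\<close> lies in \<open>M\<close>, the finite set
    \<open>M \<inter> Box p\<close> represents all of \<open>M\<close> modulo \<open>p\<close>, so a
    finite product suffices.\<close>
  define e where "e = (\<Prod>x\<in>M \<inter> Box p. 1 - x ^ c x)"
  have e: "e \<in> R" "1 - e \<in> M" "\<forall>x\<in>M \<inter> Box p. e * x \<in> P"
    using gen[of "M \<inter> Box p"] finite_Box[of p] unfolding e_def by auto
  have "e * x \<in> P" if xM: "x \<in> M" for x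
  proof -
    obtain r where r: "r \<in> Box p" "x - r \<in> P"
      using R_mod[OF idealD(5)[OF MI xM] p(1)] by (auto simp: P_def)
    have "P \<subseteq> M" using p(2) by (auto simp: P_def mulI_def intro: idealD(6)[OF MI])
    then have "x - (x - r) \<in> M" using r that idealD(8)[OF MI] by blast
    then have "e * r \<in> P" using e r by auto
    then have "e * r + e * (x - r) \<in> P" using r e idealD(3,4)[OF P] by blast
    then show ?thesis by (simp add: algebra_simps)
  qed
  with e show ?thesis unfolding P_def by blast
qed

end

section \<open>Counting ideals\<close>

text \<open>Rankin's trick, one Euler factor per element of \<open>A\<close>. Any exponent strictly
  between 1/2 and 1 would serve in place of 3/4: with weights \<open>p ^ 2\<close> the product is
  bounded above 1/2, and the near-scalar elements outnumber the bound below 1.\<close>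

lemma card_multisets_prod_le:
  fixes w :: "'b \<Rightarrow> nat"
  assumes "finite A" "\<And>x. x \<in> A \<Longrightarrow> w x \<ge> 2"
  shows "finite {\<mu>. set_mset \<mu> \<subseteq> A \<and> (\<Prod>x\<in>#\<mu>. w x) \<le> t} \<and>
    real (card {\<mu>. set_mset \<mu> \<subseteq> A \<and> (\<Prod>x\<in>#\<mu>. w x) \<le> t})
      \<le> real t powr (3/4) * (\<Prod>x\<in>A. 1 / (1 - real (w x) powr (-3/4)))"
  using assms
proof (induction A arbitrary: t rule: finite_induct)
  case empty
  have *: "{\<mu>. set_mset \<mu> \<subseteq> {} \<and> (\<Prod>x\<in>#\<mu>. w x) \<le> t} = (if t \<ge> 1 then {{#}} else {})"
    by (auto simp: set_mset_eq_empty_iff)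
  show ?case unfolding * by (auto intro: ge_one_powr_ge_zero)
next
  case (insert a A)
  define S where "S t = {\<mu>. set_mset \<mu> \<subseteq> insert a A \<and> (\<Prod>x\<in>#\<mu>. w x) \<le> t}" for t
  define P where "P = (\<Prod>x\<in>A. 1 / (1 - real (w x) powr (-3/4)))"
  define u where "u = real (w a) powr (-3/4)"
  have wa: "w a \<ge> 2" using insert by auto
  have u: "0 < u" "u < 1" unfolding u_def using wa powr_less_mono[of "-3/4" 0 "real (w a)"] by auto
  have IH: "finite {\<mu>. set_mset \<mu> \<subseteq> A \<and> (\<Prod>x\<in>#\<mu>. w x) \<le> t}"
    "real (card {\<mu>. set_mset \<mu> \<subseteq> A \<and> (\<Prod>x\<in>#\<mu>. w x) \<le> t}) \<le> real t powr (3/4) * P" for t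
    using insert.IH insert.prems by (auto simp: P_def)
  have P0: "P \<ge> 0" unfolding P_def
  proof (intro prod_nonneg)
    fix x assume "x \<in> A"
    then have "real (w x) powr (-3/4) \<le> 1" using insert.prems[of x] powr_mono[of "-3/4" 0 "real (w x)"] by auto
    then show "0 \<le> 1 / (1 - real (w x) powr (-3/4))" by simp
  qed
  have pos: "(\<Prod>x\<in>#\<mu>. w x) \<ge> 1" if "set_mset \<mu> \<subseteq> insert a A" for \<mu>
    using that insert.prems
  proof (induction \<mu>)
    case (add x \<mu>)
    then have "w x \<ge> 2" "(\<Prod>x\<in>#\<mu>. w x) \<ge> 1" by auto
    then show ?case using mult_le_mono[of 1 "w x" 1 "\<Prod>x\<in>#\<mu>. w x"] by simp
  qed auto
  \<comment> \<open>A multiset either avoids \<open>a\<close> or loses one copy of it, in which case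
    the bound drops to \<open>t div w a\<close>. Solving this recursion produces the geometric
    factor \<open>1 / (1 - u)\<close>.\<close>
  have rec: "S t \<subseteq> {\<mu>. set_mset \<mu> \<subseteq> A \<and> (\<Prod>x\<in>#\<mu>. w x) \<le> t} \<union> add_mset a ` S (t div w a)" for t
  proof
    fix \<mu> assume m: "\<mu> \<in> S t"
    show "\<mu> \<in> {\<mu>. set_mset \<mu> \<subseteq> A \<and> (\<Prod>x\<in>#\<mu>. w x) \<le> t} \<union> add_mset a ` S (t div w a)"
    proof (cases "a \<in># \<mu>")
      case True
      then obtain \<nu> where n: "\<mu> = add_mset a \<nu>" by (metis insert_DiffM)
      with m wa have "\<nu> \<in> S (t div w a)"
        by (auto simp: S_def less_eq_div_iff_mult_less_eq mult.commute)
      with n show ?thesis by auto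
    next
      case False
      with m show ?thesis by (auto simp: S_def)
    qed
  qed
  have main: "finite (S t) \<and> real (card (S t)) \<le> real t powr (3/4) * (P / (1 - u))"
  proof (induction t rule: less_induct)
    case (less t)
    show ?case
    proof (cases "t = 0")
      case True
      have "\<mu> \<notin> S t" for \<mu> using pos[of \<mu>] True unfolding S_def by (simp only: mem_Collect_eq) linarith
      then have "S t = {}" by blast
      then show ?thesis using True by simp
    next
      case False
      then have lt: "t div w a < t" using wa by simp
      note L = less.IH[OF lt]
      have fin: "finite ({\<mu>. set_mset \<mu> \<subseteq> A \<and> (\<Prod>x\<in>#\<mu>. w x) \<le> t} \<union> add_mset a ` S (t div w a))"
        using L IH by auto
      have "real (card (S t)) \<le> real (card ({\<mu>. set_mset \<mu> \<subseteq> A \<and> (\<Prod>x\<in>#\<mu>. w x) \<le> t} \<union> add_mset a ` S (t div w a)))"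
        using card_mono[OF fin rec] by simp
      also have "\<dots> \<le> real (card {\<mu>. set_mset \<mu> \<subseteq> A \<and> (\<Prod>x\<in>#\<mu>. w x) \<le> t}) + real (card (S (t div w a)))"
        using card_Un_le[of "{\<mu>. set_mset \<mu> \<subseteq> A \<and> (\<Prod>x\<in>#\<mu>. w x) \<le> t}" "add_mset a ` S (t div w a)"]
          card_image_le[of "S (t div w a)" "add_mset a"] L by linarith
      also have "\<dots> \<le> real t powr (3/4) * P + real (t div w a) powr (3/4) * (P / (1 - u))"
        using IH(2) L by (intro add_mono) auto
      also have "\<dots> \<le> real t powr (3/4) * P + (real t / real (w a)) powr (3/4) * (P / (1 - u))"
        using P0 u by (intro add_left_mono mult_right_mono powr_mono2 of_nat_div_le_of_nat) auto
      also have "(real t / real (w a)) powr (3/4) = real t powr (3/4) * u"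
        unfolding u_def using wa by (simp add: powr_divide powr_minus_divide)
      also have "real t powr (3/4) * P + real t powr (3/4) * u * (P / (1 - u)) = real t powr (3/4) * (P / (1 - u))"
        using u by (simp add: field_simps)
      finally show ?thesis using fin rec finite_subset by blast
    qed
  qed
  have "(\<Prod>x\<in>insert a A. 1 / (1 - real (w x) powr (-3/4))) = P / (1 - u)"
    using insert by (simp add: P_def u_def)
  with main show ?case by (simp add: S_def)
qed

lemma inverse_one_minus_le_exp:
  fixes x :: real
  assumes "0 \<le> x" "x \<le> 1/2"
  shows "1 / (1 - x) \<le> exp (2 * x)"
proof -
  have "1 \<le> (1 - x) * (1 + 2 * x)" using mult_left_mono[OF assms(2,1)] by (simp add: algebra_simps)
  then have "1 / (1 - x) \<le> 1 + 2 * x" using assms by (simp add: field_simps)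
  also have "\<dots> \<le> exp (2 * x)" by (rule exp_ge_add_one_self)
  finally show ?thesis .
qed

text \<open>This is zeta(3/2): the term for \<open>n = 0\<close> is zero by the convention for
  \<open>powr\<close>.\<close>

definition zeta_const :: real where "zeta_const = (\<Sum>n. real n powr (-3/2))"

lemma summable_zeta: "summable (\<lambda>n. real n powr (-3/2))"
  using summable_real_powr_iff[of "-3/2"] by simp

context box_order
begin

lemma of_int_R [simp]: "of_int z \<in> R"
  by (cases z rule: int_cases2) auto

lemma of_int_mem_maximal:
  assumes "is_maximal M" "prime p" "of_nat p \<in> M"
  shows "of_int z \<in> M \<longleftrightarrow> int p dvd z"
proof
  have M: "is_ideal M" using assms by (simp add: is_maximal_def)
  assume "int p dvd z"
  then obtain k where "z = int p * k" by blast
  then show "of_int z \<in> M" using idealD(6)[OF M, of "of_int k" "of_nat p"] assms by simp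
next
  have M: "is_ideal M" using assms by (simp add: is_maximal_def)
  assume z: "of_int z \<in> M"
  show "int p dvd z"
  proof (rule ccontr)
    assume "\<not> int p dvd z"
    then have "coprime z (int p)" using assms(2) by (metis coprime_commute prime_imp_coprime prime_nat_int_transfer)
    then obtain u v where "u * z + v * int p = 1" by (metis bezout_int coprime_imp_gcd_eq_1)
    then have "(of_int (u * z + v * int p) :: 'a) = 1" by simp
    then have "of_int u * of_int z + of_int v * of_nat p = (1 :: 'a)" by simp
    moreover have "of_int u * of_int z + of_int v * of_nat p \<in> M"
      using z assms(3) by (intro idealD(3)[OF M] idealD(4)[OF M]) auto
    ultimately show False using assms(1) by (auto simp: is_maximal_def)
  qed
qed

text \<open>The residue characteristic of \<open>M\<close>.\<close>

definition pr :: "'a set \<Rightarrow> nat" where "pr M = (SOME p. prime p \<and> of_nat p \<in> M)"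

lemma pr_eq:
  assumes "is_maximal M" "prime p" "of_nat p \<in> M"
  shows "pr M = p"
proof -
  have "prime (pr M) \<and> of_nat (pr M) \<in> M" unfolding pr_def using assms by (intro someI) auto
  then have "int p dvd int (pr M)" "prime (pr M)" using of_int_mem_maximal[OF assms, of "int (pr M)"] by auto
  then show ?thesis using assms(2) by (metis int_dvd_int_iff primes_dvd_imp_eq)
qed

definition ep :: "'a set \<Rightarrow> 'a" where
  "ep M = (SOME \<epsilon>. \<epsilon> \<in> R \<and> 1 - \<epsilon> \<in> M \<and> (\<forall>x\<in>M. \<epsilon> * x \<in> mulI (of_nat (pr M))))"

text \<open>The product \<open>M I\<close>, as \<open>M\<close> is generated by \<open>pr M\<close>
  and \<open>1 - ep M\<close> away from \<open>\<Delta>\<close>. In this form it commutes in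
  \<open>M\<close> for arbitrary sets \<open>I\<close>, which folding over a multiset
  demands.\<close>

definition times_max :: "'a set \<Rightarrow> 'a set \<Rightarrow> 'a set" where
  "times_max M I = {of_nat (pr M) * a + (1 - ep M) * b | a b. a \<in> I \<and> b \<in> I}"

lemma times_max_commute: "times_max M (times_max N I) = times_max N (times_max M I)"
proof -
  have "times_max M (times_max N I) \<subseteq> times_max N (times_max M I)" for M N
  proof
    fix x assume "x \<in> times_max M (times_max N I)"
    then obtain a b c e where abce: "a \<in> I" "b \<in> I" "c \<in> I" "e \<in> I"
      and x: "x = of_nat (pr M) * (of_nat (pr N) * a + (1 - ep N) * b) + (1 - ep M) * (of_nat (pr N) * c + (1 - ep N) * e)"
      unfolding times_max_def by blast
    have "x = of_nat (pr N) * (of_nat (pr M) * a + (1 - ep M) * c) + (1 - ep N) * (of_nat (pr M) * b + (1 - ep M) * e)"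
      unfolding x by (simp add: algebra_simps)
    then show "x \<in> times_max N (times_max M I)" unfolding times_max_def using abce by blast
  qed
  then show ?thesis by blast
qed

end

text \<open>Reducedness modulo the primes not dividing \<open>\<Delta>\<close> stands in for
  maximality of the order: it makes the maximal ideals over those primes invertible.\<close>

locale reduced_box_order = box_order +
  fixes \<Delta> :: nat
  assumes Delta_pos: "\<Delta> > 0" and K_pos: "K > 0" and d_pos: "d > 0"
    and reduced: "prime p \<Longrightarrow> \<not> p dvd \<Delta> \<Longrightarrow> x \<in> R \<Longrightarrow> x * x \<in> mulI (of_nat p) \<Longrightarrow> x \<in> mulI (of_nat p)"
begin

lemma ep:
  assumes "is_maximal M" "prime p" "\<not> p dvd \<Delta>" "of_nat p \<in> M"
  shows "ep M \<in> R" "1 - ep M \<in> M" "x \<in> M \<Longrightarrow> ep M * x \<in> mulI (of_nat p)" "ep M \<notin> M"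
proof -
  have "p > 0" using assms(2) prime_gt_0_nat by blast
  have "\<exists>\<epsilon>. \<epsilon> \<in> R \<and> 1 - \<epsilon> \<in> M \<and> (\<forall>x\<in>M. \<epsilon> * x \<in> mulI (of_nat (pr M)))"
    unfolding pr_eq[OF assms(1,2,4)]
    using local_idempotent[OF reduced[OF assms(2,3)] \<open>p > 0\<close> assms(4,1)] by blast
  from someI_ex[OF this]
  show *: "ep M \<in> R" "1 - ep M \<in> M" "x \<in> M \<Longrightarrow> ep M * x \<in> mulI (of_nat p)"
    unfolding ep_def pr_eq[OF assms(1,2,4)] by blast+
  show "ep M \<notin> M"
  proof
    assume "ep M \<in> M"
    moreover have "is_ideal M" using assms(1) by (simp add: is_maximal_def)
    ultimately have "(1 - ep M) + ep M \<in> M" using *(2) idealD(3) by blast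
    then show False using assms(1) by (simp add: is_maximal_def)
  qed
qed

text \<open>The colon ideal \<open>(I : M)\<close>, tested on the two generators of
  \<open>M\<close>.\<close>

definition quot :: "'a set \<Rightarrow> 'a set \<Rightarrow> 'a set" where
  "quot I M = {x\<in>R. of_nat (pr M) * x \<in> I \<and> (1 - ep M) * x \<in> I}"

text \<open>The idempotents \<open>ep M\<close> are linearly independent over the field with
  \<open>p\<close> elements, so \<open>p\<close> to the number of these \<open>M\<close> is at most
  the number of classes modulo \<open>p\<close>. The latter is bounded by
  \<open>card (Box p) = (2 p + 1) ^ d\<close>, and \<open>2 p + 1 \<le> p ^ 3\<close> accounts for
  the factor 3.\<close>

lemma card_maximal_over:
  assumes p: "prime p" "\<not> p dvd \<Delta>"
  shows "finite {M. is_maximal M \<and> of_nat p \<in> M}" "card {M. is_maximal M \<and> of_nat p \<in> M} \<le> 3 * d"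
proof -
  define F where "F = {M. is_maximal M \<and> of_nat p \<in> M}"
  have p2: "p \<ge> 2" using p prime_ge_2_nat by blast
  have "F \<subseteq> {J. is_ideal J \<and> of_nat p \<in> J}" by (auto simp: F_def is_maximal_def)
  then show fin: "finite {M. is_maximal M \<and> of_nat p \<in> M}"
    using finite_subset[OF _ finite_ideals_containing[of p]] p2 unfolding F_def by simp
  \<comment> \<open>\<open>ep M\<close> sends an element of \<open>M\<close> outside
    \<open>N\<close> into \<open>p R\<close>, hence into \<open>N\<close>; as \<open>N\<close> is
    prime, it contains \<open>ep M\<close>.\<close>
  have other: "ep M \<in> N" if "M \<in> F" "N \<in> F" "M \<noteq> N" for M N
  proof -
    have MN: "is_maximal M" "of_nat p \<in> M" "is_maximal N" "of_nat p \<in> N" using that by (auto simp: F_def)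
    have "\<not> M \<subseteq> N" using MN that(3) unfolding is_maximal_def by blast
    then obtain m where m: "m \<in> M" "m \<notin> N" by blast
    have NI: "is_ideal N" using MN by (simp add: is_maximal_def)
    have "ep M * m \<in> mulI (of_nat p)" using ep(3)[OF MN(1) p MN(2) m(1)] .
    then have "ep M * m \<in> N" using MN(4) by (auto simp: mulI_def intro: idealD(6)[OF NI])
    moreover have "m \<in> R" using m(1) MN(1) idealD(5) by (auto simp: is_maximal_def)
    ultimately show ?thesis using maximal_prime[OF MN(3) ep(1)[OF MN(1) p MN(2)]] m(2) by blast
  qed
  define C where "C = PiE F (\<lambda>_. {..<p})"
  define g where "g c = (\<Sum>M\<in>F. of_nat (c M) * ep M)" for c
  have epR: "ep M \<in> R" if "M \<in> F" for M using that ep(1)[OF _ p] by (auto simp: F_def)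
  have sumR: "(\<Sum>M\<in>G. h M) \<in> J" if "is_ideal J" "\<And>M. M \<in> G \<Longrightarrow> h M \<in> J" for G h J
    using that(2) by (induction G rule: infinite_finite_induct) (auto intro: idealD[OF that(1)])
  have key: "c = c'" if c: "c \<in> C" "c' \<in> C" "g c - g c' \<in> mulI (of_nat p)" for c c'
  proof (rule PiE_ext[OF c(1,2)[unfolded C_def]])
    fix N assume N: "N \<in> F"
    then have NM: "is_maximal N" "of_nat p \<in> N" by (auto simp: F_def)
    have NI: "is_ideal N" using NM by (simp add: is_maximal_def)
    have "g c - g c' = (\<Sum>M\<in>F. of_int (int (c M) - int (c' M)) * ep M)"
      unfolding g_def by (simp add: sum_subtractf left_diff_distrib)
    also have "\<dots> = of_int (int (c N) - int (c' N)) * ep N + (\<Sum>M\<in>F-{N}. of_int (int (c M) - int (c' M)) * ep M)"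
      using fin N by (intro sum.remove) (auto simp: F_def)
    finally have eq: "of_int (int (c N) - int (c' N)) * ep N = (g c - g c') - (\<Sum>M\<in>F-{N}. of_int (int (c M) - int (c' M)) * ep M)"
      by simp
    have "g c - g c' \<in> N" using c(3) NM(2) by (auto simp: mulI_def intro: idealD(6)[OF NI])
    moreover have "(\<Sum>M\<in>F-{N}. of_int (int (c M) - int (c' M)) * ep M) \<in> N"
      using other N by (intro sumR NI idealD(4)[OF NI of_int_R]) auto
    ultimately have "of_int (int (c N) - int (c' N)) * ep N \<in> N" unfolding eq by (rule idealD(8)[OF NI])
    then have "of_int (int (c N) - int (c' N)) \<in> N"
      using maximal_prime[OF NM(1) of_int_R epR[OF N]] ep(4)[OF NM(1) p NM(2)] by blast
    then have "int p dvd int (c N) - int (c' N)" using of_int_mem_maximal[OF NM(1) p(1) NM(2)] by blast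
    moreover have "c N < p" "c' N < p" using c N by (auto simp: C_def PiE_def)
    ultimately show "c N = c' N"
      using zdvd_not_zless[of "int (c N) - int (c' N)" "int p"] zdvd_not_zless[of "int (c' N) - int (c N)" "int p"]
      by (metis (no_types, opaque_lifting) dvd_minus_iff int_ops(6) linorder_neqE_linordered_idom minus_diff_eq mod_eq_dvd_iff mod_pos_pos_trivial of_nat_0_le_iff of_nat_less_iff of_nat_eq_iff)
  qed
  have inj: "inj_on g C"
    using key zero_R idealD(2)[OF is_ideal_mulI[of "of_nat p"]] by (auto intro!: inj_onI)
  have "index_le (mulI (of_nat p)) (card (Box p))"
    using R_mod p2 finite_Box by (intro index_leI is_ideal_mulI) auto
  moreover have "incong (mulI (of_nat p)) (g ` C)"
    unfolding incong_def
  proof (intro conjI ballI impI)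
    show "finite (g ` C)" unfolding C_def using fin by (intro finite_imageI finite_PiE) (auto simp: F_def)
    show "g ` C \<subseteq> R" unfolding g_def using epR by (auto intro!: sumR is_ideal_R)
    show "x = y" if "x \<in> g ` C" "y \<in> g ` C" "x - y \<in> mulI (of_nat p)" for x y using that key by auto
  qed
  ultimately have "card (g ` C) \<le> card (Box p)" by (auto simp: index_le_def)
  then have "p ^ card F \<le> (2 * p + 1) ^ d"
    using card_image[OF inj] fin by (simp add: C_def card_PiE card_Box F_def)
  also have "2 * p + 1 \<le> p ^ 3"
  proof -
    have "2 * p + 1 \<le> 4 * p" using p2 by simp
    also have "\<dots> \<le> p * p * p" using mult_le_mono[OF p2 p2] by (intro mult_le_mono1) simp
    finally show ?thesis by (simp add: power3_eq_cube)
  qed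
  then have "(2 * p + 1) ^ d \<le> p ^ (3 * d)" by (simp add: power_mult power_mono)
  finally have "p ^ card F \<le> p ^ (3 * d)" by simp
  then show "card {M. is_maximal M \<and> of_nat p \<in> M} \<le> 3 * d"
    using p2 by (simp add: F_def power_increasing_iff)
qed

end

context reduced_box_order
begin

text \<open>Division of an ideal by a maximal ideal: the local idempotent \<open>ep M\<close> makes \<open>M\<close>
  the ideal generated by the prime and \<open>1 - ep M\<close>, and \<open>M\<close> is invertible.\<close>

lemma is_ideal_quot:
  assumes "is_maximal M" "prime p" "\<not> p dvd \<Delta>" "of_nat p \<in> M" "is_ideal I"
  shows "is_ideal (quot I M)"
proof -
  have e: "1 - ep M \<in> R" using ep(1)[OF assms(1-4)] by simp
  note D = idealD[OF assms(5)]
  show ?thesis unfolding is_ideal_def quot_def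
  proof (intro conjI ballI; (intro CollectI conjI)?)
    fix x y assume "x \<in> {x \<in> R. of_nat (pr M) * x \<in> I \<and> (1 - ep M) * x \<in> I}" "y \<in> {x \<in> R. of_nat (pr M) * x \<in> I \<and> (1 - ep M) * x \<in> I}"
    then have h: "x \<in> R" "of_nat (pr M) * x \<in> I" "(1 - ep M) * x \<in> I" "y \<in> R" "of_nat (pr M) * y \<in> I" "(1 - ep M) * y \<in> I" by auto
    then show "x + y \<in> R" by simp
    show "of_nat (pr M) * (x + y) \<in> I" "(1 - ep M) * (x + y) \<in> I"
      using D(3)[OF h(2,5)] D(3)[OF h(3,6)] by (simp_all only: distrib_left)
  next
    fix r x assume r: "r \<in> R" and "x \<in> {x \<in> R. of_nat (pr M) * x \<in> I \<and> (1 - ep M) * x \<in> I}"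
    then have h: "x \<in> R" "of_nat (pr M) * x \<in> I" "(1 - ep M) * x \<in> I" by auto
    then show "r * x \<in> R" using r by simp
    show "of_nat (pr M) * (r * x) \<in> I" "(1 - ep M) * (r * x) \<in> I"
      using D(4)[OF r h(2)] D(4)[OF r h(3)] by (simp_all only: mult.left_commute)
  qed (use D in auto)
qed

lemma quot_superset:
  assumes "is_maximal M" "prime p" "\<not> p dvd \<Delta>" "of_nat p \<in> M" "is_ideal I"
  shows "I \<subseteq> quot I M"
  using ep(1)[OF assms(1-4)] idealD[OF assms(5)] by (auto simp: quot_def)

text \<open>For \<open>x\<close> in \<open>I\<close> write \<open>ep M * x = p z\<close>. Cancelling
  \<open>p\<close> in \<open>p (1 - ep M) z = ep M (1 - ep M) x = p w x\<close> shows that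
  \<open>z\<close> lies in the colon ideal, and \<open>x = p z + (1 - ep M) x\<close> exhibits
  \<open>x\<close> in the product.\<close>

lemma times_max_quot:
  assumes M: "is_maximal M" "prime p" "\<not> p dvd \<Delta>" "of_nat p \<in> M" and I: "is_ideal I" "I \<subseteq> M"
  shows "times_max M (quot I M) = I"
    and "x \<in> I \<Longrightarrow> \<exists>z\<in>quot I M. ep M * x = of_nat p * z"
proof -
  note D = idealD[OF I(1)]
  note E = ep[OF M]
  have p0: "p > 0" using M(2) prime_gt_0_nat by blast
  have prM: "pr M = p" using pr_eq[OF M(1,2,4)] .
  have z: "\<exists>z\<in>quot I M. ep M * x = of_nat p * z" if x: "x \<in> I" for x
  proof -
    have "ep M * x \<in> mulI (of_nat p)" using E(3) x I(2) by blast
    then obtain z where z: "z \<in> R" "ep M * x = of_nat p * z" by (auto simp: mulI_def)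
    have "ep M * (1 - ep M) \<in> mulI (of_nat p)" using E(2,3) by blast
    then obtain w where w: "w \<in> R" "ep M * (1 - ep M) = of_nat p * w" by (auto simp: mulI_def)
    have "of_nat p * z \<in> I" unfolding z(2)[symmetric] using D(4)[OF E(1) x] .
    moreover have pzw: "of_nat p * ((1 - ep M) * z) = of_nat p * (w * x)"
    proof -
      have "of_nat p * ((1 - ep M) * z) = (1 - ep M) * (ep M * x)" unfolding z(2) by (simp add: mult_ac)
      also have "\<dots> = (ep M * (1 - ep M)) * x" by (simp add: mult_ac)
      also have "\<dots> = of_nat p * (w * x)" unfolding w(2) by (simp add: mult_ac)
      finally show ?thesis .
    qed
    have R: "(1 - ep M) * z \<in> R" "w * x \<in> R" using E(1) z(1) w(1) D(5)[OF x] by auto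
    have "(1 - ep M) * z = w * x"
      by (rule of_nat_cancel[OF R p0 pzw])
    then have "(1 - ep M) * z \<in> I" using D(4)[OF w(1) x] by simp
    ultimately have "z \<in> quot I M" using z(1) prM by (simp add: quot_def)
    with z(2) show ?thesis by blast
  qed
  then show "x \<in> I \<Longrightarrow> \<exists>z\<in>quot I M. ep M * x = of_nat p * z" .
  show "times_max M (quot I M) = I"
  proof
    show "times_max M (quot I M) \<subseteq> I" unfolding times_max_def quot_def using D(3) by auto
    show "I \<subseteq> times_max M (quot I M)"
    proof
      fix x assume x: "x \<in> I"
      from z[OF x] obtain y where y: "y \<in> quot I M" "ep M * x = of_nat p * y" by blast
      have "x = of_nat p * y + (1 - ep M) * x" unfolding y(2)[symmetric] by (simp add: algebra_simps)
      moreover have "x \<in> quot I M" using quot_superset[OF M I(1)] x by blast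
      ultimately show "x \<in> times_max M (quot I M)" unfolding times_max_def prM using y(1) by blast
    qed
  qed
qed

text \<open>If \<open>(I : M) = I\<close>, dividing \<open>ep M * x\<close> by \<open>p\<close>
  stays inside \<open>I\<close> and can be iterated, so \<open>ep M ^ k * n\<close> lies in
  \<open>p ^ k I\<close> for all \<open>k\<close>. Once \<open>p ^ k\<close> exceeds the
  \<open>p\<close>-part of \<open>n\<close>, a product of powers of \<open>ep M\<close> and an
  integer prime to \<open>p\<close> falls into \<open>M\<close>, a contradiction.\<close>

lemma quot_neq:
  assumes M: "is_maximal M" "prime p" "\<not> p dvd \<Delta>" "of_nat p \<in> M" and I: "is_ideal I" "I \<subseteq> M"
    and n: "n > 0" "of_nat n \<in> I"
  shows "quot I M \<noteq> I"
proof
  assume eq: "quot I M = I"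
  note E = ep[OF M]
  have p0: "p > 0" using M(2) prime_gt_0_nat by blast
  have MI: "is_ideal M" using M(1) by (simp add: is_maximal_def)
  have pow: "\<exists>z\<in>I. ep M ^ k * of_nat n = of_nat (p ^ k) * z" for k
  proof (induction k)
    case 0 then show ?case using n by auto
  next
    case (Suc k)
    then obtain z where z: "z \<in> I" "ep M ^ k * of_nat n = of_nat (p ^ k) * z" by blast
    obtain y where y: "y \<in> I" "ep M * z = of_nat p * y"
      using times_max_quot(2)[OF M I z(1)] unfolding eq by blast
    have "ep M ^ Suc k * of_nat n = ep M * (of_nat (p ^ k) * z)" unfolding z(2)[symmetric] by (simp add: mult_ac)
    also have "\<dots> = of_nat (p ^ k) * (ep M * z)" by (simp add: mult_ac)
    also have "\<dots> = of_nat (p ^ Suc k) * y" unfolding y(2) by (simp add: mult_ac)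
    finally show ?case using y(1) by blast
  qed
  obtain a m where am: "n = p ^ a * m" "\<not> p dvd m"
  proof (rule multiplicity_decompose')
    show "n \<noteq> 0" "\<not> is_unit p" using n(1) M(2) not_prime_unit by auto
  qed
  obtain z where z: "z \<in> I" "ep M ^ Suc a * of_nat n = of_nat (p ^ Suc a) * z" using pow by blast
  have "of_nat (p ^ a) * (ep M ^ Suc a * of_nat m) = of_nat (p ^ a) * (of_nat p * z)"
    using z(2) unfolding am(1) by (simp add: mult_ac)
  moreover have "ep M ^ Suc a * of_nat m \<in> R" "of_nat p * z \<in> R"
    using E(1) idealD(5)[OF I(1) z(1)] by (auto simp del: power_Suc)
  ultimately have "ep M ^ Suc a * of_nat m = of_nat p * z"
    using p0 of_nat_cancel[of _ _ "p ^ a"] by (simp del: of_nat_power power_Suc)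
  also have "\<dots> \<in> M" using idealD(6)[OF MI idealD(5)[OF I(1) z(1)] M(4)] .
  finally have *: "ep M ^ Suc a * of_nat m \<in> M" .
  have "of_nat m \<notin> M" using of_int_mem_maximal[OF M(1,2,4), of "int m"] am(2) by simp
  with * have "ep M ^ Suc a \<in> M" using maximal_prime[OF M(1) _ _ *] E(1) by auto
  moreover have "ep M ^ k \<notin> M" for k
  proof (induction k)
    case 0 then show ?case using M(1) by (simp add: is_maximal_def)
  next
    case (Suc k) then show ?case using maximal_prime[OF M(1), of "ep M" "ep M ^ k"] E(1,4) by auto
  qed
  ultimately show False by blast
qed

lemma prime_le_index:
  assumes M: "is_maximal M" "prime p" "of_nat p \<in> M" and "index_le M t"
  shows "p \<le> t"
proof -
  have MI: "is_ideal M" using M(1) by (simp add: is_maximal_def)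
  have eq: "i = j" if "i < p" "j < p" "of_nat i - of_nat j \<in> M" for i j
  proof -
    have "of_int (int i - int j) \<in> M" using that by simp
    then have "int p dvd int i - int j" using of_int_mem_maximal[OF M] by blast
    then have "int i mod int p = int j mod int p" by (simp add: mod_eq_dvd_iff)
    with that show ?thesis by simp
  qed
  have "inj_on (of_nat :: nat \<Rightarrow> 'a) {..<p}"
    using eq idealD(2)[OF MI] by (auto intro!: inj_onI)
  moreover have "incong M (of_nat ` {..<p})" unfolding incong_def using eq by auto
  ultimately show ?thesis using assms(4) by (auto simp: index_le_def card_image)
qed

text \<open>\<open>(I : M) / I\<close> is a nonzero vector space over \<open>R / M\<close>, and this
  field has at least \<open>p ^ 2\<close> elements because the class of \<open>y\<close> is not in
  the prime field. Concretely, the \<open>p ^ 2\<close> multiples \<open>(i + j y) y0\<close> are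
  incongruent modulo \<open>I\<close>.\<close>

lemma index_quot:
  assumes M: "is_maximal M" "prime p" "\<not> p dvd \<Delta>" "of_nat p \<in> M" and I: "is_ideal I" "I \<subseteq> M"
    and n: "n > 0" "of_nat n \<in> I" and t: "index_le I t"
    and y: "y \<in> R" "\<And>k. y - of_nat k \<notin> M"
  shows "index_le (quot I M) (t div p\<^sup>2)"
  unfolding index_le_def
proof (intro allI impI)
  fix S assume S: "incong (quot I M) S"
  have p0: "p > 0" using M(2) prime_gt_0_nat by blast
  have MI: "is_ideal M" using M(1) by (simp add: is_maximal_def)
  have prM: "pr M = p" using pr_eq[OF M(1,2,4)] .
  note E = ep[OF M]
  note D = idealD[OF I(1)]
  note Q = idealD[OF is_ideal_quot[OF M I(1)]]
  obtain y0 where y0: "y0 \<in> quot I M" "y0 \<notin> I"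
    using quot_superset[OF M I(1)] quot_neq[OF M I n] by blast
  \<comment> \<open>The annihilator of \<open>y0\<close> modulo \<open>I\<close> contains
    \<open>M\<close> but not 1, so it equals \<open>M\<close>: the element \<open>y0\<close> spans a
    copy of \<open>R / M\<close>.\<close>
  define Ann where "Ann = {r\<in>R. r * y0 \<in> I}"
  have "is_ideal Ann" unfolding is_ideal_def Ann_def
    using D by (auto simp: distrib_right mult.assoc)
  moreover have "M \<subseteq> Ann"
  proof
    fix m assume m: "m \<in> M"
    obtain w where w: "w \<in> R" "ep M * m = of_nat p * w" using E(3)[OF m] by (auto simp: mulI_def)
    have "m * y0 = m * ((1 - ep M) * y0) + (ep M * m) * y0" by (simp add: algebra_simps)
    also have "\<dots> = m * ((1 - ep M) * y0) + w * (of_nat p * y0)" unfolding w(2) by (simp add: mult_ac)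
    also have "\<dots> \<in> I" using y0(1) w(1) idealD(5)[OF MI m] D(3,4) unfolding quot_def prM by blast
    finally show "m \<in> Ann" using idealD(5)[OF MI m] by (simp add: Ann_def)
  qed
  moreover have "1 \<notin> Ann" using y0(2) by (simp add: Ann_def)
  ultimately have Ann: "Ann = M" using M(1) by (auto simp: is_maximal_def)
  define f where "f = (\<lambda>(s, i, j). s + (of_nat i + of_nat j * y) * y0 :: 'a)"
  define T where "T = S \<times> {..<p} \<times> {..<p}"
  have key: "a = b" if ab: "a \<in> T" "b \<in> T" and d: "f a - f b \<in> I" for a b
  proof -
    obtain s i j where a: "a = (s, i, j)" "s \<in> S" "i < p" "j < p" using ab(1) by (auto simp: T_def)
    obtain s' i' j' where b: "b = (s', i', j')" "s' \<in> S" "i' < p" "j' < p" using ab(2) by (auto simp: T_def)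
    define r where "r = of_int (int i - int i') + of_int (int j - int j') * y"
    have r: "r \<in> R" unfolding r_def using y(1) by (intro add_R mult_R of_int_R)
    have fab: "f a - f b = (s - s') + r * y0" unfolding a b f_def r_def by (simp add: algebra_simps)
    have "f a - f b \<in> quot I M" using d quot_superset[OF M I(1)] by blast
    then have "(f a - f b) - r * y0 \<in> quot I M" using Q(8) Q(4)[OF r y0(1)] by blast
    then have "s - s' \<in> quot I M" unfolding fab by simp
    with S a b have ss: "s = s'" by (auto simp: incong_def)
    then have "r * y0 \<in> I" using d unfolding fab by simp
    then have rM: "r \<in> M" using r Ann by (auto simp: Ann_def)
    \<comment> \<open>Otherwise \<open>j - j'\<close> could be inverted modulo \<open>p\<close>, and
      \<open>r \<in> M\<close> would make \<open>y\<close> congruent to an integer.\<close>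
    have jj: "j = j'"
    proof (rule ccontr)
      assume "j \<noteq> j'"
      then have "int j mod int p \<noteq> int j' mod int p" using a(4) b(4) by simp
      then have "\<not> int p dvd int j - int j'" by (simp add: mod_eq_dvd_iff)
      then have "coprime (int j - int j') (int p)"
        using M(2) by (metis coprime_commute prime_imp_coprime prime_nat_int_transfer)
      then obtain u v where uv: "u * (int j - int j') + v * int p = 1" by (metis bezout_int coprime_imp_gcd_eq_1)
      define z where "z = - (u * (int i - int i'))"
      have "of_int u * r = y - of_int z - of_int v * of_nat p * y"
      proof -
        have "of_int u * r = of_int (u * (int j - int j')) * y - of_int z"
          unfolding r_def z_def by (simp add: algebra_simps)
        also have "u * (int j - int j') = 1 - v * int p" using uv by simp
        finally show ?thesis by (simp add: algebra_simps)
      qed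
      then have "y - of_int z = of_int u * r + (of_int v * y) * of_nat p" by (simp add: algebra_simps)
      also have "\<dots> \<in> M" using rM M(4) y(1) by (intro idealD(3,4)[OF MI]) auto
      finally have 1: "y - of_int z \<in> M" .
      have 2: "of_int (z - z mod int p) \<in> M"
        using of_int_mem_maximal[OF M(1,2,4), of "z - z mod int p"] by (simp only: minus_mod_eq_mult_div dvd_triv_left)
      have "y - of_nat (nat (z mod int p)) = (y - of_int z) + of_int (z - z mod int p)"
        using p0 by (simp add: of_nat_nat)
      also have "\<dots> \<in> M" using idealD(3)[OF MI 1 2] .
      finally show False using y(2) by blast
    qed
    then have "of_int (int i - int i') \<in> M" using rM unfolding r_def by simp
    then have "int p dvd int i - int i'" using of_int_mem_maximal[OF M(1,2,4)] by blast
    then have "int i mod int p = int i' mod int p" by (simp add: mod_eq_dvd_iff)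
    with a b have "i = i'" by simp
    with ss jj a b show ?thesis by simp
  qed
  have "inj_on f T" using key D(2) by (auto intro!: inj_onI)
  moreover have "incong I (f ` T)"
    unfolding incong_def
  proof (intro conjI ballI impI)
    show "finite (f ` T)" using S by (auto simp: T_def incong_def)
    show "f ` T \<subseteq> R" using S y(1) Q(5)[OF y0(1)] by (auto simp: T_def f_def incong_def)
    show "a = b" if "a \<in> f ` T" "b \<in> f ` T" "a - b \<in> I" for a b using that key by blast
  qed
  ultimately have "card T \<le> t" using t by (auto simp: index_le_def card_image)
  then have "card S * p\<^sup>2 \<le> t" by (simp add: T_def card_cartesian_product power2_eq_square)
  then show "card S \<le> t div p\<^sup>2" using p0 by (simp add: less_eq_div_iff_mult_less_eq)
qed

section \<open>Factorisation of ideals when no residue field is prime\<close>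

definition max_upto :: "nat \<Rightarrow> 'a set set" where
  "max_upto t = {M. is_maximal M \<and> (\<exists>p\<le>t. prime p \<and> \<not> p dvd \<Delta> \<and> of_nat p \<in> M)}"

definition has_degree_one :: "nat \<Rightarrow> bool" where
  "has_degree_one t \<longleftrightarrow> (\<exists>p M. prime p \<and> \<not> p dvd \<Delta> \<and> p \<le> t \<and> is_maximal M \<and> of_nat p \<in> M
     \<and> (\<forall>x\<in>R. \<exists>k. x - of_nat k \<in> M))"

lemma comp_fun_commute_times_max: "comp_fun_commute times_max"
  by standard (auto simp: times_max_commute fun_eq_iff)

text \<open>Descent on the index: without degree-one ideals, removing a maximal ideal over
  \<open>p\<close> costs a factor \<open>p ^ 2\<close>. The element \<open>y\<close> witnesses that
  \<open>I\<close> is prime to \<open>\<Delta>\<close>, so the maximal ideals met lie over primes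
  not dividing \<open>\<Delta>\<close>. This property and the integer \<open>n\<close> pass to the
  larger ideal \<open>quot I M\<close>.\<close>

lemma ideal_factorization:
  assumes no: "\<not> has_degree_one t0"
  shows "t \<le> t0 \<Longrightarrow> is_ideal I \<Longrightarrow> n > 0 \<Longrightarrow> of_nat n \<in> I \<Longrightarrow> y \<in> R \<Longrightarrow> 1 - of_nat \<Delta> * y \<in> I
    \<Longrightarrow> index_le I t \<Longrightarrow> \<exists>\<mu>. set_mset \<mu> \<subseteq> max_upto t0 \<and> (\<Prod>M\<in>#\<mu>. (pr M)\<^sup>2) \<le> t \<and> fold_mset times_max R \<mu> = I"
proof (induction t arbitrary: I rule: less_induct)
  case (less t)
  have "incong I {0}" by (simp add: incong_def)
  then have "card {0::'a} \<le> t" using less.prems(7) unfolding index_le_def by blast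
  then have t1: "t \<ge> 1" by simp
  show ?case
  proof (cases "1 \<in> I")
    case True
    then have "I = R" by (rule ideal_eq_R[OF less.prems(2)])
    then show ?thesis using t1 by (intro exI[of _ "{#}"] conjI) simp_all
  next
    case False
    obtain M where M: "is_maximal M" "I \<subseteq> M" using maximal_exists[OF less.prems(2,4,3) False] by blast
    have MI: "is_ideal M" using M(1) by (simp add: is_maximal_def)
    obtain p where p: "prime p" "of_nat p \<in> M"
      using maximal_prime_number[OF M(1) less.prems(3)] less.prems(4) M(2) by blast
    have p\<Delta>: "\<not> p dvd \<Delta>"
    proof
      assume "p dvd \<Delta>"
      then obtain k where "\<Delta> = p * k" by blast
      then have "of_nat \<Delta> * y = of_nat p * (of_nat k * y)" by (simp add: mult_ac)
      also have "\<dots> \<in> M" using p(2) less.prems(5) by (intro idealD(6)[OF MI]) auto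
      finally have "(1 - of_nat \<Delta> * y) + of_nat \<Delta> * y \<in> M" using less.prems(6) M(2) idealD(3)[OF MI] by blast
      then show False using M(1) by (simp add: is_maximal_def)
    qed
    have pt: "p \<le> t" using prime_le_index[OF M(1) p] index_le_mono[OF less.prems(7) M(2)] by blast
    then have "\<not> (\<forall>x\<in>R. \<exists>k. x - of_nat k \<in> M)"
      using no less.prems(1) M(1) p p\<Delta> unfolding has_degree_one_def by (meson le_trans)
    then obtain x where x: "x \<in> R" "\<And>k. x - of_nat k \<notin> M" by blast
    note Mp = M(1) p(1) p\<Delta> p(2)
    have sup: "I \<subseteq> quot I M" by (rule quot_superset[OF Mp less.prems(2)])
    have p2: "p \<ge> 2" using p prime_ge_2_nat by blast
    then have "1 * 1 < p\<^sup>2" unfolding power2_eq_square by (intro mult_strict_mono) auto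
    then have lt: "t div p\<^sup>2 < t" using t1 by (intro div_less_dividend) auto
    have "\<exists>\<mu>. set_mset \<mu> \<subseteq> max_upto t0 \<and> (\<Prod>M\<in>#\<mu>. (pr M)\<^sup>2) \<le> t div p\<^sup>2 \<and> fold_mset times_max R \<mu> = quot I M"
    proof (rule less.IH[OF lt])
      show "t div p\<^sup>2 \<le> t0" using lt less.prems(1) by linarith
      show "is_ideal (quot I M)" by (rule is_ideal_quot[OF Mp less.prems(2)])
      show "n > 0" "y \<in> R" by (rule less.prems)+
      show "of_nat n \<in> quot I M" "1 - of_nat \<Delta> * y \<in> quot I M" using sup less.prems by blast+
      show "index_le (quot I M) (t div p\<^sup>2)"
        by (rule index_quot[OF Mp less.prems(2) M(2) less.prems(3,4,7) x])
    qed
    then obtain \<mu> where mu: "set_mset \<mu> \<subseteq> max_upto t0" "(\<Prod>M\<in>#\<mu>. (pr M)\<^sup>2) \<le> t div p\<^sup>2"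
      "fold_mset times_max R \<mu> = quot I M" by blast
    interpret C: comp_fun_commute times_max by (rule comp_fun_commute_times_max)
    have "M \<in> max_upto t0" unfolding max_upto_def using Mp le_trans[OF pt less.prems(1)] by blast
    moreover have "(\<Prod>M\<in>#add_mset M \<mu>. (pr M)\<^sup>2) \<le> t"
    proof -
      have "(\<Prod>M\<in>#add_mset M \<mu>. (pr M)\<^sup>2) = p\<^sup>2 * (\<Prod>M\<in>#\<mu>. (pr M)\<^sup>2)" by (simp add: pr_eq[OF M(1) p])
      also have "\<dots> \<le> p\<^sup>2 * (t div p\<^sup>2)" using mu(2) by simp
      also have "\<dots> \<le> t" by (rule times_div_less_eq_dividend)
      finally show ?thesis .
    qed
    moreover have "fold_mset times_max R (add_mset M \<mu>) = I"
      using times_max_quot(1)[OF Mp less.prems(2) M(2)] mu(3) by simp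
    ultimately show ?thesis using mu(1) by (intro exI[of _ "add_mset M \<mu>"]) auto
  qed
qed

end

section \<open>Primes of degree one\<close>

text \<open>Calibrated for \<open>degree_one_exists\<close>: \<open>2197 = 13 ^ 3\<close> comes from
  the index bound, 7 from the units in \<open>Box 3\<close>, the exponential from the Euler product,
  and the fourth power clears the exponent 3/4.\<close>

definition box_const :: nat where
  "box_const = nat \<lceil>2197 * (7 * exp (6 * zeta_const)) ^ 4\<rceil>"

lemma box_const_ge: "2197 * (7 * exp (6 * zeta_const)) ^ 4 \<le> real box_const"
  unfolding box_const_def by (rule real_nat_ceiling_ge)

lemma box_const_pos: "box_const > 0"
proof -
  have "0 < 2197 * (7 * exp (6 * zeta_const)) ^ 4" by simp
  also note box_const_ge
  finally show ?thesis by simp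
qed

context reduced_box_order
begin

lemma max_upto_pr:
  assumes "M \<in> max_upto t"
  shows "prime (pr M)" "\<not> pr M dvd \<Delta>" "pr M \<le> t" "is_maximal M" "of_nat (pr M) \<in> M"
proof -
  obtain p where p: "is_maximal M" "p \<le> t" "prime p" "\<not> p dvd \<Delta>" "of_nat p \<in> M"
    using assms by (auto simp: max_upto_def)
  then have "pr M = p" using pr_eq by blast
  with p show "prime (pr M)" "\<not> pr M dvd \<Delta>" "pr M \<le> t" "is_maximal M" "of_nat (pr M) \<in> M" by auto
qed

lemma finite_max_upto: "finite (max_upto t)"
proof -
  have "max_upto t \<subseteq> (\<Union>p\<in>{p. p \<le> t \<and> prime p \<and> \<not> p dvd \<Delta>}. {M. is_maximal M \<and> of_nat p \<in> M})"
    by (auto simp: max_upto_def)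
  moreover have "finite (\<Union>p\<in>{p. p \<le> t \<and> prime p \<and> \<not> p dvd \<Delta>}. {M. is_maximal M \<and> of_nat p \<in> M})"
    using card_maximal_over(1) by (intro finite_UN_I) auto
  ultimately show ?thesis by (rule finite_subset)
qed

lemma sum_max_upto_le:
  fixes g :: "nat \<Rightarrow> real"
  assumes "\<And>n. g n \<ge> 0"
  shows "(\<Sum>M\<in>max_upto t. g (pr M)) \<le> 3 * real d * (\<Sum>n\<le>t. g n)"
proof -
  have "(\<Sum>M\<in>max_upto t. g (pr M)) = (\<Sum>p\<in>pr ` max_upto t. \<Sum>M\<in>{M \<in> max_upto t. pr M = p}. g (pr M))"
    by (rule sum.image_gen[OF finite_max_upto])
  also have "\<dots> \<le> (\<Sum>p\<in>pr ` max_upto t. 3 * real d * g p)"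
  proof (rule sum_mono)
    fix p assume "p \<in> pr ` max_upto t"
    then obtain N where N: "N \<in> max_upto t" "p = pr N" by blast
    have p: "prime p" "\<not> p dvd \<Delta>" using max_upto_pr[OF N(1)] N(2) by auto
    have sub: "{M \<in> max_upto t. pr M = p} \<subseteq> {M. is_maximal M \<and> of_nat p \<in> M}" using max_upto_pr by blast
    have "card {M \<in> max_upto t. pr M = p} \<le> 3 * d"
      using card_mono[OF card_maximal_over(1)[OF p] sub] card_maximal_over(2)[OF p] by linarith
    then have "real (card {M \<in> max_upto t. pr M = p}) \<le> 3 * real d" by linarith
    then have "real (card {M \<in> max_upto t. pr M = p}) * g p \<le> 3 * real d * g p"
      using assms by (intro mult_right_mono) auto
    moreover have "(\<Sum>M\<in>{M \<in> max_upto t. pr M = p}. g (pr M)) = real (card {M \<in> max_upto t. pr M = p}) * g p"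
      by simp
    ultimately show "(\<Sum>M\<in>{M \<in> max_upto t. pr M = p}. g (pr M)) \<le> 3 * real d * g p" by simp
  qed
  also have "\<dots> \<le> (\<Sum>p\<in>{..t}. 3 * real d * g p)"
    using assms max_upto_pr(3) by (intro sum_mono2) auto
  finally show ?thesis by (simp add: sum_distrib_left)
qed

text \<open>The weight \<open>p ^ 2\<close> contributes \<open>p powr (-3/2)\<close>, at most 1/2.
  In the constant, \<open>6 = 2 * 3\<close>: a factor 2 from
  \<open>1 / (1 - x) \<le> exp (2 * x)\<close>, and 3 from the bound \<open>3 * d\<close> for the
  maximal ideals over one prime.\<close>

lemma euler_product_le:
  "(\<Prod>M\<in>max_upto t. 1 / (1 - real ((pr M)\<^sup>2) powr (-3/4))) \<le> exp (6 * zeta_const) ^ d"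
proof -
  have x: "real ((pr M)\<^sup>2) powr (-3/4) = real (pr M) powr (-3/2)"
    "0 \<le> real (pr M) powr (-3/2)" "real (pr M) powr (-3/2) \<le> 1/2" if "M \<in> max_upto t" for M
  proof -
    have p2: "pr M \<ge> 2" using max_upto_pr[OF that] prime_ge_2_nat by blast
    have "real ((pr M)\<^sup>2) = real (pr M) powr 2" using p2 by simp
    then show "real ((pr M)\<^sup>2) powr (-3/4) = real (pr M) powr (-3/2)" by (simp only: powr_powr) simp
    show "0 \<le> real (pr M) powr (-3/2)" by simp
    have "real (pr M) powr (-3/2) \<le> real (pr M) powr (-1)" using p2 by (intro powr_mono) auto
    also have "\<dots> = 1 / real (pr M)" using p2 by (simp add: powr_minus_divide)
    also have "\<dots> \<le> 1 / 2" using p2 by (intro divide_left_mono) auto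
    finally show "real (pr M) powr (-3/2) \<le> 1/2" .
  qed
  have "(\<Prod>M\<in>max_upto t. 1 / (1 - real ((pr M)\<^sup>2) powr (-3/4))) \<le> (\<Prod>M\<in>max_upto t. exp (2 * real (pr M) powr (-3/2)))"
  proof (rule prod_mono)
    fix M assume M: "M \<in> max_upto t"
    show "0 \<le> 1 / (1 - real ((pr M)\<^sup>2) powr (-3/4)) \<and> 1 / (1 - real ((pr M)\<^sup>2) powr (-3/4)) \<le> exp (2 * real (pr M) powr (-3/2))"
      unfolding x(1)[OF M] using inverse_one_minus_le_exp[OF x(2,3)[OF M]] x(3)[OF M] by auto
  qed
  also have "\<dots> = exp (\<Sum>M\<in>max_upto t. 2 * real (pr M) powr (-3/2))"
    by (simp add: exp_sum finite_max_upto)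
  also have "\<dots> \<le> exp (3 * real d * (2 * zeta_const))"
  proof (rule exp_mono)
    have "(\<Sum>M\<in>max_upto t. 2 * real (pr M) powr (-3/2)) \<le> 3 * real d * (\<Sum>n\<le>t. 2 * real n powr (-3/2))"
      by (rule sum_max_upto_le) simp
    also have "(\<Sum>n\<le>t. 2 * real n powr (-3/2)) = 2 * (\<Sum>n\<le>t. real n powr (-3/2))" by (simp add: sum_distrib_left)
    also have "3 * real d * (2 * (\<Sum>n\<le>t. real n powr (-3/2))) \<le> 3 * real d * (2 * zeta_const)"
      unfolding zeta_const_def by (intro mult_left_mono sum_le_suminf[OF summable_zeta]) auto
    finally show "(\<Sum>M\<in>max_upto t. 2 * real (pr M) powr (-3/2)) \<le> 3 * real d * (2 * zeta_const)" .
  qed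
  also have "exp (3 * real d * (2 * zeta_const)) = exp (6 * zeta_const) ^ d"
    by (simp flip: exp_of_nat_mult add: mult_ac)
  finally show ?thesis .
qed

lemma ideals_few:
  assumes "\<not> has_degree_one t"
  shows "\<exists>F. finite F \<and> real (card F) \<le> real t powr (3/4) * exp (6 * zeta_const) ^ d \<and>
    (\<forall>I n y. is_ideal I \<longrightarrow> n > 0 \<longrightarrow> of_nat n \<in> I \<longrightarrow> y \<in> R \<longrightarrow> 1 - of_nat \<Delta> * y \<in> I \<longrightarrow> index_le I t \<longrightarrow> I \<in> F)"
proof -
  define U where "U = {\<mu>. set_mset \<mu> \<subseteq> max_upto t \<and> (\<Prod>M\<in>#\<mu>. (pr M)\<^sup>2) \<le> t}"
  have w: "(pr M)\<^sup>2 \<ge> 2" if "M \<in> max_upto t" for M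
  proof -
    have "2 \<le> pr M" using max_upto_pr(1)[OF that] prime_ge_2_nat by blast
    then have "2 * 2 \<le> pr M * pr M" by (intro mult_le_mono) auto
    then show ?thesis by (simp add: power2_eq_square)
  qed
  have U: "finite U" "real (card U) \<le> real t powr (3/4) * (\<Prod>M\<in>max_upto t. 1 / (1 - real ((pr M)\<^sup>2) powr (-3/4)))"
    using card_multisets_prod_le[of "max_upto t" "\<lambda>M. (pr M)\<^sup>2" t, OF finite_max_upto w] unfolding U_def by auto
  have "real (card U) \<le> real t powr (3/4) * exp (6 * zeta_const) ^ d"
    by (rule order_trans[OF U(2)]) (intro mult_left_mono euler_product_le, simp)
  moreover have "card (fold_mset times_max R ` U) \<le> card U" using U(1) by (rule card_image_le)
  ultimately have "real (card (fold_mset times_max R ` U)) \<le> real t powr (3/4) * exp (6 * zeta_const) ^ d" by linarith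
  moreover have "I \<in> fold_mset times_max R ` U" if "is_ideal I" "n > 0" "of_nat n \<in> I" "y \<in> R"
    "1 - of_nat \<Delta> * y \<in> I" "index_le I t" for I n y
    using ideal_factorization[OF assms order_refl that] unfolding U_def by (auto simp: image_iff)
  ultimately show ?thesis using U(1) by (intro exI[of _ "fold_mset times_max R ` U"]) auto
qed

lemma has_degree_one_mono: "has_degree_one s \<Longrightarrow> s \<le> t \<Longrightarrow> has_degree_one t"
  unfolding has_degree_one_def by (meson order_trans)

lemma integer_in_finite_index:
  assumes "is_ideal I" "index_le I t"
  shows "\<exists>n>0. of_nat n \<in> I"
proof (rule ccontr)
  assume no: "\<not> (\<exists>n>0. of_nat n \<in> I)"
  have eq: "i = j" if "of_nat i - of_nat j \<in> I" for i j
  proof (rule ccontr)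
    assume "i \<noteq> j"
    then consider "i < j" | "j < i" by linarith
    then show False
    proof cases
      case 1
      then have "of_nat (j - i) = - (of_nat i - of_nat j :: 'a)" by (simp add: of_nat_diff)
      also have "\<dots> \<in> I" using idealD(7)[OF assms(1) that] .
      finally show False using no 1 zero_less_diff by blast
    next
      case 2
      then have "of_nat (i - j) = (of_nat i - of_nat j :: 'a)" by (simp add: of_nat_diff)
      with that have "of_nat (i - j) \<in> I" by simp
      then show False using no 2 zero_less_diff by blast
    qed
  qed
  have "inj_on (of_nat :: nat \<Rightarrow> 'a) {..t}" using eq idealD(2)[OF assms(1)] by (auto intro!: inj_onI)
  moreover have "incong I (of_nat ` {..t})" unfolding incong_def using eq by auto
  ultimately have "Suc t \<le> t" using assms(2) by (auto simp: index_le_def card_image)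
  then show False by simp
qed

text \<open>There are \<open>(2 Z + 1) ^ d\<close> generators, at most \<open>7 ^ d\<close> of them
  for each ideal. Comparing with the bound for the number of ideals and removing the
  \<open>d\<close>-th power leaves
  \<open>(2 Z + 1) ^ 4 \<le> (7 E) ^ 4 (13 K \<Delta> Z) ^ 3\<close>. \<open>Z\<close> is chosen so
  that the right side is at most \<open>Z ^ 4\<close>.\<close>

theorem degree_one_exists: "has_degree_one ((13 * box_const * (K * \<Delta>) ^ 4) ^ d)"
proof (rule ccontr)
  define E where "E = exp (6 * zeta_const)"
  define Z where "Z = box_const * (K * \<Delta>) ^ 3"
  \<comment> \<open>The summand 1 makes \<open>Y\<close>, and with it every
    \<open>Y + \<Delta> \<eta>\<close>, congruent to 1 modulo \<open>\<Delta>\<close>. The other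
    summand ensures the contraction condition for perturbations in
    \<open>Box (\<Delta> * Z)\<close>.\<close>
  define Y where "Y = 2 * K * (\<Delta> * Z) + 1"
  define T where "T = (4 * Y + 1) ^ d"
  have E0: "E > 0" by (simp add: E_def)
  have KD: "K * \<Delta> > 0" using K_pos Delta_pos by simp
  then have Z0: "Z > 0" using box_const_pos by (simp add: Z_def)
  have KDZ: "K * \<Delta> * Z = box_const * (K * \<Delta>) ^ 4" by (simp add: Z_def power_numeral_reduce)
  have Y13: "4 * Y + 1 \<le> 13 * (K * \<Delta> * Z)" using KD Z0 by (simp add: Y_def Suc_le_eq)
  have "T \<le> (13 * box_const * (K * \<Delta>) ^ 4) ^ d"
    unfolding T_def using Y13 KDZ by (intro power_mono) (auto simp: mult.assoc)
  moreover assume "\<not> has_degree_one ((13 * box_const * (K * \<Delta>) ^ 4) ^ d)"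
  ultimately have no: "\<not> has_degree_one T" using has_degree_one_mono by blast
  obtain F where F: "finite F" "real (card F) \<le> real T powr (3/4) * E ^ d"
    "\<And>I n y. is_ideal I \<Longrightarrow> n > 0 \<Longrightarrow> of_nat n \<in> I \<Longrightarrow> y \<in> R \<Longrightarrow> 1 - of_nat \<Delta> * y \<in> I \<Longrightarrow> index_le I T \<Longrightarrow> I \<in> F"
    using ideals_few[OF no] unfolding E_def by blast
  define th where "th \<eta> = of_nat Y + of_nat \<Delta> * \<eta>" for \<eta> :: 'a
  have DB: "of_nat \<Delta> * \<eta> \<in> Box (\<Delta> * Z)" if "\<eta> \<in> Box Z" for \<eta> using scale_Box[OF that] .
  have Y0: "Y > 0" and KH: "2 * K * (\<Delta> * Z) \<le> Y" by (simp_all add: Y_def)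
  have HY: "\<Delta> * Z \<le> Y" using K_pos unfolding Y_def by (simp add: le_SucI trans_le_add1)
  have thR: "th \<eta> \<in> R" if "\<eta> \<in> Box Z" for \<eta> using R_I[OF that] by (simp add: th_def)
  have idF: "mulI (th \<eta>) \<in> F" if \<eta>: "\<eta> \<in> Box Z" for \<eta>
  proof -
    have I: "is_ideal (mulI (th \<eta>))" using thR[OF \<eta>] by (rule is_ideal_mulI)
    have ix: "index_le (mulI (th \<eta>)) T"
      unfolding th_def T_def using near_scalar_index[OF Y0 DB[OF \<eta>] KH] .
    obtain n where n: "n > 0" "of_nat n \<in> mulI (th \<eta>)" using integer_in_finite_index[OF I ix] by blast
    have "1 - of_nat \<Delta> * (- (of_nat (2 * K * Z) + \<eta>)) = th \<eta> * 1"
      unfolding th_def Y_def by (simp add: algebra_simps)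
    also have "\<dots> \<in> mulI (th \<eta>)" by (rule mulI_I) simp
    finally have "1 - of_nat \<Delta> * (- (of_nat (2 * K * Z) + \<eta>)) \<in> mulI (th \<eta>)" .
    then show ?thesis using F(3)[OF I n _ _ ix] R_I[OF \<eta>] by (metis add_R of_nat_R uminus_R)
  qed
  have th_inj: "\<eta> = \<eta>'" if "\<eta> \<in> Box Z" "\<eta>' \<in> Box Z" "th \<eta> = th \<eta>'" for \<eta> \<eta>'
    using of_nat_cancel[OF R_I[OF that(1)] R_I[OF that(2)] Delta_pos] that(3) unfolding th_def by simp
  have fib: "card {\<eta>\<in>Box Z. mulI (th \<eta>) = I} \<le> 7 ^ d" for I
  proof (cases "{\<eta>\<in>Box Z. mulI (th \<eta>) = I} = {}")
    case True
    show ?thesis unfolding True by simp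
  next
    case False
    then obtain \<eta>0 where e0: "\<eta>0 \<in> Box Z" "mulI (th \<eta>0) = I" by blast
    have ex: "\<exists>u. u \<in> Box 3 \<and> th \<eta> = th \<eta>0 * u" if \<eta>: "\<eta> \<in> Box Z" "mulI (th \<eta>) = I" for \<eta>
    proof -
      have "th \<eta> * 1 \<in> mulI (th \<eta>)" by (rule mulI_I) simp
      then have "th \<eta> \<in> mulI (th \<eta>0)" using \<eta> e0 by simp
      then obtain u where u: "u \<in> R" "th \<eta> = th \<eta>0 * u" by (auto simp: mulI_def)
      have "u \<in> Box 3"
        using near_scalar_unit[OF Y0 DB[OF e0(1)] DB[OF \<eta>(1)] KH HY u(1)] u(2) unfolding th_def by blast
      with u show ?thesis by blast
    qed
    then obtain u where u: "\<And>\<eta>. \<eta> \<in> Box Z \<Longrightarrow> mulI (th \<eta>) = I \<Longrightarrow> u \<eta> \<in> Box 3 \<and> th \<eta> = th \<eta>0 * u \<eta>" by metis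
    have "inj_on u {\<eta>\<in>Box Z. mulI (th \<eta>) = I}"
    proof (rule inj_onI)
      fix a b assume a: "a \<in> {\<eta>\<in>Box Z. mulI (th \<eta>) = I}" and b: "b \<in> {\<eta>\<in>Box Z. mulI (th \<eta>) = I}" and "u a = u b"
      then have "th a = th b" using u[of a] u[of b] by auto
      then show "a = b" using th_inj a b by blast
    qed
    then have "card {\<eta>\<in>Box Z. mulI (th \<eta>) = I} \<le> card (Box 3)"
      using u finite_Box by (intro card_inj_on_le[of u]) auto
    then show ?thesis by (simp add: card_Box)
  qed
  have "Box Z \<subseteq> (\<Union>I\<in>F. {\<eta>\<in>Box Z. mulI (th \<eta>) = I})" using idF by auto
  then have "card (Box Z) \<le> card (\<Union>I\<in>F. {\<eta>\<in>Box Z. mulI (th \<eta>) = I})"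
    using F(1) finite_Box[of Z] by (intro card_mono finite_UN_I) auto
  also have "\<dots> \<le> (\<Sum>I\<in>F. card {\<eta>\<in>Box Z. mulI (th \<eta>) = I})" by (rule card_UN_le[OF F(1)])
  also have "\<dots> \<le> (\<Sum>I\<in>F. 7 ^ d)" by (intro sum_mono fib)
  finally have "(2 * Z + 1) ^ d \<le> card F * 7 ^ d" by (simp add: card_Box)
  then have "real ((2 * Z + 1) ^ d) \<le> real (card F * 7 ^ d)" by (rule of_nat_mono)
  then have "real (2 * Z + 1) ^ d \<le> real (card F) * 7 ^ d" by simp
  also have "\<dots> \<le> (real T powr (3/4) * E ^ d) * 7 ^ d" using F(2) by (intro mult_right_mono) auto
  also have "real T powr (3/4) = (real (4 * Y + 1) powr (3/4)) ^ d"
  proof -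
    have "real T powr (3/4) = (real (4 * Y + 1) powr real d) powr (3/4)"
      unfolding T_def by (subst powr_realpow) auto
    also have "\<dots> = (real (4 * Y + 1) powr (3/4)) powr real d" by (simp only: powr_powr mult.commute)
    also have "\<dots> = (real (4 * Y + 1) powr (3/4)) ^ d" by (rule powr_realpow) simp
    finally show ?thesis .
  qed
  also have "(real (4 * Y + 1) powr (3/4)) ^ d * E ^ d * 7 ^ d = (7 * E * real (4 * Y + 1) powr (3/4)) ^ d"
    by (simp add: power_mult_distrib mult_ac)
  finally have "real (2 * Z + 1) \<le> 7 * E * real (4 * Y + 1) powr (3/4)"
    using d_pos E0 by (subst (asm) power_mono_iff) auto
  then have "real (2 * Z + 1) ^ 4 \<le> (7 * E * real (4 * Y + 1) powr (3/4)) ^ 4" by (intro power_mono) auto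
  also have "\<dots> = (7 * E) ^ 4 * (real (4 * Y + 1) powr (3/4)) ^ 4" by (simp only: power_mult_distrib)
  also have "(real (4 * Y + 1) powr (3/4)) ^ 4 = real (4 * Y + 1) ^ 3"
  proof -
    have "(real (4 * Y + 1) powr (3/4)) ^ 4 = (real (4 * Y + 1) powr (3/4)) powr 4"
      by simp
    also have "\<dots> = real (4 * Y + 1) powr 3" by (simp only: powr_powr) simp
    also have "\<dots> = real (4 * Y + 1) ^ 3" by simp
    finally show ?thesis .
  qed
  also have "(7 * E) ^ 4 * real (4 * Y + 1) ^ 3 \<le> (7 * E) ^ 4 * real (13 * (K * \<Delta> * Z)) ^ 3"
    using Y13 by (intro mult_left_mono power_mono of_nat_mono) auto
  also have "\<dots> = (2197 * (7 * E) ^ 4) * (real ((K * \<Delta>) ^ 3) * real Z ^ 3)" by (simp add: power_mult_distrib)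
  also have "\<dots> \<le> real box_const * (real ((K * \<Delta>) ^ 3) * real Z ^ 3)"
    using box_const_ge by (intro mult_right_mono) (auto simp: E_def)
  also have "\<dots> = real Z ^ 4" by (simp add: Z_def power_numeral_reduce)
  finally have "real (2 * Z + 1) ^ 4 \<le> real Z ^ 4" .
  then have "real (2 * Z + 1) \<le> real Z" by (subst (asm) power_mono_iff) auto
  then show False by simp
qed

text \<open>Every class modulo a degree-one ideal contains an integer; \<open>\<phi>\<close> selects
  one, so the reduction map to integers modulo \<open>p\<close> is expressed by congruences.\<close>

theorem prime_with_homomorphism:
  obtains p \<phi> where "prime p" "\<not> p dvd \<Delta>" "p \<le> (13 * box_const * (K * \<Delta>) ^ 4) ^ d"
    "\<And>x y. x \<in> R \<Longrightarrow> y \<in> R \<Longrightarrow> [\<phi> (x + y) = \<phi> x + \<phi> y] (mod int p)"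
    "\<And>x y. x \<in> R \<Longrightarrow> y \<in> R \<Longrightarrow> [\<phi> (x * y) = \<phi> x * \<phi> y] (mod int p)"
    "\<And>z. [\<phi> (of_int z) = z] (mod int p)"
proof -
  obtain p M where p: "prime p" "\<not> p dvd \<Delta>" "p \<le> (13 * box_const * (K * \<Delta>) ^ 4) ^ d"
    and M: "is_maximal M" "of_nat p \<in> M" and k: "\<forall>x\<in>R. \<exists>k. x - of_nat k \<in> M"
    using degree_one_exists unfolding has_degree_one_def by (elim exE conjE) (rule that; assumption)
  have MI: "is_ideal M" using M(1) by (simp add: is_maximal_def)
  define \<phi> :: "'a \<Rightarrow> int" where "\<phi> x = (SOME z. x - of_int z \<in> M)" for x
  have ph: "x - of_int (\<phi> x) \<in> M" if xR: "x \<in> R" for x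
  proof -
    obtain k where "x - of_nat k \<in> M" using bspec[OF k xR] by blast
    then have "x - of_int (int k) \<in> M" by simp
    then show ?thesis unfolding \<phi>_def by (rule someI)
  qed
  have cong: "[z = w] (mod int p)" if "of_int z - of_int w \<in> M" for z w
    using of_int_mem_maximal[OF M(1) p(1) M(2), of "z - w"] that by (simp add: cong_iff_dvd_diff)
  show ?thesis
  proof (rule that[of p \<phi>])
    fix x y assume xy: "x \<in> R" "y \<in> R"
    have "of_int (\<phi> (x + y)) - of_int (\<phi> x + \<phi> y) = (x - of_int (\<phi> x)) + (y - of_int (\<phi> y)) - (x + y - of_int (\<phi> (x + y)))"
      by simp
    also have "\<dots> \<in> M" using xy by (intro idealD(8)[OF MI] idealD(3)[OF MI] ph) auto
    finally show "[\<phi> (x + y) = \<phi> x + \<phi> y] (mod int p)" by (rule cong)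
    have "of_int (\<phi> (x * y)) - of_int (\<phi> x * \<phi> y) = (x * (y - of_int (\<phi> y)) + of_int (\<phi> y) * (x - of_int (\<phi> x))) - (x * y - of_int (\<phi> (x * y)))"
      by (simp add: algebra_simps)
    also have "\<dots> \<in> M" using xy by (intro idealD(8)[OF MI] idealD(3)[OF MI] idealD(4)[OF MI] ph) auto
    finally show "[\<phi> (x * y) = \<phi> x * \<phi> y] (mod int p)" by (rule cong)
  next
    fix z
    have "of_int (\<phi> (of_int z)) - of_int z = - (of_int z - of_int (\<phi> (of_int z)) :: 'a)" by simp
    also have "\<dots> \<in> M" by (intro idealD(7)[OF MI] ph) simp
    finally show "[\<phi> (of_int z) = z] (mod int p)" by (rule cong)
  qed (use p in auto)
qed

end

section \<open>Quadratic extensions of orders\<close>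

context box_order
begin

text \<open>An operator norm of multiplication by \<open>z\<close>. It is kept apart from
  \<open>K\<close> because estimating the same product by \<open>mult_Box\<close> would cost another
  factor \<open>K\<close>.\<close>

definition op_bound :: "'a \<Rightarrow> nat \<Rightarrow> bool" where
  "op_bound z k \<longleftrightarrow> (\<forall>n. \<forall>x\<in>Box n. z * x \<in> Box (k * n))"

definition reduced_mod :: "nat \<Rightarrow> bool" where
  "reduced_mod p \<longleftrightarrow> (\<forall>x\<in>R. x * x \<in> mulI (of_nat p) \<longrightarrow> x \<in> mulI (of_nat p))"

lemma op_bound_mono: "op_bound z k \<Longrightarrow> k \<le> l \<Longrightarrow> op_bound z l"
  unfolding op_bound_def using Box_mono by (meson mult_le_mono1 subsetD)

lemma op_bound_of_int: "op_bound (of_int z) (nat \<bar>z\<bar>)"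
  unfolding op_bound_def
proof (intro allI ballI)
  fix n x assume x: "x \<in> Box n"
  show "of_int z * x \<in> Box (nat \<bar>z\<bar> * n)"
  proof (cases "z \<ge> 0")
    case True
    then have "of_int z * x = of_nat (nat \<bar>z\<bar>) * x" by (simp add: of_nat_nat)
    then show ?thesis using scale_Box[OF x, of "nat \<bar>z\<bar>"] by (simp only:)
  next
    case False
    then have "of_int z * x = - (of_nat (nat \<bar>z\<bar>) * x)" by (simp add: of_nat_nat)
    then show ?thesis using uminus_Box[OF scale_Box[OF x, of "nat \<bar>z\<bar>"]] by (simp only:)
  qed
qed

lemma op_bound_add: "op_bound z k \<Longrightarrow> op_bound w l \<Longrightarrow> op_bound (z + w) (k + l)"
  unfolding op_bound_def using add_Box by (simp add: distrib_right) 

lemma op_bound_uminus: "op_bound z k \<Longrightarrow> op_bound (- z) k"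
  unfolding op_bound_def using uminus_Box by simp

lemma op_bound_mult: "op_bound z k \<Longrightarrow> op_bound w l \<Longrightarrow> op_bound (z * w) (k * l)"
  unfolding op_bound_def by (simp add: mult.assoc)

lemma mulI_cancel_unit:
  assumes "prime p" "\<not> int p dvd D" "of_int D * x \<in> mulI (of_nat p)" "x \<in> R"
  shows "x \<in> mulI (of_nat p)"
proof -
  have I: "is_ideal (mulI (of_nat p))" by (intro is_ideal_mulI) simp
  have "coprime D (int p)" using assms(1,2) by (metis coprime_commute prime_imp_coprime prime_nat_int_transfer)
  then obtain u v where uv: "u * D + v * int p = 1" by (metis bezout_int coprime_imp_gcd_eq_1)
  have "x = of_int (u * D + v * int p) * x" unfolding uv by simp
  also have "\<dots> = of_int u * (of_int D * x) + of_nat p * (of_int v * x)" by (simp add: algebra_simps)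
  also have "\<dots> \<in> mulI (of_nat p)"
    using idealD(3)[OF I idealD(4)[OF I of_int_R assms(3)] mulI_I[OF mult_R[OF of_int_R assms(4)]]] .
  finally show ?thesis .
qed

end

section \<open>Adjoining a root of a monic quadratic polynomial\<close>

locale quadratic_step = box_order +
  fixes t \<beta> \<gamma> :: 'a and k :: nat
  assumes beta_R: "\<beta> \<in> R" and gamma_R: "\<gamma> \<in> R"
    and t_sq: "t * t = \<beta> * t + \<gamma>"
    and indep: "u \<in> R \<Longrightarrow> v \<in> R \<Longrightarrow> u + v * t = 0 \<Longrightarrow> u = 0 \<and> v = 0"
    and beta_op: "op_bound \<beta> k" and gamma_op: "op_bound \<gamma> k"
begin

definition Box2 :: "nat \<Rightarrow> 'a set" where
  "Box2 n = (\<lambda>(u, v). u + v * t) ` (Box n \<times> Box n)"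

lemma Box2_iff: "x \<in> Box2 n \<longleftrightarrow> (\<exists>u\<in>Box n. \<exists>v\<in>Box n. x = u + v * t)"
  by (auto simp: Box2_def)

lemma Box2_I: "u \<in> Box n \<Longrightarrow> v \<in> Box n \<Longrightarrow> u + v * t \<in> Box2 n"
  by (auto simp: Box2_def)

lemma unique:
  assumes "u \<in> R" "v \<in> R" "u' \<in> R" "v' \<in> R" "u + v * t = u' + v' * t"
  shows "u = u'" "v = v'"
  using indep[of "u - u'" "v - v'"] assms by (auto simp: algebra_simps)

lemma Union_Box2: "(\<Union>n. Box2 n) = {u + v * t | u v. u \<in> R \<and> v \<in> R}"
proof
  show "(\<Union>n. Box2 n) \<subseteq> {u + v * t | u v. u \<in> R \<and> v \<in> R}" using R_I by (auto simp: Box2_def)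
  show "{u + v * t | u v. u \<in> R \<and> v \<in> R} \<subseteq> (\<Union>n. Box2 n)"
  proof
    fix x assume "x \<in> {u + v * t | u v. u \<in> R \<and> v \<in> R}"
    then obtain u v m n where "x = u + v * t" "u \<in> Box m" "v \<in> Box n" by (auto simp: R_def)
    then have "x \<in> Box2 (max m n)" using Box_mono[of m "max m n"] Box_mono[of n "max m n"] by (auto simp: Box2_iff)
    then show "x \<in> (\<Union>n. Box2 n)" by blast
  qed
qed

text \<open>The factor \<open>k + 2\<close> comes from the coefficient
  \<open>u * v' + v * u' + \<beta> * (v * v')\<close> of \<open>t\<close> in a product: three terms
  of size \<open>K m n\<close>, the last of them enlarged by the operator bound
  \<open>k\<close>.\<close>

lemma box_order_Box2: "box_order Box2 (2 * d) (K * (k + 2))"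
proof
  fix n
  show "finite (Box2 n)" by (simp add: Box2_def finite_Box)
  have "inj_on (\<lambda>(u, v). u + v * t) (Box n \<times> Box n)"
  proof (rule inj_onI)
    fix a b assume ab: "a \<in> Box n \<times> Box n" "b \<in> Box n \<times> Box n"
      and eq: "(\<lambda>(u, v). u + v * t) a = (\<lambda>(u, v). u + v * t) b"
    then have "fst a \<in> R" "snd a \<in> R" "fst b \<in> R" "snd b \<in> R" using R_I[of _ n] by auto
    from unique[OF this] eq show "a = b" by (auto simp: case_prod_beta prod_eq_iff)
  qed
  then show "card (Box2 n) = (2 * n + 1) ^ (2 * d)"
    by (simp add: Box2_def card_image card_cartesian_product card_Box mult_2 power_add)
next
  show "0 \<in> Box2 0" using Box2_I[OF zero_Box zero_Box] by simp
  show "1 \<in> Box2 1" using Box2_I[OF one_Box, of 0] zero_Box Box_mono[of 0 1] by auto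
next
  fix x n assume "x \<in> Box2 n"
  then obtain u v where "u \<in> Box n" "v \<in> Box n" "x = u + v * t" by (auto simp: Box2_iff)
  then show "- x \<in> Box2 n" using Box2_I[OF uminus_Box uminus_Box, of u n v] by simp
next
  fix x y m n assume "x \<in> Box2 m" "y \<in> Box2 n"
  then obtain u v u' v' where x: "u \<in> Box m" "v \<in> Box m" "x = u + v * t"
    and y: "u' \<in> Box n" "v' \<in> Box n" "y = u' + v' * t" by (auto simp: Box2_iff)
  have "(u + u') + (v + v') * t \<in> Box2 (m + n)" by (intro Box2_I add_Box x y)
  then show "x + y \<in> Box2 (m + n)" using x y by (simp add: algebra_simps)
  define N where "N = K * m * n"
  have vv: "v * v' \<in> Box N" unfolding N_def by (intro mult_Box x y)
  have uu: "u * u' \<in> Box N" "u * v' \<in> Box N" "v * u' \<in> Box N" unfolding N_def by (intro mult_Box x y)+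
  have gv: "\<gamma> * (v * v') \<in> Box (k * N)" "\<beta> * (v * v') \<in> Box (k * N)"
    using gamma_op beta_op vv unfolding op_bound_def by blast+
  have "u * u' + \<gamma> * (v * v') \<in> Box (N + k * N)" by (rule add_Box[OF uu(1) gv(1)])
  then have 1: "u * u' + \<gamma> * (v * v') \<in> Box (K * (k + 2) * m * n)"
    by (rule subsetD[OF Box_mono, rotated]) (simp add: N_def algebra_simps)
  have "(u * v' + v * u') + \<beta> * (v * v') \<in> Box ((N + N) + k * N)"
    by (rule add_Box[OF add_Box[OF uu(2,3)] gv(2)])
  then have 2: "(u * v' + v * u') + \<beta> * (v * v') \<in> Box (K * (k + 2) * m * n)"
    by (rule subsetD[OF Box_mono, rotated]) (simp add: N_def algebra_simps)
  have "x * y = u * u' + (u * v' + v * u') * t + v * v' * (t * t)"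
    unfolding x(3) y(3) by (simp add: algebra_simps)
  also have "\<dots> = (u * u' + \<gamma> * (v * v')) + ((u * v' + v * u') + \<beta> * (v * v')) * t"
    unfolding t_sq by (simp add: algebra_simps)
  finally show "x * y \<in> Box2 (K * (k + 2) * m * n)" using Box2_I[OF 1 2] by simp
next
  fix m n :: nat assume "m \<le> n"
  from Box_mono[OF this] show "Box2 m \<subseteq> Box2 n" unfolding Box2_def by (intro image_mono) auto
next
  fix x n m assume "x \<in> Box2 n" and m: "0 < (m::nat)"
  then obtain u v where x: "u \<in> Box n" "v \<in> Box n" "x = u + v * t" by (auto simp: Box2_iff)
  from div_Box[OF x(1) m] obtain q r where q: "q \<in> Box (n div m)" "r \<in> Box m" "u = of_nat m * q + r" by blast
  from div_Box[OF x(2) m] obtain q' r' where q': "q' \<in> Box (n div m)" "r' \<in> Box m" "v = of_nat m * q' + r'" by blast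
  have "x = of_nat m * (q + q' * t) + (r + r' * t)" unfolding x(3) q(3) q'(3) by (simp add: algebra_simps)
  then show "\<exists>q\<in>Box2 (n div m). \<exists>r\<in>Box2 m. x = of_nat m * q + r"
    by (intro bexI[OF _ Box2_I[OF q(1) q'(1)]] bexI[OF _ Box2_I[OF q(2) q'(2)]])
next
  fix x n m assume "x \<in> Box2 n"
  then obtain u v where x: "u \<in> Box n" "v \<in> Box n" "x = u + v * t" by (auto simp: Box2_iff)
  have "of_nat m * u + (of_nat m * v) * t \<in> Box2 (m * n)" by (intro Box2_I scale_Box x)
  then show "of_nat m * x \<in> Box2 (m * n)" unfolding x(3) by (simp add: algebra_simps)
next
  fix x :: 'a and m n :: nat assume xx: "x \<in> (\<Union>k. Box2 k)" and m: "0 < m" and mx: "of_nat m * x \<in> Box2 n"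
  obtain u v where x: "u \<in> R" "v \<in> R" "x = u + v * t" using xx unfolding Union_Box2 by blast
  obtain a b where ab: "a \<in> Box n" "b \<in> Box n" "of_nat m * x = a + b * t" using mx by (auto simp: Box2_iff)
  have "of_nat m * u + (of_nat m * v) * t = a + b * t" using ab(3) unfolding x(3) by (simp add: algebra_simps)
  from unique[OF mult_R[OF of_nat_R x(1)] mult_R[OF of_nat_R x(2)] R_I[OF ab(1)] R_I[OF ab(2)] this]
  have "of_nat m * u \<in> Box n" "of_nat m * v \<in> Box n" using ab by simp_all
  then have "u \<in> Box (n div m)" "v \<in> Box (n div m)" using descale_Box[OF _ m] x(1,2) unfolding R_def by blast+
  then show "x \<in> Box2 (n div m)" unfolding x(3) by (rule Box2_I)
qed

sublocale E: box_order Box2 "2 * d" "K * (k + 2)" by (rule box_order_Box2)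

lemma E_R: "E.R = {u + v * t | u v. u \<in> R \<and> v \<in> R}"
  unfolding E.R_def by (rule Union_Box2)

lemma R_subset_E: "R \<subseteq> E.R"
proof
  fix x assume "x \<in> R"
  then show "x \<in> E.R" unfolding E_R by (intro CollectI exI[of _ x] exI[of _ 0]) auto
qed

lemma t_in_E: "t \<in> E.R"
  unfolding E_R by (intro CollectI exI[of _ 0] exI[of _ 1]) auto

lemma op_bound_E:
  assumes "op_bound z c"
  shows "E.op_bound z c"
  unfolding E.op_bound_def
proof (intro allI ballI)
  fix n x assume "x \<in> Box2 n"
  then obtain u v where x: "u \<in> Box n" "v \<in> Box n" "x = u + v * t" by (auto simp: Box2_iff)
  have "z * u + (z * v) * t \<in> Box2 (c * n)" using assms x by (intro Box2_I) (auto simp: op_bound_def)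
  then show "z * x \<in> Box2 (c * n)" unfolding x(3) by (simp add: algebra_simps)
qed

lemma op_bound_t: "E.op_bound t (k + 1)"
  unfolding E.op_bound_def
proof (intro allI ballI)
  fix n x assume "x \<in> Box2 n"
  then obtain u v where x: "u \<in> Box n" "v \<in> Box n" "x = u + v * t" by (auto simp: Box2_iff)
  have b: "\<beta> * v \<in> Box (k * n)" "\<gamma> * v \<in> Box (k * n)" using beta_op gamma_op x(2) unfolding op_bound_def by blast+
  have "\<beta> * v + u \<in> Box (k * n + n)" by (intro add_Box b x)
  moreover have "\<gamma> * v \<in> Box (k * n + n)" by (rule subsetD[OF Box_mono b(2)]) simp
  ultimately have "\<gamma> * v + (\<beta> * v + u) * t \<in> Box2 ((k + 1) * n)" by (intro Box2_I) (auto simp: algebra_simps)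
  moreover have "t * x = u * t + v * (t * t)" unfolding x(3) by (simp add: algebra_simps)
  then have "t * x = \<gamma> * v + (\<beta> * v + u) * t" unfolding t_sq by (simp add: algebra_simps)
  ultimately show "t * x \<in> Box2 ((k + 1) * n)" by simp
qed

lemma mulI_E:
  assumes "u \<in> R" "v \<in> R"
  shows "u + v * t \<in> E.mulI (of_nat p) \<longleftrightarrow> u \<in> mulI (of_nat p) \<and> v \<in> mulI (of_nat p)"
proof
  assume "u + v * t \<in> E.mulI (of_nat p)"
  then obtain a b where ab: "a \<in> R" "b \<in> R" "u + v * t = of_nat p * (a + b * t)"
    unfolding E.mulI_def E_R by auto
  then have "u + v * t = (of_nat p * a) + (of_nat p * b) * t" by (simp add: algebra_simps)
  from unique[OF assms _ _ this] ab show "u \<in> mulI (of_nat p) \<and> v \<in> mulI (of_nat p)"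
    by (auto simp: mulI_def)
next
  assume "u \<in> mulI (of_nat p) \<and> v \<in> mulI (of_nat p)"
  then obtain a b where ab: "a \<in> R" "b \<in> R" "u = of_nat p * a" "v = of_nat p * b" by (auto simp: mulI_def)
  then have "u + v * t = of_nat p * (a + b * t)" by (simp add: algebra_simps)
  moreover have "a + b * t \<in> E.R" using ab unfolding E_R by blast
  ultimately show "u + v * t \<in> E.mulI (of_nat p)" using E.mulI_I by simp
qed

text \<open>A nilpotent \<open>u + v t\<close> modulo \<open>p\<close> forces \<open>(\<beta>\<^sup>2 + 4 \<gamma>) v\<^sup>3\<close> to vanish modulo \<open>p\<close>.\<close>

lemma reduced_mod_E:
  assumes red: "reduced_mod p" and p: "prime p" "\<not> int p dvd D"
    and w: "w \<in> R" "(\<beta> * \<beta> + 4 * \<gamma>) * w = of_int D"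
  shows "E.reduced_mod p"
  unfolding E.reduced_mod_def
proof (intro ballI impI)
  fix x assume "x \<in> E.R" and xx: "x * x \<in> E.mulI (of_nat p)"
  then obtain u v where uv: "u \<in> R" "v \<in> R" "x = u + v * t" unfolding E_R by blast
  have I: "is_ideal (mulI (of_nat p))" by (intro is_ideal_mulI) simp
  note D = idealD[OF I]
  have "x * x = u * u + (2 * (u * v)) * t + v * v * (t * t)" unfolding uv(3) by (simp add: algebra_simps)
  then have "x * x = (u * u + \<gamma> * (v * v)) + (2 * (u * v) + \<beta> * (v * v)) * t"
    unfolding t_sq by (simp add: algebra_simps)
  moreover have two: "(2 :: 'a) \<in> R" "(4 :: 'a) \<in> R" using of_nat_R[of 2] of_nat_R[of 4] by simp_all
  have R: "u * u + \<gamma> * (v * v) \<in> R" "2 * (u * v) + \<beta> * (v * v) \<in> R"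
    by (intro add_R mult_R uv beta_R gamma_R two)+
  ultimately have a: "u * u + \<gamma> * (v * v) \<in> mulI (of_nat p)" "2 * (u * v) + \<beta> * (v * v) \<in> mulI (of_nat p)"
    using xx mulI_E[OF R, of p] by simp_all
  \<comment> \<open>The coefficients of \<open>1\<close> and \<open>t\<close> in
    \<open>x * x\<close> are combined so that \<open>u\<close> drops out.\<close>
  have "(\<beta> * \<beta> + 4 * \<gamma>) * (v * v * v) =
    4 * v * (u * u + \<gamma> * (v * v)) - (2 * u - \<beta> * v) * (2 * (u * v) + \<beta> * (v * v))"
    by (simp add: algebra_simps)
  also have "\<dots> \<in> mulI (of_nat p)"
    by (intro D(8) D(4)[OF _ a(1)] D(4)[OF _ a(2)] mult_R diff_R two uv beta_R)
  finally have "w * ((\<beta> * \<beta> + 4 * \<gamma>) * (v * v * v)) \<in> mulI (of_nat p)" using w(1) D(4) by blast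
  moreover have "w * ((\<beta> * \<beta> + 4 * \<gamma>) * (v * v * v)) = of_int D * (v * v * v)"
    unfolding w(2)[symmetric] by (simp add: mult_ac)
  ultimately have "v * v * v \<in> mulI (of_nat p)" using mulI_cancel_unit[OF p, of "v * v * v"] uv by simp
  then have "(v * v) * (v * v) \<in> mulI (of_nat p)" using D(4)[OF uv(2), of "v * v * v"] by (simp add: mult_ac)
  then have v4: "(v * v) * (v * v) \<in> mulI (of_nat p)" .
  have redD: "y \<in> mulI (of_nat p)" if "y \<in> R" "y * y \<in> mulI (of_nat p)" for y
    using red that unfolding reduced_mod_def by blast
  have vv: "v * v \<in> mulI (of_nat p)" by (rule redD[OF mult_R[OF uv(2) uv(2)] v4])
  then have v: "v \<in> mulI (of_nat p)" by (rule redD[OF uv(2)])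
  have gv: "\<gamma> * (v * v) \<in> mulI (of_nat p)" by (rule D(4)[OF gamma_R vv])
  have "u * u \<in> mulI (of_nat p)" using D(8)[OF a(1) gv] by simp
  then have "u \<in> mulI (of_nat p)" by (rule redD[OF uv(1)])
  with v show "x \<in> E.mulI (of_nat p)" unfolding uv(3) using mulI_E uv by blast
qed

end

section \<open>The cubic order with basis 1, e, e^2\<close>

locale cubic_base =
  fixes e :: "'a::comm_ring_1" and A B :: int
  assumes e_cubic: "e * e * e = - (of_int A * e) - of_int B"
    and e_indep: "of_int a + of_int b * e + of_int c * (e * e) = 0 \<Longrightarrow> a = 0 \<and> b = 0 \<and> c = 0"
begin

definition lin :: "int \<times> int \<times> int \<Rightarrow> 'a" where
  "lin = (\<lambda>(a, b, c). of_int a + of_int b * e + of_int c * (e * e))"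

definition Box3 :: "nat \<Rightarrow> 'a set" where
  "Box3 n = lin ` ({-int n..int n} \<times> {-int n..int n} \<times> {-int n..int n})"

lemma lin_inj: "lin x = lin y \<Longrightarrow> x = y"
proof -
  assume h: "lin x = lin y"
  obtain a b c where x: "x = (a, b, c)" by (metis prod_cases3)
  obtain a' b' c' where y: "y = (a', b', c')" by (metis prod_cases3)
  have "of_int (a - a') + of_int (b - b') * e + of_int (c - c') * (e * e) = 0"
    using h unfolding x y lin_def by (simp add: algebra_simps)
  from e_indep[OF this] show "x = y" unfolding x y by simp
qed

lemma lin_mult:
  "lin (a, b, c) * lin (a', b', c') =
    lin (a * a' - B * (b * c' + c * b'),
         a * b' + b * a' - A * (b * c' + c * b') - B * (c * c'),
         a * c' + b * b' + c * a' - A * (c * c'))"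
proof -
  have e4: "e * (e * e * e) = - (of_int A * (e * e)) - of_int B * e" unfolding e_cubic by (simp add: algebra_simps)
  have "lin (a, b, c) * lin (a', b', c') = of_int (a * a') + of_int (a * b' + b * a') * e
    + of_int (a * c' + b * b' + c * a') * (e * e) + of_int (b * c' + c * b') * (e * e * e) + of_int (c * c') * (e * (e * e * e))"
    unfolding lin_def by (simp add: algebra_simps)
  then show ?thesis unfolding e4 e_cubic by (simp add: lin_def algebra_simps)
qed

lemma Box3_iff: "x \<in> Box3 n \<longleftrightarrow> (\<exists>a b c. x = lin (a, b, c) \<and> \<bar>a\<bar> \<le> int n \<and> \<bar>b\<bar> \<le> int n \<and> \<bar>c\<bar> \<le> int n)"
proof
  assume "x \<in> Box3 n"
  then obtain a b c where "x = lin (a, b, c)" "a \<in> {-int n..int n}" "b \<in> {-int n..int n}" "c \<in> {-int n..int n}"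
    by (auto simp: Box3_def)
  then show "\<exists>a b c. x = lin (a, b, c) \<and> \<bar>a\<bar> \<le> int n \<and> \<bar>b\<bar> \<le> int n \<and> \<bar>c\<bar> \<le> int n"
    by (intro exI[of _ a] exI[of _ b] exI[of _ c]) auto
next
  assume "\<exists>a b c. x = lin (a, b, c) \<and> \<bar>a\<bar> \<le> int n \<and> \<bar>b\<bar> \<le> int n \<and> \<bar>c\<bar> \<le> int n"
  then obtain a b c where "x = lin (a, b, c)" "\<bar>a\<bar> \<le> int n" "\<bar>b\<bar> \<le> int n" "\<bar>c\<bar> \<le> int n" by blast
  then show "x \<in> Box3 n" unfolding Box3_def by (intro image_eqI[of _ _ "(a, b, c)"]) auto
qed

lemma Box3_I: "\<bar>a\<bar> \<le> int n \<Longrightarrow> \<bar>b\<bar> \<le> int n \<Longrightarrow> \<bar>c\<bar> \<le> int n \<Longrightarrow> lin (a, b, c) \<in> Box3 n"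
  by (auto simp: Box3_iff)

lemma e_mult_lin: "e * lin (a, b, c) = lin (- (B * c), a - A * c, b)"
proof -
  have "e = lin (0, 1, 0)" by (simp add: lin_def)
  moreover have "lin (0, 1, 0) * lin (a, b, c) = lin (- (B * c), a - A * c, b)" unfolding lin_mult by simp
  ultimately show ?thesis by (simp only:)
qed

text \<open>Dominates the triangle-inequality bounds for all three coordinates in
  \<open>lin_mult\<close>.\<close>

definition K3 :: nat where "K3 = nat (3 + 2 * \<bar>A\<bar> + 2 * \<bar>B\<bar>)"

text \<open>Division rounds towards zero here: rounding down could give a negative \<open>a\<close>
  a quotient of absolute value \<open>n div m + 1\<close>.\<close>

lemma quot_rem_bound:
  fixes a :: int
  assumes "\<bar>a\<bar> \<le> int n" "m > 0"
  shows "\<exists>q r. a = int m * q + r \<and> \<bar>q\<bar> \<le> int (n div m) \<and> \<bar>r\<bar> \<le> int m"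
proof -
  define q where "q = sgn a * (\<bar>a\<bar> div int m)"
  define r where "r = sgn a * (\<bar>a\<bar> mod int m)"
  have s1: "\<bar>sgn a\<bar> \<le> 1" by (simp add: sgn_if)
  have "int m * q + r = sgn a * (int m * (\<bar>a\<bar> div int m) + \<bar>a\<bar> mod int m)"
    unfolding q_def r_def by (simp only: distrib_left mult.left_commute)
  then have "a = int m * q + r" by (simp only: mult_div_mod_eq sgn_mult_abs)
  moreover have "\<bar>q\<bar> \<le> int (n div m)"
  proof -
    have d0: "0 \<le> \<bar>a\<bar> div int m" using assms(2) by (simp add: pos_imp_zdiv_nonneg_iff)
    have "\<bar>q\<bar> = \<bar>sgn a\<bar> * (\<bar>a\<bar> div int m)" unfolding q_def abs_mult using d0 by simp
    also have "\<dots> \<le> 1 * (\<bar>a\<bar> div int m)" by (rule mult_right_mono[OF s1 d0])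
    also have "\<dots> \<le> int n div int m" using zdiv_mono1[OF assms(1), of "int m"] assms(2) by simp
    finally show ?thesis by (simp add: zdiv_int)
  qed
  moreover have "\<bar>r\<bar> \<le> int m"
  proof -
    have d0: "0 \<le> \<bar>a\<bar> mod int m" "\<bar>a\<bar> mod int m \<le> int m"
      using assms(2) pos_mod_bound[of "int m" "\<bar>a\<bar>"] by (simp_all add: less_imp_le)
    have "\<bar>r\<bar> = \<bar>sgn a\<bar> * (\<bar>a\<bar> mod int m)" unfolding r_def abs_mult using d0 by simp
    also have "\<dots> \<le> 1 * (\<bar>a\<bar> mod int m)" by (rule mult_right_mono[OF s1 d0(1)])
    finally show ?thesis using d0(2) by simp
  qed
  ultimately show ?thesis by blast
qed

lemma box_order_Box3: "box_order Box3 3 K3"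
proof
  fix n
  show "finite (Box3 n)" by (simp add: Box3_def)
  have "inj_on lin ({-int n..int n} \<times> {-int n..int n} \<times> {-int n..int n})" by (intro inj_onI lin_inj)
  moreover have "card {-int n..int n} = 2 * n + 1" by simp
  ultimately show "card (Box3 n) = (2 * n + 1) ^ 3"
    by (simp add: Box3_def card_image card_cartesian_product power3_eq_cube)
next
  show "0 \<in> Box3 0" using Box3_I[of 0 0 0 0] by (simp add: lin_def)
  show "1 \<in> Box3 1" using Box3_I[of 1 1 0 0] by (simp add: lin_def)
next
  fix x n assume "x \<in> Box3 n"
  then obtain a b c where x: "x = lin (a, b, c)" "\<bar>a\<bar> \<le> int n" "\<bar>b\<bar> \<le> int n" "\<bar>c\<bar> \<le> int n" by (auto simp: Box3_iff)
  have "- x = lin (- a, - b, - c)" unfolding x lin_def by (simp add: algebra_simps)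
  then show "- x \<in> Box3 n" using x Box3_I[of "- a" n "- b" "- c"] by simp
next
  fix x y m n assume "x \<in> Box3 m" "y \<in> Box3 n"
  then obtain a b c a' b' c' where x: "x = lin (a, b, c)" "\<bar>a\<bar> \<le> int m" "\<bar>b\<bar> \<le> int m" "\<bar>c\<bar> \<le> int m"
    and y: "y = lin (a', b', c')" "\<bar>a'\<bar> \<le> int n" "\<bar>b'\<bar> \<le> int n" "\<bar>c'\<bar> \<le> int n" by (auto simp: Box3_iff)
  have "x + y = lin (a + a', b + b', c + c')" unfolding x(1) y(1) lin_def by (simp add: algebra_simps)
  moreover have "lin (a + a', b + b', c + c') \<in> Box3 (m + n)" using x y by (intro Box3_I) auto
  ultimately show "x + y \<in> Box3 (m + n)" by simp
  define M where "M = int m * int n"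
  have M: "\<bar>s * s'\<bar> \<le> M" if "\<bar>s\<bar> \<le> int m" "\<bar>s'\<bar> \<le> int n" for s s'
    unfolding abs_mult M_def using that by (intro mult_mono) auto
  have M2: "\<bar>A * s\<bar> \<le> \<bar>A\<bar> * N" "\<bar>B * s\<bar> \<le> \<bar>B\<bar> * N" if "\<bar>s\<bar> \<le> N" for s N
    unfolding abs_mult using that by (auto intro: mult_left_mono)
  have bc: "\<bar>b * c' + c * b'\<bar> \<le> 2 * M" using M[OF x(3) y(4)] M[OF x(4) y(3)] by linarith
  have cc: "\<bar>c * c'\<bar> \<le> M" using M[OF x(4) y(4)] .
  have M0: "M \<ge> 0" "\<bar>A\<bar> * M \<ge> 0" "\<bar>B\<bar> * M \<ge> 0" by (auto simp: M_def)
  have KM: "int (K3 * m * n) = 3 * M + 2 * (\<bar>A\<bar> * M) + 2 * (\<bar>B\<bar> * M)" by (simp add: K3_def M_def algebra_simps)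
  have A2: "\<bar>A * (b * c' + c * b')\<bar> \<le> 2 * (\<bar>A\<bar> * M)" "\<bar>B * (b * c' + c * b')\<bar> \<le> 2 * (\<bar>B\<bar> * M)"
    using M2[OF bc] by (simp_all add: mult_ac)
  note A1 = M2[OF cc]
  have "lin (a * a' - B * (b * c' + c * b'),
         a * b' + b * a' - A * (b * c' + c * b') - B * (c * c'),
         a * c' + b * b' + c * a' - A * (c * c')) \<in> Box3 (K3 * m * n)"
  proof (rule Box3_I; unfold KM)
    show "\<bar>a * a' - B * (b * c' + c * b')\<bar> \<le> 3 * M + 2 * (\<bar>A\<bar> * M) + 2 * (\<bar>B\<bar> * M)"
      using M[OF x(2) y(2)] A2 M0 by linarith
    show "\<bar>a * b' + b * a' - A * (b * c' + c * b') - B * (c * c')\<bar> \<le> 3 * M + 2 * (\<bar>A\<bar> * M) + 2 * (\<bar>B\<bar> * M)"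
      using M[OF x(2) y(3)] M[OF x(3) y(2)] A2 A1 M0 by linarith
    show "\<bar>a * c' + b * b' + c * a' - A * (c * c')\<bar> \<le> 3 * M + 2 * (\<bar>A\<bar> * M) + 2 * (\<bar>B\<bar> * M)"
      using M[OF x(2) y(4)] M[OF x(3) y(3)] M[OF x(4) y(2)] A1 M0 by linarith
  qed
  then show "x * y \<in> Box3 (K3 * m * n)" unfolding x(1) y(1) lin_mult .
next
  fix m n :: nat assume "m \<le> n"
  then show "Box3 m \<subseteq> Box3 n" unfolding Box3_def by (intro image_mono Sigma_mono) auto
next
  fix x n m assume "x \<in> Box3 n" and m: "0 < (m::nat)"
  then obtain a b c where x: "x = lin (a, b, c)" "\<bar>a\<bar> \<le> int n" "\<bar>b\<bar> \<le> int n" "\<bar>c\<bar> \<le> int n" by (auto simp: Box3_iff)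
  obtain q1 r1 where 1: "a = int m * q1 + r1" "\<bar>q1\<bar> \<le> int (n div m)" "\<bar>r1\<bar> \<le> int m" using quot_rem_bound[OF x(2) m] by blast
  obtain q2 r2 where 2: "b = int m * q2 + r2" "\<bar>q2\<bar> \<le> int (n div m)" "\<bar>r2\<bar> \<le> int m" using quot_rem_bound[OF x(3) m] by blast
  obtain q3 r3 where 3: "c = int m * q3 + r3" "\<bar>q3\<bar> \<le> int (n div m)" "\<bar>r3\<bar> \<le> int m" using quot_rem_bound[OF x(4) m] by blast
  have "x = of_nat m * lin (q1, q2, q3) + lin (r1, r2, r3)"
    unfolding x(1) 1(1) 2(1) 3(1) lin_def by (simp add: algebra_simps)
  then show "\<exists>q\<in>Box3 (n div m). \<exists>r\<in>Box3 m. x = of_nat m * q + r"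
    by (intro bexI[OF _ Box3_I[OF 1(2) 2(2) 3(2)]] bexI[OF _ Box3_I[OF 1(3) 2(3) 3(3)]])
next
  fix x n m assume "x \<in> Box3 n"
  then obtain a b c where x: "x = lin (a, b, c)" "\<bar>a\<bar> \<le> int n" "\<bar>b\<bar> \<le> int n" "\<bar>c\<bar> \<le> int n" by (auto simp: Box3_iff)
  have "of_nat m * x = lin (int m * a, int m * b, int m * c)" unfolding x lin_def by (simp add: algebra_simps)
  moreover have "lin (int m * a, int m * b, int m * c) \<in> Box3 (m * n)"
    using x by (intro Box3_I) (auto simp: abs_mult intro: mult_left_mono)
  ultimately show "of_nat m * x \<in> Box3 (m * n)" by simp
next
  fix x :: 'a and m n :: nat assume xx: "x \<in> (\<Union>k. Box3 k)" and m: "0 < m" and mx: "of_nat m * x \<in> Box3 n"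
  obtain a b c where x: "x = lin (a, b, c)" using xx by (auto simp: Box3_iff)
  obtain a' b' c' where y: "of_nat m * x = lin (a', b', c')" "\<bar>a'\<bar> \<le> int n" "\<bar>b'\<bar> \<le> int n" "\<bar>c'\<bar> \<le> int n"
    using mx by (auto simp: Box3_iff)
  have "of_nat m * x = lin (int m * a, int m * b, int m * c)" unfolding x lin_def by (simp add: algebra_simps)
  then have "(int m * a, int m * b, int m * c) = (a', b', c')" using y(1) by (intro lin_inj) simp
  then have "a' = int m * a" "b' = int m * b" "c' = int m * c" by auto
  moreover have "\<bar>s\<bar> \<le> int (n div m)" if "\<bar>int m * s\<bar> \<le> int n" for s
  proof -
    have "\<bar>s\<bar> * int m \<le> int n" using that by (simp add: abs_mult mult.commute)
    then have "(\<bar>s\<bar> * int m) div int m \<le> int n div int m" using m by (intro zdiv_mono1) auto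
    then have "\<bar>s\<bar> \<le> int n div int m" using m by simp
    then show ?thesis by (simp add: zdiv_int)
  qed
  ultimately show "x \<in> Box3 (n div m)" unfolding x using y by (intro Box3_I) auto
qed

sublocale C: box_order Box3 3 K3 by (rule box_order_Box3)

lemma C_R: "C.R = range lin"
proof
  show "C.R \<subseteq> range lin" by (auto simp: C.R_def Box3_iff)
  show "range lin \<subseteq> C.R"
  proof
    fix x assume "x \<in> range lin"
    then obtain a b c where x: "x = lin (a, b, c)" by (metis imageE prod_cases3)
    have "x \<in> Box3 (nat (\<bar>a\<bar> + \<bar>b\<bar> + \<bar>c\<bar>))" unfolding x by (intro Box3_I) auto
    then show "x \<in> C.R" by (rule C.R_I)
  qed
qed

lemma C_E: "x \<in> C.R \<Longrightarrow> \<exists>a b c. x = lin (a, b, c)"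
  unfolding C_R by (metis imageE prod_cases3)

lemma e_in_C: "e \<in> C.R"
proof -
  have "e = lin (0, 1, 0)" by (simp add: lin_def)
  then show ?thesis unfolding C_R by blast
qed

lemma op_bound_e: "C.op_bound e (nat (1 + \<bar>A\<bar> + \<bar>B\<bar>))"
  unfolding C.op_bound_def
proof (intro allI ballI)
  fix n x assume "x \<in> Box3 n"
  then obtain a b c where x: "x = lin (a, b, c)" "\<bar>a\<bar> \<le> int n" "\<bar>b\<bar> \<le> int n" "\<bar>c\<bar> \<le> int n" by (auto simp: Box3_iff)
  have ex: "e * x = lin (- (B * c), a - A * c, b)" unfolding x(1) by (rule e_mult_lin)
  have M2: "\<bar>A * c\<bar> \<le> \<bar>A\<bar> * int n" "\<bar>B * c\<bar> \<le> \<bar>B\<bar> * int n"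
    unfolding abs_mult using x(4) by (auto intro: mult_left_mono)
  have M0: "\<bar>A\<bar> * int n \<ge> 0" "\<bar>B\<bar> * int n \<ge> 0" by auto
  have KM: "int (nat (1 + \<bar>A\<bar> + \<bar>B\<bar>) * n) = int n + \<bar>A\<bar> * int n + \<bar>B\<bar> * int n" by (simp add: algebra_simps)
  show "e * x \<in> Box3 (nat (1 + \<bar>A\<bar> + \<bar>B\<bar>) * n)" unfolding ex
    by (rule Box3_I; unfold KM; use M2 M0 x in linarith)
qed

lemma mulI_C: "lin (a, b, c) \<in> C.mulI (of_nat p) \<longleftrightarrow> int p dvd a \<and> int p dvd b \<and> int p dvd c"
proof
  assume "lin (a, b, c) \<in> C.mulI (of_nat p)"
  then obtain a' b' c' where "lin (a, b, c) = of_nat p * lin (a', b', c')"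
    unfolding C.mulI_def C_R by (metis imageE prod_cases3)
  also have "\<dots> = lin (int p * a', int p * b', int p * c')" unfolding lin_def by (simp add: algebra_simps)
  finally show "int p dvd a \<and> int p dvd b \<and> int p dvd c" by (auto dest!: lin_inj)
next
  assume "int p dvd a \<and> int p dvd b \<and> int p dvd c"
  then obtain a' b' c' where "a = int p * a'" "b = int p * b'" "c = int p * c'" by (auto simp: dvd_def)
  then have "lin (a, b, c) = of_nat p * lin (a', b', c')" unfolding lin_def by (simp add: algebra_simps)
  also have "\<dots> \<in> C.mulI (of_nat p)" by (rule C.mulI_I) (simp add: C_R)
  finally show "lin (a, b, c) \<in> C.mulI (of_nat p)" .
qed

text \<open>The hypotheses say that the square of \<open>u = a + b e + c e\<^sup>2\<close> vanishes modulo \<open>q\<close>.  In the proof, \<open>t1\<close> and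
  \<open>t2\<close> are the coefficients of the characteristic polynomial of \<open>u\<close>, and \<open>t2 * u\<close> is computed by
  Cayley--Hamilton.\<close>

lemma nilpotent_trace:
  fixes a b c :: int
  assumes p: "prime (q::int)"
    and q0: "q dvd a * a - 2 * B * b * c"
    and q1: "q dvd 2 * a * b - 2 * A * b * c - B * c * c"
    and q2: "q dvd b * b + 2 * a * c - A * c * c"
  shows "q dvd 3 * a - 2 * A * c"
proof -
  define Q0 where "Q0 = a * a - 2 * B * b * c"
  define Q1 where "Q1 = 2 * a * b - 2 * A * b * c - B * c * c"
  define Q2 where "Q2 = b * b + 2 * a * c - A * c * c"
  define t1 where "t1 = 3 * a - 2 * A * c"
  define t2 where "t2 = 3 * a * a - 4 * A * a * c + A * A * c * c + 3 * B * b * c + A * b * b"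
  have Q: "q dvd Q0" "q dvd Q1" "q dvd Q2" using assms by (simp_all add: Q0_def Q1_def Q2_def)
  have "t2 * b = t1 * Q1 - a * Q1 - b * Q0 + A * (b * Q2 + c * Q1) + B * c * Q2"
    unfolding t1_def t2_def Q0_def Q1_def Q2_def by (simp add: algebra_simps)
  then have b: "q dvd t2 * b" using Q by simp
  have "t2 * c = t1 * Q2 - a * Q2 - b * Q1 - c * Q0 + A * c * Q2"
    unfolding t1_def t2_def Q0_def Q1_def Q2_def by (simp add: algebra_simps)
  then have c: "q dvd t2 * c" using Q by simp
  show ?thesis
  proof (cases "q dvd t2")
    case True
    have "t1 * t1 = 2 * t2 + 3 * Q0 - 2 * A * Q2"
      unfolding t1_def t2_def Q0_def Q2_def by (simp add: algebra_simps)
    then have "q dvd t1 * t1" using True Q by simp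
    then show ?thesis using p prime_dvd_mult_iff[of q t1 t1] by (simp add: t1_def)
  next
    case False
    then have bc: "q dvd b" "q dvd c" using b c p by (auto simp: prime_dvd_mult_iff)
    have "a * a = Q0 + 2 * B * b * c" by (simp add: Q0_def)
    then have "q dvd a * a" using Q(1) bc by simp
    then have "q dvd a" using p by (simp add: prime_dvd_mult_iff)
    with bc show ?thesis by simp
  qed
qed

text \<open>If the square of \<open>x\<close> vanishes modulo \<open>p\<close>, so do the squares of
  \<open>e x\<close> and \<open>e\<^sup>2 x\<close>, and \<open>nilpotent_trace\<close> makes all
  three traces vanish. These are linear equations in the coordinates of \<open>x\<close>, and the
  discriminant of the trace form is invertible modulo \<open>p\<close>.\<close>

lemma reduced_mod_C:
  assumes p: "prime p" "\<not> int p dvd 4 * A ^ 3 + 27 * B\<^sup>2"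
  shows "C.reduced_mod p"
  unfolding C.reduced_mod_def
proof (intro ballI impI)
  fix x assume "x \<in> C.R" and xx: "x * x \<in> C.mulI (of_nat p)"
  then obtain a b c where x: "x = lin (a, b, c)" unfolding C_R by (metis imageE prod_cases3)
  have pp: "prime (int p)" using p by simp
  have I: "C.is_ideal (C.mulI (of_nat p))" by (intro C.is_ideal_mulI) simp
  have tr: "int p dvd 3 * a - 2 * A * c" if "lin (a, b, c) * lin (a, b, c) \<in> C.mulI (of_nat p)" for a b c
  proof (rule nilpotent_trace[OF pp])
    show "int p dvd a * a - 2 * B * b * c" "int p dvd 2 * a * b - 2 * A * b * c - B * c * c"
      "int p dvd b * b + 2 * a * c - A * c * c"
      using that unfolding lin_mult mulI_C by (simp_all add: algebra_simps)
  qed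
  have sq: "(e * y) * (e * y) \<in> C.mulI (of_nat p)" if yy: "y * y \<in> C.mulI (of_nat p)" for y
  proof -
    have "(e * y) * (e * y) = (e * e) * (y * y)" by (simp add: mult_ac)
    then show ?thesis using C.idealD(4)[OF I C.mult_R[OF e_in_C e_in_C] yy] by (simp only:)
  qed
  have 1: "int p dvd 3 * a - 2 * A * c" using tr xx unfolding x by blast
  have x2: "lin (- (B * c), a - A * c, b) * lin (- (B * c), a - A * c, b) \<in> C.mulI (of_nat p)"
    using sq[OF xx[unfolded x]] unfolding e_mult_lin .
  have 2: "int p dvd 3 * (- (B * c)) - 2 * A * b" by (rule tr[OF x2])
  have 3: "int p dvd 3 * (- (B * b)) - 2 * A * (a - A * c)" by (rule tr[OF sq[OF x2, unfolded e_mult_lin]])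
  define D where "D = 4 * A ^ 3 + 27 * B\<^sup>2"
  define T1 where "T1 = 3 * a - 2 * A * c"
  define T2 where "T2 = 3 * (- (B * c)) - 2 * A * b"
  define T3 where "T3 = 3 * (- (B * b)) - 2 * A * (a - A * c)"
  have T: "int p dvd T1" "int p dvd T2" "int p dvd T3" using 1 2 3 by (simp_all add: T1_def T2_def T3_def)
  \<comment> \<open>\<open>X\<close> eliminates \<open>a\<close>; together with \<open>T2\<close> it
    is a linear system in \<open>b\<close> and \<open>c\<close> with determinant \<open>D\<close> up
    to sign.\<close>
  define X where "X = 3 * T3 + 2 * A * T1"
  have X: "int p dvd X" using T by (simp add: X_def)
  have "D * c = 2 * A * X - 9 * B * T2" "D * b = - (3 * B * X + 2 * A\<^sup>2 * T2)"
    unfolding D_def X_def T1_def T2_def T3_def by (simp_all add: algebra_simps power2_eq_square power3_eq_cube)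
  then have "int p dvd D * c" "int p dvd D * b" using T X by simp_all
  then have pc: "int p dvd c" "int p dvd b" using pp p(2) by (auto simp: prime_dvd_mult_iff D_def)
  have "D * a = 9 * B\<^sup>2 * (T1 + 2 * A * c) + 2 * A\<^sup>2 * (2 * A * A * c - T3 - 3 * B * b)"
    unfolding D_def T1_def T3_def by (simp add: algebra_simps power2_eq_square power3_eq_cube)
  then have "int p dvd D * a" using T pc by simp
  then have "int p dvd a" using pp p(2) by (auto simp: prime_dvd_mult_iff D_def)
  with pc show "x \<in> C.mulI (of_nat p)" unfolding x mulI_C by simp
qed

end

section \<open>The tower of square roots\<close>

lemma of_int_fun_apply [simp]: "(of_int z :: 'a \<Rightarrow> 'b::comm_ring_1) x = of_int z"
proof (cases z rule: int_cases2)
  case (nonneg n) then show ?thesis by simp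
next
  case (nonpos n) then show ?thesis by (simp add: fun_Compl_def)
qed

text \<open>The order is realised inside a ring of complex functions: the first two components of the index choose
  an ordering of the three roots, the last one chooses the signs of the square roots.\<close>

type_synonym idx = "nat \<times> nat \<times> (nat \<Rightarrow> bool)"

locale cubic_roots =
  fixes A B :: int and r0 r1 r2 :: complex
  assumes distinct_roots: "r0 \<noteq> r1" "r0 \<noteq> r2" "r1 \<noteq> r2"
    and roots: "r \<in> {r0, r1, r2} \<Longrightarrow> r * r * r = - (of_int A * r) - of_int B"
begin

definition rt :: "nat \<Rightarrow> complex" where
  "rt i = (if i mod 3 = 0 then r0 else if i mod 3 = 1 then r1 else r2)"

text \<open>With \<open>E2\<close>, a pair of distinct roots as a function of the ordering.
  Considering all six orderings at once gives rank 6 whatever the Galois group of the cubic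
  is.\<close>

definition E1 :: "idx \<Rightarrow> complex" where "E1 = (\<lambda>(i, j, \<sigma>). rt i)"
definition E2 :: "idx \<Rightarrow> complex" where "E2 = (\<lambda>(i, j, \<sigma>). rt (i + 1 + j mod 2))"

lemma E1_apply [simp]: "E1 (i, j, \<sigma>) = rt i" by (simp add: E1_def)
lemma E2_apply: "E2 (i, j, \<sigma>) = rt (i + 1 + j mod 2)" by (simp add: E2_def)

lemma rt_root: "rt i * rt i * rt i = - (of_int A * rt i) - of_int B"
  by (rule roots) (simp add: rt_def)

lemma rt_neq: "rt i \<noteq> rt (i + 1)" "rt i \<noteq> rt (i + 2)" "rt (i + 1) \<noteq> rt (i + 2)"
proof -
  have *: "i mod 3 = 0 \<or> i mod 3 = 1 \<or> i mod 3 = 2" by linarith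
  have 1: "(i + 1) mod 3 = (if i mod 3 = 0 then 1 else if i mod 3 = 1 then 2 else 0)" by presburger
  have 2: "(i + 2) mod 3 = (if i mod 3 = 0 then 2 else if i mod 3 = 1 then 0 else 1)" by presburger
  show "rt i \<noteq> rt (i + 1)" "rt i \<noteq> rt (i + 2)" "rt (i + 1) \<noteq> rt (i + 2)"
    unfolding rt_def 1 2 using * distinct_roots by auto
qed

lemma E12_neq: "E1 x \<noteq> E2 x"
proof -
  obtain i j s where x: "x = (i, j, s)" by (metis prod_cases3)
  have "j mod 2 = 0 \<or> j mod 2 = 1" by linarith
  then show ?thesis unfolding x E1_def E2_def using rt_neq[of i] by (auto simp: numeral_2_eq_2)
qed

lemma E1_cubic: "E1 * E1 * E1 = - (of_int A * E1) - of_int B"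
  by (rule ext) (use rt_root in \<open>auto simp: E1_def fun_Compl_def\<close>)

text \<open>With \<open>f\<close> the cubic, \<open>E2\<close> is a root of
  \<open>(f(x) - f(E1)) / (x - E1)\<close>; the division is done pointwise by
  \<open>E1 - E2\<close>, which vanishes nowhere.\<close>

lemma E2_quadratic: "E2 * E2 = (- E1) * E2 + - (E1 * E1 + of_int A)"
proof
  fix x
  have a: "E1 x * E1 x * E1 x = - (of_int A * E1 x) - of_int B" "E2 x * E2 x * E2 x = - (of_int A * E2 x) - of_int B"
    using rt_root by (auto simp: E1_def E2_def case_prod_beta)
  have "(E1 x - E2 x) * (E2 x * E2 x + E1 x * E2 x + E1 x * E1 x + of_int A)
    = (E1 x * E1 x * E1 x + of_int A * E1 x) - (E2 x * E2 x * E2 x + of_int A * E2 x)" by (simp add: algebra_simps)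
  also have "\<dots> = 0" unfolding a by simp
  finally have "E2 x * E2 x + E1 x * E2 x + E1 x * E1 x + of_int A = 0" using E12_neq[of x] by simp
  then have "E2 x * E2 x = - (E1 x * E2 x) - (E1 x * E1 x + of_int A)" by (simp add: algebra_simps eq_neg_iff_add_eq_0)
  then show "(E2 * E2) x = ((- E1) * E2 + - (E1 * E1 + of_int A)) x" by (simp add: fun_Compl_def)
qed

definition F :: "int \<Rightarrow> int" where "F n = n ^ 3 + A * n + B"

lemma F_prod: "(of_int n - E1) * (of_int n - E2) * (of_int n - (- E1 - E2)) = of_int (F n)"
proof -
  have "(of_int n - E2) * (of_int n - (- E1 - E2)) = of_int n * of_int n + of_int n * E1 - E1 * E2 - E2 * E2"
    by (simp add: algebra_simps)
  also have "\<dots> = of_int n * of_int n + of_int n * E1 + E1 * E1 + of_int A"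
    unfolding E2_quadratic by (simp add: algebra_simps)
  finally have q: "(of_int n - E2) * (of_int n - (- E1 - E2)) = of_int n * of_int n + of_int n * E1 + E1 * E1 + of_int A" .
  have "(of_int n - E1) * ((of_int n - E2) * (of_int n - (- E1 - E2)))
    = of_int n * of_int n * of_int n + of_int A * of_int n - (E1 * E1 * E1 + of_int A * E1)"
    unfolding q by (simp add: algebra_simps)
  also have "\<dots> = of_int n * of_int n * of_int n + of_int A * of_int n + of_int B"
    unfolding E1_cubic by simp
  also have "\<dots> = of_int (F n)" by (simp add: F_def power3_eq_cube)
  finally show ?thesis by (simp only: mult.assoc)
qed

sublocale base: cubic_base E1 A B
proof
  show "E1 * E1 * E1 = - (of_int A * E1) - of_int B" by (rule E1_cubic)
  fix a b c assume h: "of_int a + of_int b * E1 + of_int c * (E1 * E1) = 0"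
  note rt_neq0 = rt_neq[of 0, unfolded add_0]
  have at: "of_int a + of_int b * rt i + of_int c * (rt i * rt i) = 0" for i
    using fun_cong[OF h, of "(i, 0, \<lambda>_. False)"] by simp
  have "(rt 0 - rt 1) * (of_int b + of_int c * (rt 0 + rt 1)) =
    (of_int a + of_int b * rt 0 + of_int c * (rt 0 * rt 0)) - (of_int a + of_int b * rt 1 + of_int c * (rt 1 * rt 1))"
    by (simp add: algebra_simps)
  then have "(rt 0 - rt 1) * (of_int b + of_int c * (rt 0 + rt 1)) = 0" unfolding at by simp
  then have 1: "of_int b + of_int c * (rt 0 + rt 1) = 0" using rt_neq0(1) by simp
  have "(rt 0 - rt 2) * (of_int b + of_int c * (rt 0 + rt 2)) =
    (of_int a + of_int b * rt 0 + of_int c * (rt 0 * rt 0)) - (of_int a + of_int b * rt 2 + of_int c * (rt 2 * rt 2))"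
    by (simp add: algebra_simps)
  then have "(rt 0 - rt 2) * (of_int b + of_int c * (rt 0 + rt 2)) = 0" unfolding at by simp
  then have 2: "of_int b + of_int c * (rt 0 + rt 2) = 0" using rt_neq0(2) by simp
  have "of_int c * (rt 1 - rt 2) = (of_int b + of_int c * (rt 0 + rt 1)) - (of_int b + of_int c * (rt 0 + rt 2))"
    by (simp add: algebra_simps)
  then have "of_int c * (rt 1 - rt 2) = 0" unfolding 1 2 by simp
  then have c: "c = 0" using rt_neq0(3) by simp
  with 1 have b: "b = 0" by simp
  with c at[of 0] show "a = 0 \<and> b = 0 \<and> c = 0" by simp
qed

definition \<kappa>0 :: nat where "\<kappa>0 = (nat (1 + \<bar>A\<bar> + \<bar>B\<bar>)) * (nat (1 + \<bar>A\<bar> + \<bar>B\<bar>)) + nat \<bar>A\<bar>"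

lemma kappa0_ge: "nat (1 + \<bar>A\<bar> + \<bar>B\<bar>) \<le> \<kappa>0"
proof -
  have "m \<le> m * m + l" for m l :: nat by (cases m) auto
  then show ?thesis unfolding \<kappa>0_def .
qed

sublocale step1: quadratic_step base.Box3 3 base.K3 E2 "- E1" "- (E1 * E1 + of_int A)" \<kappa>0
proof unfold_locales
  show "- E1 \<in> base.C.R" "- (E1 * E1 + of_int A) \<in> base.C.R"
    using base.e_in_C by simp_all
  show "E2 * E2 = - E1 * E2 + - (E1 * E1 + of_int A)" by (rule E2_quadratic)
  show "base.C.op_bound (- E1) \<kappa>0"
    by (intro base.C.op_bound_uminus base.C.op_bound_mono[OF base.op_bound_e kappa0_ge])
  show "base.C.op_bound (- (E1 * E1 + of_int A)) \<kappa>0" unfolding \<kappa>0_def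
    by (intro base.C.op_bound_uminus base.C.op_bound_add base.C.op_bound_mult base.op_bound_e base.C.op_bound_of_int)
  fix u v assume uv: "u \<in> base.C.R" "v \<in> base.C.R" and z: "u + v * E2 = 0"
  \<comment> \<open>Elements of the cubic order depend on \<open>i\<close> only. Changing
    \<open>j\<close> exchanges the two values of \<open>E2\<close> over a fixed \<open>E1\<close>,
    so a relation \<open>u + v * E2 = 0\<close> forces \<open>v = 0\<close>.\<close>
  have dep: "x (i, j, s) = x (i, j', s')" if xR: "x \<in> base.C.R" for x i j j' s s'
  proof -
    obtain a b c where "x = base.lin (a, b, c)" using base.C_E[OF xR] by blast
    then show ?thesis by (simp add: base.lin_def)
  qed
  have v: "v (i, j, s) = 0" for i j s
  proof -
    have d: "u (i, 1, s) = u (i, 0, s)" "v (i, 1, s) = v (i, 0, s)" using dep uv by blast+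
    have 1: "u (i, 0, s) + v (i, 0, s) * rt (i + 1) = 0"
      using fun_cong[OF z, of "(i, 0, s)"] by (simp add: E2_apply)
    have 2: "u (i, 0, s) + v (i, 0, s) * rt (i + 2) = 0"
      unfolding d[symmetric] using fun_cong[OF z, of "(i, 1, s)"] by (simp add: E2_apply)
    have "v (i, 0, s) * (rt (i + 1) - rt (i + 2)) =
      (u (i, 0, s) + v (i, 0, s) * rt (i + 1)) - (u (i, 0, s) + v (i, 0, s) * rt (i + 2))" by (simp add: algebra_simps)
    also have "\<dots> = 0" unfolding 1 2 by simp
    finally have "v (i, 0, s) * (rt (i + 1) - rt (i + 2)) = 0" .
    then have "v (i, 0, s) = 0" using rt_neq(3)[of i] by simp
    then show ?thesis using dep[OF uv(2), of i j s 0 s] by simp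
  qed
  then have v0: "v = 0" by (auto simp: fun_eq_iff)
  with z have "u = 0" by simp
  with v0 show "u = 0 \<and> v = 0" by simp
qed

section \<open>The tower of orders and its invariants\<close>

abbreviation R' :: "(nat \<Rightarrow> (idx \<Rightarrow> complex) set) \<Rightarrow> (idx \<Rightarrow> complex) set" where
  "R' Box \<equiv> box_order.R Box"

text \<open>The discriminants of the successive extensions divide products of these integers: the
  discriminant of the cubic for the roots, and \<open>4 * F n\<close> for a square root of
  \<open>n - e\<close>, which divides \<open>F n\<close>.\<close>

definition Delta :: "nat \<Rightarrow> nat" where
  "Delta N = nat \<bar>2 * (4 * A ^ 3 + 27 * B\<^sup>2)\<bar> * (\<Prod>n\<in>{n. n \<le> N \<and> F (int n) \<noteq> 0}. nat \<bar>F (int n)\<bar>)"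

text \<open>By the last clause the elements of stage \<open>m\<close> ignore all signs from
  \<open>m\<close> on, so sign \<open>m\<close> is free for the next square root. The operator
  bounds for \<open>E1\<close> and \<open>E2\<close> are the same at every stage, which keeps the
  growth of \<open>K\<close> geometric.\<close>

definition tower :: "nat \<Rightarrow> nat \<Rightarrow> (nat \<Rightarrow> (idx \<Rightarrow> complex) set) \<Rightarrow> nat \<Rightarrow> nat \<Rightarrow> bool" where
  "tower N m Box d K \<longleftrightarrow> box_order Box d K \<and> E1 \<in> R' Box \<and> E2 \<in> R' Box \<and>
     box_order.op_bound Box E1 (\<kappa>0 + 1) \<and> box_order.op_bound Box E2 (\<kappa>0 + 1) \<and>
     (\<forall>p. prime p \<longrightarrow> \<not> p dvd Delta N \<longrightarrow> box_order.reduced_mod Box p) \<and>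
     (\<forall>x\<in>R' Box. \<forall>i j s k b. k \<ge> m \<longrightarrow> x (i, j, s(k := b)) = x (i, j, s))"

lemma not_dvd_Delta:
  assumes "prime p" "\<not> p dvd Delta N"
  shows "\<not> int p dvd 2 * (4 * A ^ 3 + 27 * B\<^sup>2)" "n \<le> N \<Longrightarrow> F (int n) \<noteq> 0 \<Longrightarrow> \<not> int p dvd F (int n)"
proof -
  have 1: "\<not> p dvd nat \<bar>2 * (4 * A ^ 3 + 27 * B\<^sup>2)\<bar>" using assms(2) dvd_mult2 unfolding Delta_def by blast
  then show "\<not> int p dvd 2 * (4 * A ^ 3 + 27 * B\<^sup>2)" by (simp only: dvd_nat_abs_iff not_False_eq_True)
  assume n: "n \<le> N" "F (int n) \<noteq> 0"
  have "nat \<bar>F (int n)\<bar> dvd (\<Prod>n\<in>{n. n \<le> N \<and> F (int n) \<noteq> 0}. nat \<bar>F (int n)\<bar>)"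
    using n by (intro dvd_prodI) auto
  then have "\<not> p dvd nat \<bar>F (int n)\<bar>" using assms(2) dvd_mult dvd_trans unfolding Delta_def by blast
  then show "\<not> int p dvd F (int n)" by (simp only: dvd_nat_abs_iff not_False_eq_True)
qed

lemma tower_base: "tower N 0 step1.Box2 6 (base.K3 * (\<kappa>0 + 2))"
  unfolding tower_def
proof (intro conjI allI impI ballI)
  show "box_order step1.Box2 6 (base.K3 * (\<kappa>0 + 2))" using step1.box_order_Box2 by simp
  show "E1 \<in> R' step1.Box2" "E2 \<in> R' step1.Box2"
    using step1.R_subset_E base.e_in_C step1.t_in_E by auto
  show "step1.E.op_bound E1 (\<kappa>0 + 1)"
    using kappa0_ge by (intro step1.op_bound_E base.C.op_bound_mono[OF base.op_bound_e]) simp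
  show "step1.E.op_bound E2 (\<kappa>0 + 1)" by (rule step1.op_bound_t)
next
  fix p assume p: "prime p" "\<not> p dvd Delta N"
  have pD: "\<not> int p dvd 4 * A ^ 3 + 27 * B\<^sup>2" using not_dvd_Delta(1)[OF p] dvd_mult by blast
  show "step1.E.reduced_mod p"
  proof (rule step1.reduced_mod_E[OF base.reduced_mod_C[OF p(1) pD] p(1)])
    show "\<not> int p dvd - (4 * A ^ 3 + 27 * B\<^sup>2)" by (subst dvd_minus_iff) (rule pD)
    \<comment> \<open>The quadratic for \<open>E2\<close> has discriminant
      \<open>- 3 E1\<^sup>2 - 4 A\<close>, the squared difference of the two other roots.
      Multiplying it by the squared derivative of the cubic at \<open>E1\<close> gives the
      discriminant of the cubic.\<close>
    let ?w = "(3 * (E1 * E1) + of_int A) * (3 * (E1 * E1) + of_int A)"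
    have three: "(3 :: idx \<Rightarrow> complex) \<in> base.C.R" using base.C.of_nat_R[of 3] by simp
    show "?w \<in> base.C.R" using base.e_in_C three by simp
    have e4: "E1 * (E1 * E1 * E1) = - (of_int A * (E1 * E1)) - of_int B * E1" unfolding E1_cubic by (simp add: algebra_simps)
    have e6: "(E1 * E1 * E1) * (E1 * E1 * E1) = of_int A * of_int A * (E1 * E1) + 2 * of_int A * of_int B * E1 + of_int B * of_int B"
      unfolding E1_cubic by (simp add: algebra_simps)
    have "(- E1 * - E1 + 4 * - (E1 * E1 + of_int A)) * ?w =
      - 27 * ((E1 * E1 * E1) * (E1 * E1 * E1)) - 54 * of_int A * (E1 * (E1 * E1 * E1)) - 27 * of_int A * of_int A * (E1 * E1) - 4 * of_int A * of_int A * of_int A"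
      by (simp add: algebra_simps)
    also have "\<dots> = of_int (- (4 * A ^ 3 + 27 * B\<^sup>2))" unfolding e6 e4 by (simp add: algebra_simps power2_eq_square power3_eq_cube)
    finally show "(- E1 * - E1 + 4 * - (E1 * E1 + of_int A)) * ?w = of_int (- (4 * A ^ 3 + 27 * B\<^sup>2))" .
  qed
next
  fix x :: "idx \<Rightarrow> complex" and i j s k b assume "x \<in> R' step1.Box2"
  then obtain u v where uv: "u \<in> base.C.R" "v \<in> base.C.R" "x = u + v * E2" unfolding step1.E_R by blast
  have dep: "x (i, j, s) = x (i, j, s')" if xR: "x \<in> base.C.R" for x s'
  proof -
    obtain a b c where "x = base.lin (a, b, c)" using base.C_E[OF xR] by blast
    then show ?thesis by (simp add: base.lin_def)
  qed
  show "x (i, j, s(k := b)) = x (i, j, s)"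
    using dep[OF uv(1), of "s(k := b)"] dep[OF uv(2), of "s(k := b)"] unfolding uv(3) by (simp add: E2_apply)
qed

definition EE :: "nat \<Rightarrow> idx \<Rightarrow> complex" where
  "EE l = (if l = 1 then E1 else if l = 2 then E2 else - E1 - E2)"

lemma tower_step:
  assumes T: "tower N m Box d K" and n: "n \<le> N" "F (int n) \<noteq> 0"
  shows "\<exists>Box'. tower N (Suc m) Box' (2 * d) (K * (N + 2 * \<kappa>0 + 4)) \<and> R' Box \<subseteq> R' Box' \<and>
    (\<exists>s\<in>R' Box'. s * s = of_int (int n) - EE l)"
proof -
  interpret Q: box_order Box d K using T by (simp add: tower_def)
  have E: "E1 \<in> Q.R" "E2 \<in> Q.R" and op: "Q.op_bound E1 (\<kappa>0 + 1)" "Q.op_bound E2 (\<kappa>0 + 1)"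
    and red: "\<And>p. prime p \<Longrightarrow> \<not> p dvd Delta N \<Longrightarrow> Q.reduced_mod p"
    and dep: "\<And>x i j s k b. x \<in> Q.R \<Longrightarrow> k \<ge> m \<Longrightarrow> x (i, j, s(k := b)) = x (i, j, s)"
    using T unfolding tower_def by blast+
  define \<alpha> where "\<alpha> = of_int (int n) - EE l"
  define k where "k = N + 2 * \<kappa>0 + 2"
  have k2: "k + 2 = N + 2 * \<kappa>0 + 4" by (simp add: k_def)
  have EER: "EE l \<in> Q.R" for l using E by (simp add: EE_def)
  have aR: "\<alpha> \<in> Q.R" unfolding \<alpha>_def using EER by simp
  \<comment> \<open>The cofactor \<open>w\<close> turns the discriminant \<open>4 * \<alpha>\<close>
    of the extension into the integer \<open>4 * F n\<close>; it also shows that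
    \<open>\<alpha>\<close> vanishes nowhere.\<close>
  have "\<exists>w\<in>Q.R. \<alpha> * w = of_int (F (int n))"
  proof -
    consider "l = 1" | "l = 2" | "EE l = - E1 - E2" unfolding EE_def by presburger
    then show ?thesis
    proof cases
      case 1
      then show ?thesis unfolding \<alpha>_def F_prod[symmetric] using E
        by (intro bexI[of _ "(of_int (int n) - E2) * (of_int (int n) - (- E1 - E2))"]) (auto simp: EE_def mult_ac simp del: of_int_of_nat_eq)
    next
      case 2
      then show ?thesis unfolding \<alpha>_def F_prod[symmetric] using E
        by (intro bexI[of _ "(of_int (int n) - E1) * (of_int (int n) - (- E1 - E2))"]) (auto simp: EE_def mult_ac simp del: of_int_of_nat_eq)
    next
      case 3
      then show ?thesis unfolding \<alpha>_def F_prod[symmetric] 3 using E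
        by (intro bexI[of _ "(of_int (int n) - E1) * (of_int (int n) - E2)"]) (auto simp: mult_ac simp del: of_int_of_nat_eq)
    qed
  qed
  then obtain w where w: "w \<in> Q.R" "\<alpha> * w = of_int (F (int n))" by blast
  have a0: "\<alpha> x \<noteq> 0" for x
  proof
    assume "\<alpha> x = 0"
    then have "(\<alpha> * w) x = 0" by simp
    then show False unfolding w(2) using n(2) by simp
  qed
  \<comment> \<open>The sign is read off the fresh coordinate \<open>m\<close>, so both square roots
    occur over the same values of the lower stage. Hence \<open>1\<close> and \<open>s\<close> are
    independent even if \<open>\<alpha>\<close> already had a square root there.\<close>
  define s where "s = (\<lambda>x :: idx. (if snd (snd x) m then 1 else - 1) * csqrt (\<alpha> x))"
  have ss: "s * s = \<alpha>"
  proof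
    fix x
    have "csqrt (\<alpha> x) * csqrt (\<alpha> x) = \<alpha> x" by (metis power2_csqrt power2_eq_square)
    then show "(s * s) x = \<alpha> x" by (simp add: s_def)
  qed
  have opE: "Q.op_bound (EE l) (2 * \<kappa>0 + 2)"
  proof -
    consider "EE l = E1" | "EE l = E2" | "EE l = - E1 + - E2" unfolding EE_def by fastforce
    then show ?thesis
    proof cases
      case 1 then show ?thesis using Q.op_bound_mono[OF op(1)] by simp
    next
      case 2 then show ?thesis using Q.op_bound_mono[OF op(2)] by simp
    next
      case 3
      have "Q.op_bound (- E1 + - E2) ((\<kappa>0 + 1) + (\<kappa>0 + 1))"
        by (intro Q.op_bound_add Q.op_bound_uminus op)
      then show ?thesis unfolding 3 by (simp add: mult_2)
    qed
  qed
  have opa: "Q.op_bound \<alpha> k"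
  proof -
    have "Q.op_bound (of_int (int n) + - EE l) (nat \<bar>int n\<bar> + (2 * \<kappa>0 + 2))"
      by (intro Q.op_bound_add Q.op_bound_uminus opE Q.op_bound_of_int)
    then show ?thesis using n(1) Q.op_bound_mono unfolding \<alpha>_def k_def by fastforce
  qed
  interpret S: quadratic_step Box d K s 0 \<alpha> k
  proof unfold_locales
    show "0 \<in> Q.R" "\<alpha> \<in> Q.R" using aR by auto
    show "s * s = 0 * s + \<alpha>" using ss by simp
    show "Q.op_bound \<alpha> k" by (rule opa)
    have "Q.op_bound (of_int 0) 0" using Q.op_bound_of_int[of 0] by simp
    then show "Q.op_bound 0 k" using Q.op_bound_mono[of "of_int 0" 0 k] by simp
    fix u v assume uv: "u \<in> Q.R" "v \<in> Q.R" and z: "u + v * s = 0"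
    have v: "v (i, j, \<sigma>) = 0" for i j \<sigma>
    proof -
      have eq: "u (i, j, \<sigma>) + v (i, j, \<sigma>) * ((if b then 1 else - 1) * csqrt (\<alpha> (i, j, \<sigma>))) = 0" for b
        using fun_cong[OF z, of "(i, j, \<sigma>(m := b))"] dep[OF uv(1) order_refl, of i j \<sigma> b]
          dep[OF uv(2) order_refl, of i j \<sigma> b] dep[OF aR order_refl, of i j \<sigma> b] by (simp add: s_def)
      have "2 * (v (i, j, \<sigma>) * csqrt (\<alpha> (i, j, \<sigma>))) = 0"
        using eq[of True] eq[of False] by simp
      then show ?thesis using a0 by simp
    qed
    then have v0: "v = 0" by (auto simp: fun_eq_iff)
    with z have "u = 0" by simp
    with v0 show "u = 0 \<and> v = 0" by simp
  qed
  have "tower N (Suc m) S.Box2 (2 * d) (K * (N + 2 * \<kappa>0 + 4))"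
    unfolding tower_def
  proof (intro conjI allI impI ballI)
    show "box_order S.Box2 (2 * d) (K * (N + 2 * \<kappa>0 + 4))" using S.box_order_Box2 unfolding k2 .
    show "E1 \<in> S.E.R" "E2 \<in> S.E.R" using S.R_subset_E E by auto
    show "S.E.op_bound E1 (\<kappa>0 + 1)" "S.E.op_bound E2 (\<kappa>0 + 1)" by (intro S.op_bound_E op)+
  next
    fix p assume p: "prime p" "\<not> p dvd Delta N"
    have "\<not> int p dvd F (int n)" "\<not> int p dvd 2" using not_dvd_Delta[OF p] n dvd_mult2 by blast+
    then have "\<not> int p dvd 2 * 2 * F (int n)" using p(1) by (simp only: prime_dvd_mult_iff prime_nat_int_transfer simp_thms)
    then have p4: "\<not> int p dvd 4 * F (int n)" by simp
    show "S.E.reduced_mod p"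
    proof (rule S.reduced_mod_E[OF red[OF p] p(1) p4 w(1)])
      show "(0 * 0 + 4 * \<alpha>) * w = of_int (4 * F (int n))" using w(2) by (simp add: mult.assoc)
    qed
  next
    fix x :: "idx \<Rightarrow> complex" and i j \<sigma> k' b assume "x \<in> S.E.R" and k: "Suc m \<le> k'"
    then obtain u v where uv: "u \<in> Q.R" "v \<in> Q.R" "x = u + v * s" unfolding S.E_R by blast
    show "x (i, j, \<sigma>(k' := b)) = x (i, j, \<sigma>)"
      using dep[OF uv(1), of k' i j \<sigma> b] dep[OF uv(2), of k' i j \<sigma> b] dep[OF aR, of k' i j \<sigma> b] k
      unfolding uv(3) by (simp add: s_def)
  qed
  moreover have "\<exists>s\<in>S.E.R. s * s = of_int (int n) - EE l" using ss S.t_in_E unfolding \<alpha>_def by blast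
  ultimately show ?thesis using S.R_subset_E by blast
qed

lemma tower_exists:
  assumes "\<And>n l. (n, l) \<in> set qs \<Longrightarrow> n \<le> N \<and> F (int n) \<noteq> 0"
  shows "\<exists>Box. tower N (length qs) Box (6 * 2 ^ length qs) (base.K3 * (\<kappa>0 + 2) * (N + 2 * \<kappa>0 + 4) ^ length qs) \<and>
    (\<forall>(n, l)\<in>set qs. \<exists>s\<in>R' Box. s * s = of_int (int n) - EE l)"
  using assms
proof (induction qs)
  case Nil
  show ?case using tower_base by (intro exI[of _ step1.Box2]) simp
next
  case (Cons q qs)
  obtain n l where q: "q = (n, l)" by (cases q)
  obtain Box where Box: "tower N (length qs) Box (6 * 2 ^ length qs) (base.K3 * (\<kappa>0 + 2) * (N + 2 * \<kappa>0 + 4) ^ length qs)"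
    "\<forall>(n, l)\<in>set qs. \<exists>s\<in>R' Box. s * s = of_int (int n) - EE l"
    using Cons.IH Cons.prems by (meson list.set_intros(2))
  have n: "n \<le> N" "F (int n) \<noteq> 0" using Cons.prems[of n l] q by auto
  obtain Box' where B': "tower N (Suc (length qs)) Box' (2 * (6 * 2 ^ length qs)) (base.K3 * (\<kappa>0 + 2) * (N + 2 * \<kappa>0 + 4) ^ length qs * (N + 2 * \<kappa>0 + 4))"
    "R' Box \<subseteq> R' Box'" "\<exists>s\<in>R' Box'. s * s = of_int (int n) - EE l"
    using tower_step[OF Box(1) n] by blast
  have "\<forall>(n, l)\<in>set (q # qs). \<exists>s\<in>R' Box'. s * s = of_int (int n) - EE l"
    using Box(2) B'(2,3) unfolding q by fastforce
  moreover have "tower N (length (q # qs)) Box' (6 * 2 ^ length (q # qs)) (base.K3 * (\<kappa>0 + 2) * (N + 2 * \<kappa>0 + 4) ^ length (q # qs))"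
    using B'(1) by (simp add: mult_ac)
  ultimately show ?case by blast
qed

text \<open>The bound for a tower of at most \<open>2 N + 3\<close> square roots: two for each of
  the \<open>N + 1\<close> values of \<open>n\<close>, and one for \<open>n0\<close>.\<close>

definition prime_bound :: "nat \<Rightarrow> nat" where
  "prime_bound N = (13 * box_const * (base.K3 * (\<kappa>0 + 2) * (N + 2 * \<kappa>0 + 4) ^ (2 * N + 3) * Delta N) ^ 4) ^ (6 * 2 ^ (2 * N + 3))"

lemma split_prime:
  assumes disc: "4 * A ^ 3 + 27 * B\<^sup>2 \<noteq> 0" and n0: "n0 \<le> N" "F (int n0) \<noteq> 0"
  obtains p e1 e2 e3 where "prime p" "\<not> int p dvd 2 * (4 * A ^ 3 + 27 * B\<^sup>2)" "p \<le> prime_bound N"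
    "[e1 + e2 + e3 = 0] (mod int p)" "[e1 * e2 + e1 * e3 + e2 * e3 = A] (mod int p)" "[e1 * e2 * e3 = - B] (mod int p)"
    "\<And>n. n \<le> N \<Longrightarrow> F (int n) \<noteq> 0 \<Longrightarrow> \<not> int p dvd F (int n) \<and> (\<exists>s. [s * s = int n - e1] (mod int p)) \<and> (\<exists>s. [s * s = int n - e2] (mod int p))"
    "\<exists>s. [s * s = int n0 - e3] (mod int p)"
proof -
  define xs where "xs = filter (\<lambda>n. F (int n) \<noteq> 0) [0..<Suc N]"
  \<comment> \<open>With the entry \<open>(n0, 3)\<close> all three factors of \<open>F n0\<close>
    become squares modulo \<open>p\<close>, so that a point with abscissa \<open>n0\<close>
    exists.\<close>
  define qs :: "(nat \<times> nat) list" where "qs = concat (map (\<lambda>n. [(n, 1), (n, 2)]) xs) @ [(n0, 3)]"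
  have "length (concat (map (\<lambda>n. [(n, 1), (n, 2 :: nat)]) ys)) = 2 * length ys" for ys :: "nat list"
    by (induction ys) auto
  moreover have "length xs \<le> Suc N" unfolding xs_def by (rule order_trans[OF length_filter_le]) simp
  ultimately have len: "length qs \<le> 2 * N + 3" by (simp add: qs_def)
  have set_xs: "set xs = {n. n \<le> N \<and> F (int n) \<noteq> 0}" by (auto simp: xs_def simp del: upt_Suc)
  have qsN: "n \<le> N \<and> F (int n) \<noteq> 0" if "(n, l) \<in> set qs" for n l
    using that n0 by (auto simp: qs_def set_xs)
  define K where "K = base.K3 * (\<kappa>0 + 2) * (N + 2 * \<kappa>0 + 4) ^ length qs"
  define d :: nat where "d = 6 * 2 ^ length qs"
  obtain Box where T: "tower N (length qs) Box d K"
    and sq: "\<forall>(n, l)\<in>set qs. \<exists>s\<in>R' Box. s * s = of_int (int n) - EE l"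
    using tower_exists[of qs N] qsN unfolding K_def d_def by blast
  interpret Q: box_order Box d K using T by (simp add: tower_def)
  have D0: "Delta N > 0" unfolding Delta_def using disc by (simp add: prod_pos)
  have K3: "base.K3 > 0" by (simp add: base.K3_def)
  interpret Q: reduced_box_order Box d K "Delta N"
  proof
    show "0 < Delta N" "0 < d" by (auto simp: D0 d_def)
    show "0 < K" using K3 by (simp add: K_def)
    show "x \<in> Q.mulI (of_nat p)" if "prime p" "\<not> p dvd Delta N" "x \<in> Q.R" "x * x \<in> Q.mulI (of_nat p)" for p x
      using T that unfolding tower_def Q.reduced_mod_def by blast
  qed
  obtain p \<phi> where p: "prime p" "\<not> p dvd Delta N" "p \<le> (13 * box_const * (K * Delta N) ^ 4) ^ d"
    and add: "\<And>x y. x \<in> Q.R \<Longrightarrow> y \<in> Q.R \<Longrightarrow> [\<phi> (x + y) = \<phi> x + \<phi> y] (mod int p)"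
    and mul: "\<And>x y. x \<in> Q.R \<Longrightarrow> y \<in> Q.R \<Longrightarrow> [\<phi> (x * y) = \<phi> x * \<phi> y] (mod int p)"
    and int: "\<And>z. [\<phi> (of_int z) = z] (mod int p)"
    by (rule Q.prime_with_homomorphism) (rule that; assumption)
  have ER: "E1 \<in> Q.R" "E2 \<in> Q.R" using T by (auto simp: tower_def)
  define E3 where "E3 = - E1 - E2"
  have E3R: "E3 \<in> Q.R" using ER by (simp add: E3_def)
  have EER: "EE l \<in> Q.R" for l using ER by (simp add: EE_def)
  have 1: "[\<phi> E1 + \<phi> E2 + \<phi> E3 = 0] (mod int p)"
  proof -
    have "[\<phi> E1 + \<phi> E2 + \<phi> E3 = \<phi> (E1 + E2) + \<phi> E3] (mod int p)"
      by (intro cong_add cong_sym[OF add] ER) simp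
    also have "[\<phi> (E1 + E2) + \<phi> E3 = \<phi> (E1 + E2 + E3)] (mod int p)"
      by (intro cong_sym[OF add] ER Q.add_R E3R)
    also have "E1 + E2 + E3 = of_int 0" by (simp add: E3_def)
    finally show ?thesis using int[of 0] cong_trans by blast
  qed
  have 2: "[\<phi> E1 * \<phi> E2 + \<phi> E1 * \<phi> E3 + \<phi> E2 * \<phi> E3 = A] (mod int p)"
  proof -
    have "[\<phi> E1 * \<phi> E2 + \<phi> E1 * \<phi> E3 + \<phi> E2 * \<phi> E3 = \<phi> (E1 * E2) + \<phi> (E1 * E3) + \<phi> (E2 * E3)] (mod int p)"
      by (intro cong_add cong_sym[OF mul] ER E3R)
    also have "[\<phi> (E1 * E2) + \<phi> (E1 * E3) + \<phi> (E2 * E3) = \<phi> (E1 * E2 + E1 * E3) + \<phi> (E2 * E3)] (mod int p)"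
      by (intro cong_add cong_sym[OF add] ER E3R Q.mult_R) simp
    also have "[\<phi> (E1 * E2 + E1 * E3) + \<phi> (E2 * E3) = \<phi> (E1 * E2 + E1 * E3 + E2 * E3)] (mod int p)"
      by (intro cong_sym[OF add] ER E3R Q.mult_R Q.add_R)
    also have "E1 * E2 + E1 * E3 + E2 * E3 = - (E1 * E1) - E1 * E2 - E2 * E2"
      unfolding E3_def by (simp add: algebra_simps)
    also have "\<dots> = of_int A" unfolding E2_quadratic by (simp add: algebra_simps)
    finally show ?thesis using int[of A] cong_trans by blast
  qed
  have 3: "[\<phi> E1 * \<phi> E2 * \<phi> E3 = - B] (mod int p)"
  proof -
    have "[\<phi> E1 * \<phi> E2 * \<phi> E3 = \<phi> (E1 * E2) * \<phi> E3] (mod int p)"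
      by (intro cong_mult cong_sym[OF mul] ER) simp
    also have "[\<phi> (E1 * E2) * \<phi> E3 = \<phi> (E1 * E2 * E3)] (mod int p)"
      by (intro cong_sym[OF mul] ER E3R Q.mult_R)
    also have "E1 * E2 * E3 = E1 * (- (E1 * E2) - E2 * E2)" unfolding E3_def by (simp add: algebra_simps)
    also have "\<dots> = E1 * E1 * E1 + of_int A * E1" unfolding E2_quadratic by (simp add: algebra_simps)
    also have "\<dots> = of_int (- B)" unfolding E1_cubic by simp
    finally show ?thesis using int[of "- B"] cong_trans by blast
  qed
  have sqr: "\<exists>s. [s * s = int n - \<phi> (EE l)] (mod int p)" if q: "(n, l) \<in> set qs" for n l
  proof -
    obtain s where s: "s \<in> Q.R" "s * s = of_int (int n) - EE l" using sq q by blast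
    have "[\<phi> s * \<phi> s + \<phi> (EE l) = \<phi> (s * s) + \<phi> (EE l)] (mod int p)"
      by (intro cong_add cong_sym[OF mul] s) simp
    also have "[\<phi> (s * s) + \<phi> (EE l) = \<phi> (s * s + EE l)] (mod int p)"
      by (intro cong_sym[OF add] Q.mult_R s EER)
    also have "s * s + EE l = of_int (int n)" unfolding s(2) by simp
    finally have "[\<phi> s * \<phi> s + \<phi> (EE l) = int n] (mod int p)" using int[of "int n"] cong_trans by blast
    then have "[\<phi> s * \<phi> s + \<phi> (EE l) - \<phi> (EE l) = int n - \<phi> (EE l)] (mod int p)"
      by (intro cong_diff) simp_all
    then show ?thesis by auto
  qed
  have bound: "p \<le> prime_bound N"
  proof -
    have "K \<le> base.K3 * (\<kappa>0 + 2) * (N + 2 * \<kappa>0 + 4) ^ (2 * N + 3)"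
      unfolding K_def using len by (intro mult_left_mono power_increasing) auto
    then have "13 * box_const * (K * Delta N) ^ 4 \<le> 13 * box_const * (base.K3 * (\<kappa>0 + 2) * (N + 2 * \<kappa>0 + 4) ^ (2 * N + 3) * Delta N) ^ 4"
      (is "?a \<le> ?b") by (intro mult_left_mono power_mono mult_right_mono) auto
    moreover have "?b > 0" using K3 D0 box_const_pos by simp
    moreover have "d \<le> 6 * 2 ^ (2 * N + 3)" unfolding d_def using len by (intro mult_left_mono power_increasing) auto
    ultimately have "?a ^ d \<le> ?b ^ (6 * 2 ^ (2 * N + 3))"
      by (intro order_trans[OF power_mono power_increasing]) auto
    with p(3) show ?thesis unfolding prime_bound_def by linarith
  qed
  have c: "\<not> int p dvd F (int n) \<and> (\<exists>s. [s * s = int n - \<phi> E1] (mod int p)) \<and> (\<exists>s. [s * s = int n - \<phi> E2] (mod int p))"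
    if n: "n \<le> N" "F (int n) \<noteq> 0" for n
  proof -
    have "(n, 1) \<in> set qs" "(n, 2) \<in> set qs" using n by (auto simp: qs_def set_xs)
    then show ?thesis using sqr[of n 1] sqr[of n 2] not_dvd_Delta(2)[OF p(1,2) n] by (simp add: EE_def)
  qed
  have e: "\<exists>s. [s * s = int n0 - \<phi> E3] (mod int p)"
    using sqr[of n0 3] by (simp add: qs_def EE_def E3_def)
  show ?thesis by (rule that[OF p(1) not_dvd_Delta(1)[OF p(1,2)] bound 1 2 3 c e])
qed

end

text \<open>The first root comes from the fundamental theorem of algebra, the others from the
  quadratic formula for the cofactor. They are distinct because the product of the squared
  differences is \<open>- (4 * A ^ 3 + 27 * B\<^sup>2)\<close>.\<close>

lemma cubic_roots_exist:
  fixes A B :: int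
  assumes disc: "4 * A ^ 3 + 27 * B\<^sup>2 \<noteq> 0"
  shows "\<exists>r0 r1 r2. cubic_roots A B r0 r1 r2"
proof -
  define P where "P = [:of_int B, of_int A, 0, 1 :: complex:]"
  have "\<not> constant (poly P)" by (simp add: constant_degree P_def)
  then obtain r0 where "poly P r0 = 0" using fundamental_theorem_of_algebra by blast
  then have r0: "r0 * r0 * r0 = - (of_int A * r0) - of_int B"
    by (simp add: P_def algebra_simps eq_neg_iff_add_eq_0)
  define q where "q = csqrt (r0 * r0 - 4 * (r0 * r0 + of_int A))"
  have q: "q * q = r0 * r0 - 4 * (r0 * r0 + of_int A)" unfolding q_def by (metis power2_csqrt power2_eq_square)
  define r1 where "r1 = (- r0 + q) / 2"
  define r2 where "r2 = (- r0 - q) / 2"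
  have s: "r2 = - r0 - r1" by (simp add: r1_def r2_def field_simps)
  have q4: "4 * (r1 * r1 + r0 * r1) = q * q - r0 * r0" by (simp add: r1_def field_simps)
  have "4 * (r1 * r1) = 4 * (r1 * r1 + r0 * r1) - 4 * (r0 * r1)" by (simp add: algebra_simps)
  also have "\<dots> = 4 * (- (r0 * r1) - (r0 * r0 + of_int A))" unfolding q4 q by (simp add: algebra_simps)
  finally have "4 * (r1 * r1) = 4 * (- (r0 * r1) - (r0 * r0 + of_int A))" .
  then have q1: "r1 * r1 = - (r0 * r1) - (r0 * r0 + of_int A)" by (subst (asm) mult_cancel_left) simp
  have cub: "t * t * t = - (of_int A * t) - of_int B" if t: "t * t = - (r0 * t) - (r0 * r0 + of_int A)" for t
  proof -
    have "t * t * t + of_int A * t + of_int B =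
      (t * t + r0 * t + (r0 * r0 + of_int A)) * (t - r0) + (r0 * r0 * r0 + of_int A * r0 + of_int B)"
      by (simp add: algebra_simps)
    also have "\<dots> = 0" unfolding t r0 by simp
    finally have z: "t * t * t + of_int A * t + of_int B = 0" .
    have "t * t * t = (t * t * t + of_int A * t + of_int B) - of_int A * t - of_int B" by simp
    then show ?thesis unfolding z by simp
  qed
  have "r2 * r2 = r0 * r0 + 2 * (r0 * r1) + r1 * r1" unfolding s by (simp add: algebra_simps)
  then have q2: "r2 * r2 = - (r0 * r2) - (r0 * r0 + of_int A)" unfolding q1 s by (simp add: algebra_simps)
  note r1 = cub[OF q1] and r2 = cub[OF q2]
  have "(r0 - r1) * (r0 - r2) = 2 * (r0 * r0) - r0 * r1 - r1 * r1" unfolding s by (simp add: algebra_simps)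
  then have e1: "(r0 - r1) * (r0 - r2) = 3 * (r0 * r0) + of_int A" unfolding q1 by simp
  have "(r1 - r2) * (r1 - r2) = 4 * (r1 * r1) + 4 * (r0 * r1) + r0 * r0" unfolding s by (simp add: algebra_simps)
  then have e2: "(r1 - r2) * (r1 - r2) = - 3 * (r0 * r0) - 4 * of_int A" unfolding q1 by simp
  have "((r0 - r1) * (r0 - r2)) * ((r0 - r1) * (r0 - r2)) * ((r1 - r2) * (r1 - r2)) =
    - 27 * ((r0 * r0 * r0) * (r0 * r0 * r0)) - 54 * of_int A * (r0 * (r0 * r0 * r0)) - 27 * of_int A * of_int A * (r0 * r0) - 4 * of_int A * of_int A * of_int A"
    unfolding e1 e2 by (simp add: algebra_simps)
  also have "\<dots> = of_int (- (4 * A ^ 3 + 27 * B\<^sup>2))"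
  proof -
    have e4: "r0 * (r0 * r0 * r0) = - (of_int A * (r0 * r0)) - of_int B * r0" unfolding r0 by (simp add: algebra_simps)
    have e6: "(r0 * r0 * r0) * (r0 * r0 * r0) = of_int A * of_int A * (r0 * r0) + 2 * of_int A * of_int B * r0 + of_int B * of_int B"
      unfolding r0 by (simp add: algebra_simps)
    show ?thesis unfolding e6 e4 by (simp add: algebra_simps power2_eq_square power3_eq_cube)
  qed
  also have "\<dots> \<noteq> 0" using disc by (simp only: of_int_eq_0_iff neg_equal_0_iff_equal not_False_eq_True)
  finally have "r0 \<noteq> r1" "r0 \<noteq> r2" "r1 \<noteq> r2" by auto
  then have "cubic_roots A B r0 r1 r2" using r0 r1 r2 by unfold_locales auto
  then show ?thesis by blast
qed

section \<open>The group law modulo a prime\<close>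

locale elliptic_mod = residues_prime p R for p :: nat and R (structure) +
  fixes A B :: int
  assumes good: "\<not> int p dvd 2 * (4 * A ^ 3 + 27 * B\<^sup>2)"
begin

abbreviation "q \<equiv> int p"
abbreviation "E \<equiv> ell_points R (A mod q) (B mod q)"
abbreviation "padd \<equiv> ell_add R (A mod q)"

definition pneg :: "int point \<Rightarrow> int point" where
  "pneg P = (case P of Infinity \<Rightarrow> Infinity | Point x y \<Rightarrow> Point x ((- y) mod q))"

definition on :: "int \<Rightarrow> int \<Rightarrow> bool" where
  "on x y \<longleftrightarrow> q dvd y * y - (x * x * x + A * x + B)"

text \<open>The three points lie on the line \<open>y = l x + k\<close>, and their abscissae are the roots, with
  multiplicity, of \<open>x\<^sup>3 + A x + B - (l x + k)\<^sup>2\<close>.\<close>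

definition line :: "int \<Rightarrow> int \<Rightarrow> int \<Rightarrow> int \<Rightarrow> int \<Rightarrow> int \<Rightarrow> int \<Rightarrow> int \<Rightarrow> bool" where
  "line l k x1 y1 x2 y2 x3 y3 \<longleftrightarrow>
     q dvd l * x1 + k - y1 \<and> q dvd l * x2 + k - y2 \<and> q dvd l * x3 + k - y3 \<and>
     q dvd x1 + x2 + x3 - l * l \<and>
     q dvd x1 * x2 + x1 * x3 + x2 * x3 - (A - 2 * l * k) \<and>
     q dvd x1 * x2 * x3 - (k * k - B)"

lemma q_pos: "q > 0" using p_prime prime_gt_0_nat by simp

lemma q_prime: "prime q" using p_prime by simp

lemma q_dvd_mult: "q dvd a * b \<longleftrightarrow> q dvd a \<or> q dvd b"
  using q_prime by (rule prime_dvd_mult_iff)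

lemma q_odd: "\<not> q dvd 2" using good dvd_mult2 by blast

lemma disc: "\<not> q dvd 4 * A ^ 3 + 27 * B\<^sup>2" using good dvd_mult by blast

lemma q_dvd_double: "q dvd 2 * a \<longleftrightarrow> q dvd a" using q_odd by (auto simp: q_dvd_mult)

lemma residue_unique: "0 \<le> x \<Longrightarrow> x < q \<Longrightarrow> 0 \<le> y \<Longrightarrow> y < q \<Longrightarrow> q dvd x - y \<Longrightarrow> x = y"
  using mod_eq_dvd_iff[of x q y] by simp

lemma mod_dvd: "q dvd x mod q - x" "q dvd x - x mod q"
  by (simp_all add: minus_mod_eq_mult_div) (metis dvd_minus_mod dvd_diff_commute)

lemma carrier_iff: "x \<in> carrier R \<longleftrightarrow> 0 \<le> x \<and> x < q"
  unfolding res_carrier_eq by auto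

lemma pow_eq: "x \<in> carrier R \<Longrightarrow> x [^] (n::nat) = x ^ n mod q"
  using pow_cong[of x n] by (simp add: carrier_iff)

lemma point_iff: "Point x y \<in> E \<longleftrightarrow> 0 \<le> x \<and> x < q \<and> 0 \<le> y \<and> y < q \<and> on x y"
proof -
  have "y [^] (2::nat) = x [^] (3::nat) \<oplus> A mod q \<otimes> x \<oplus> B mod q \<longleftrightarrow> on x y" if "x \<in> carrier R" "y \<in> carrier R"
  proof -
    have "x [^] (3::nat) \<oplus> A mod q \<otimes> x \<oplus> B mod q = (x ^ 3 + A * x + B) mod q"
      unfolding pow_eq[OF that(1)] res_add_eq res_mult_eq by (simp add: mod_simps)
    then show ?thesis unfolding pow_eq[OF that(2)] on_def
      by (simp add: mod_eq_dvd_iff power2_eq_square power3_eq_cube)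
  qed
  then show ?thesis unfolding ell_points_def using carrier_iff by auto
qed

lemma inf_in [simp]: "Infinity \<in> E" by (simp add: ell_points_def)

lemma finite_E: "finite E"
proof -
  have "E \<subseteq> insert Infinity ((\<lambda>(x, y). Point x y) ` (carrier R \<times> carrier R))"
    by (auto simp: ell_points_def)
  then show ?thesis by (rule finite_subset) simp
qed

lemma inv_spec:
  assumes "\<not> q dvd u" "u \<in> carrier R"
  shows "inv u \<in> carrier R" "q dvd u * inv u - 1"
proof -
  have "u \<noteq> \<zero>" using assms by (auto simp: res_zero_eq)
  then have U: "u \<in> Units R" using assms(2) field_Units by auto
  then show "inv u \<in> carrier R" by simp
  have "u \<otimes> inv u = \<one>" using U by simp
  then have "(u * inv u) mod q = 1 mod q" unfolding res_mult_eq res_one_eq using p_prime prime_gt_1_nat by simp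
  then show "q dvd u * inv u - 1" by (simp add: mod_eq_dvd_iff)
qed

lemma res_minus_eq: "x \<ominus> y = (x - y) mod q"
  unfolding a_minus_def res_add_eq res_neg_eq by (simp add: mod_simps)

lemma nmult_eq: "x \<in> carrier R \<Longrightarrow> [(2::nat)] \<cdot> x = (2 * x) mod q" "x \<in> carrier R \<Longrightarrow> [(3::nat)] \<cdot> x = (3 * x) mod q"
  by (simp_all add: numeral_2_eq_2 numeral_3_eq_3 add.nat_pow_Suc add.nat_pow_0 res_add_eq res_zero_eq mod_simps)

lemma on_mod: "on x y \<Longrightarrow> q dvd x' - x \<Longrightarrow> q dvd y' - y \<Longrightarrow> on x' y'"
proof -
  assume h: "on x y" "q dvd x' - x" "q dvd y' - y"
  have eq: "y' * y' - (x' * x' * x' + A * x' + B) = (y * y - (x * x * x + A * x + B))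
    + (y' + y) * (y' - y) - (x' * x' + x' * x + x * x + A) * (x' - x)" by (simp add: algebra_simps)
  show "on x' y'" unfolding on_def eq using h[unfolded on_def] by simp
qed

section \<open>Addition expressed by collinearity\<close>

lemma add_affine:
  assumes P: "Point x1 y1 \<in> E" and Q: "Point x2 y2 \<in> E" and ne: "\<not> (x1 = x2 \<and> y1 = (- y2) mod q)"
  shows "\<exists>l. padd (Point x1 y1) (Point x2 y2) =
      Point ((l * l - x1 - x2) mod q) ((- (l * (l * l - x1 - x2) + (y1 - l * x1))) mod q) \<and>
    (x1 \<noteq> x2 \<longrightarrow> q dvd l * (x2 - x1) - (y2 - y1)) \<and>
    (x1 = x2 \<longrightarrow> y1 = y2 \<and> \<not> q dvd y1 \<and> q dvd 2 * y1 * l - (3 * x1 * x1 + A))"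
proof -
  note P' = P[unfolded point_iff] and Q' = Q[unfolded point_iff]
  have car: "x1 \<in> carrier R" "y1 \<in> carrier R" "x2 \<in> carrier R" "y2 \<in> carrier R" using P' Q' carrier_iff by auto
  define l where "l = (if x1 = x2 then ([(3::nat)] \<cdot> (x1 [^] (2::nat)) \<oplus> (A mod q)) \<otimes> inv ([(2::nat)] \<cdot> y1)
                  else (y2 \<ominus> y1) \<otimes> inv (x2 \<ominus> x1))"
  have ne': "\<not> (x1 = x2 \<and> y1 = \<ominus> y2)" using ne by (simp add: res_neg_eq)
  have "padd (Point x1 y1) (Point x2 y2) =
     (let x3 = l [^] (2::nat) \<ominus> x1 \<ominus> x2 in Point x3 (l \<otimes> (x1 \<ominus> x3) \<ominus> y1))"
    unfolding ell_add_def l_def Let_def using ne' by simp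
  moreover have lc: "l \<in> carrier R"
    unfolding l_def using mod_in_carrier by (auto simp: res_mult_eq)
  have "l [^] (2::nat) \<ominus> x1 \<ominus> x2 = (l * l - x1 - x2) mod q"
    unfolding pow_eq[OF lc] res_minus_eq by (simp add: mod_simps power2_eq_square)
  moreover have "l \<otimes> (x1 \<ominus> (l * l - x1 - x2) mod q) \<ominus> y1 = (- (l * (l * l - x1 - x2) + (y1 - l * x1))) mod q"
    unfolding res_mult_eq res_minus_eq by (simp add: mod_simps algebra_simps)
  ultimately have 1: "padd (Point x1 y1) (Point x2 y2) =
    Point ((l * l - x1 - x2) mod q) ((- (l * (l * l - x1 - x2) + (y1 - l * x1))) mod q)" by (simp add: Let_def)
  have 2: "q dvd l * (x2 - x1) - (y2 - y1)" if "x1 \<noteq> x2"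
  proof -
    define u where "u = x2 \<ominus> x1"
    have u: "u = (x2 - x1) mod q" by (simp add: u_def res_minus_eq)
    have "\<not> q dvd x2 - x1" using residue_unique[of x2 x1] P' Q' that by auto
    then have "\<not> q dvd u" unfolding u by (simp add: dvd_mod_iff)
    then have i: "q dvd u * inv u - 1" using inv_spec(2)[of u] u mod_in_carrier by auto
    have "l = ((y2 - y1) * inv u) mod q" unfolding l_def u_def[symmetric] using that by (simp add: res_minus_eq res_mult_eq mod_simps)
    then have "q dvd l - (y2 - y1) * inv u" using mod_dvd(1) by simp
    moreover have "q dvd u - (x2 - x1)" using mod_dvd(1) u by simp
    moreover have eq: "l * (x2 - x1) - (y2 - y1) = (l - (y2 - y1) * inv u) * (x2 - x1)
       - (y2 - y1) * inv u * (u - (x2 - x1)) + (y2 - y1) * (u * inv u - 1)" by (simp add: algebra_simps)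
    ultimately show ?thesis unfolding eq using i by simp
  qed
  have 3: "y1 = y2 \<and> \<not> q dvd y1 \<and> q dvd 2 * y1 * l - (3 * x1 * x1 + A)" if x: "x1 = x2"
  proof -
    have eq: "(y1 - y2) * (y1 + y2) = (y1 * y1 - (x1 * x1 * x1 + A * x1 + B)) - (y2 * y2 - (x2 * x2 * x2 + A * x2 + B))"
      unfolding x by (simp add: algebra_simps)
    have "q dvd (y1 - y2) * (y1 + y2)" unfolding eq using P' Q' by (intro dvd_diff[where x = q, OF iffD1[OF on_def] iffD1[OF on_def]]) auto
    moreover have "\<not> q dvd y1 + y2"
    proof
      assume "q dvd y1 + y2"
      then have "y1 mod q = (- y2) mod q" by (simp add: mod_eq_dvd_iff)
      then show False using ne x P' by simp
    qed
    ultimately have "q dvd y1 - y2" by (simp add: q_dvd_mult)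
    then have y: "y1 = y2" using residue_unique P' Q' by blast
    with \<open>\<not> q dvd y1 + y2\<close> have y0: "\<not> q dvd y1" by auto
    define u where "u = [(2::nat)] \<cdot> y1"
    have u: "u = (2 * y1) mod q" using nmult_eq(1)[OF car(2)] by (simp add: u_def)
    have "\<not> q dvd u" unfolding u using y0 by (simp add: dvd_mod_iff q_dvd_double)
    then have i: "q dvd u * inv u - 1" using inv_spec(2)[of u] u mod_in_carrier by auto
    have "l = ((3 * x1 * x1 + A) * inv u) mod q" unfolding l_def u_def[symmetric] using x car
      by (simp add: pow_eq nmult_eq res_mult_eq res_add_eq mod_simps power2_eq_square mult.assoc)
    then have "q dvd l - (3 * x1 * x1 + A) * inv u" using mod_dvd(1) by simp
    moreover have "q dvd u - 2 * y1" using mod_dvd(1) u by simp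
    moreover have eq: "2 * y1 * l - (3 * x1 * x1 + A) = 2 * y1 * (l - (3 * x1 * x1 + A) * inv u)
      - (3 * x1 * x1 + A) * inv u * (u - 2 * y1) + (3 * x1 * x1 + A) * (u * inv u - 1)" by (simp add: algebra_simps)
    ultimately have "q dvd 2 * y1 * l - (3 * x1 * x1 + A)" unfolding eq using i by simp
    with y y0 show ?thesis by blast
  qed
  from 1 2 3 show ?thesis by blast
qed

text \<open>With \<open>f\<close> the cubic, \<open>c1 x + c0\<close> is
  \<open>f(x) - (l x + k)\<^sup>2 - (x - x1) (x - x2) (x - x3)\<close>; the choice of
  \<open>x3\<close> removes the quadratic term. It vanishes at \<open>x1\<close> and
  \<open>x2\<close>, doubly in the tangent case, so both coefficients vanish modulo
  \<open>q\<close>.\<close>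

lemma line_chord:
  assumes on: "on x1 y1" "on x2 y2"
    and c: "\<not> q dvd x2 - x1 \<and> q dvd l * (x2 - x1) - (y2 - y1) \<or>
      x1 = x2 \<and> y1 = y2 \<and> q dvd 2 * y1 * l - (3 * x1 * x1 + A)"
  defines "k \<equiv> y1 - l * x1" and "x3 \<equiv> l * l - x1 - x2"
  shows "line l k x1 y1 x2 y2 x3 (l * x3 + k)" "on x3 (l * x3 + k)"
proof -
  define c1 where "c1 = (A - 2 * l * k) - (x1 * x2 + x1 * x3 + x2 * x3)"
  define c0 where "c0 = B - k * k + x1 * x2 * x3"
  have g1: "c1 * x1 + c0 = - (y1 * y1 - (x1 * x1 * x1 + A * x1 + B))"
    unfolding c1_def c0_def k_def x3_def by (simp add: algebra_simps)
  have e2: "q dvd l * x2 + k - y2" using c unfolding k_def by (auto simp: algebra_simps)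
  have d1: "q dvd c1 * x1 + c0" unfolding g1 dvd_minus_iff using on(1) unfolding on_def .
  have c1: "q dvd c1"
    using c
  proof
    assume h: "\<not> q dvd x2 - x1 \<and> q dvd l * (x2 - x1) - (y2 - y1)"
    have g2: "c1 * x2 + c0 = - (y2 * y2 - (x2 * x2 * x2 + A * x2 + B)) - (l * x2 + k + y2) * (l * x2 + k - y2)"
      unfolding c1_def c0_def x3_def by (simp add: algebra_simps)
    have "q dvd c1 * x2 + c0" unfolding g2
      by (rule dvd_diff[OF iffD2[OF dvd_minus_iff on(2)[unfolded on_def]] dvd_mult[OF e2]])
    then have "q dvd (c1 * x2 + c0) - (c1 * x1 + c0)" by (rule dvd_diff[OF _ d1])
    then have "q dvd c1 * (x2 - x1)" by (simp add: algebra_simps)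
    then show ?thesis using h by (simp add: q_dvd_mult)
  next
    assume h: "x1 = x2 \<and> y1 = y2 \<and> q dvd 2 * y1 * l - (3 * x1 * x1 + A)"
    then have x: "x2 = x1" and t: "q dvd 2 * y1 * l - (3 * x1 * x1 + A)" by auto
    have "c1 = - (2 * y1 * l - (3 * x1 * x1 + A))"
      unfolding c1_def x3_def k_def x by (simp add: algebra_simps)
    then show ?thesis using t by (simp only: dvd_minus_iff)
  qed
  have "c0 = (c1 * x1 + c0) - c1 * x1" by simp
  also have "q dvd \<dots>" by (rule dvd_diff[OF d1 dvd_mult2[OF c1]])
  finally have c0: "q dvd c0" .
  have "x1 * x2 + x1 * x3 + x2 * x3 - (A - 2 * l * k) = - c1" "x1 * x2 * x3 - (k * k - B) = c0"
    unfolding c1_def c0_def by simp_all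
  then have "q dvd x1 * x2 + x1 * x3 + x2 * x3 - (A - 2 * l * k)" "q dvd x1 * x2 * x3 - (k * k - B)"
    using c1 c0 by (simp_all only: dvd_minus_iff)
  moreover have "q dvd l * x1 + k - y1" "q dvd l * x3 + k - (l * x3 + k)" "q dvd x1 + x2 + x3 - l * l"
    by (simp_all add: k_def x3_def)
  ultimately show "line l k x1 y1 x2 y2 x3 (l * x3 + k)" unfolding line_def using e2 by blast
  have "(l * x3 + k) * (l * x3 + k) - (x3 * x3 * x3 + A * x3 + B) = - (c1 * x3 + c0)"
    unfolding c1_def c0_def x3_def by (simp add: algebra_simps)
  moreover have "q dvd c1 * x3 + c0" by (rule dvd_add[OF dvd_mult2[OF c1] c0])
  ultimately show "on x3 (l * x3 + k)" unfolding on_def by (simp only: dvd_minus_iff)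
qed

lemma line_cong:
  assumes "line l k x1 y1 x2 y2 x3 y3" "q dvd x3' - x3" "q dvd y3' - y3"
  shows "line l k x1 y1 x2 y2 x3' y3'"
proof -
  note h = assms(1)[unfolded line_def]
  have eq: "l * x3' + k - y3' = (l * x3 + k - y3) + l * (x3' - x3) - (y3' - y3)"
    "x1 + x2 + x3' - l * l = (x1 + x2 + x3 - l * l) + (x3' - x3)"
    "x1 * x2 + x1 * x3' + x2 * x3' - (A - 2 * l * k) = (x1 * x2 + x1 * x3 + x2 * x3 - (A - 2 * l * k)) + (x1 + x2) * (x3' - x3)"
    "x1 * x2 * x3' - (k * k - B) = (x1 * x2 * x3 - (k * k - B)) + x1 * x2 * (x3' - x3)"
    by (simp_all add: algebra_simps)
  have g: "q dvd l * x3 + k - y3" "q dvd x1 + x2 + x3 - l * l" "q dvd x1 * x2 + x1 * x3 + x2 * x3 - (A - 2 * l * k)"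
    "q dvd x1 * x2 * x3 - (k * k - B)" using h by blast+
  have "q dvd l * x3' + k - y3'" "q dvd x1 + x2 + x3' - l * l" "q dvd x1 * x2 + x1 * x3' + x2 * x3' - (A - 2 * l * k)"
    "q dvd x1 * x2 * x3' - (k * k - B)"
    unfolding eq by (rule dvd_diff[OF dvd_add[OF g(1) dvd_mult[OF assms(2)]] assms(3)] dvd_add[OF g(2) assms(2)]
      dvd_add[OF g(3) dvd_mult[OF assms(2)]] dvd_add[OF g(4) dvd_mult[OF assms(2)]])+
  then show ?thesis unfolding line_def using h by blast
qed

lemma line_swap12: "line l k x1 y1 x2 y2 x3 y3 \<Longrightarrow> line l k x2 y2 x1 y1 x3 y3"
  unfolding line_def by (simp add: algebra_simps)

lemma line_swap23: "line l k x1 y1 x2 y2 x3 y3 \<Longrightarrow> line l k x1 y1 x3 y3 x2 y2"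
  unfolding line_def by (simp add: algebra_simps)

lemma neg_in: "P \<in> E \<Longrightarrow> pneg P \<in> E"
proof (cases P)
  case (Point x y)
  assume "P \<in> E"
  then have h: "0 \<le> x" "x < q" "on x y" unfolding Point point_iff by auto
  have "on x (- y)" using h unfolding on_def by simp
  then have "on x ((- y) mod q)" by (rule on_mod) (simp_all only: mod_dvd diff_self dvd_0_right)
  then show ?thesis using h q_pos by (simp add: Point pneg_def point_iff)
qed (simp add: pneg_def)

lemma neg_neg: "P \<in> E \<Longrightarrow> pneg (pneg P) = P"
  by (cases P) (auto simp: pneg_def point_iff mod_simps)

lemma neg_Point: "pneg (Point x y) = Point x ((- y) mod q)" by (simp add: pneg_def)

text \<open>Uniqueness of the chord or tangent. In the tangent case the conditions on the roots give
  \<open>2 l y1 = 3 x1\<^sup>2 + A\<close> modulo \<open>q\<close>, and \<open>y1\<close> is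
  invertible because the points are not opposite.\<close>

lemma line_slope:
  assumes P: "Point x1 y1 \<in> E" and Q: "Point x2 y2 \<in> E" and ne: "Point x2 y2 \<noteq> pneg (Point x1 y1)"
    and L: "line l k x1 y1 x2 y2 x3 y3" and L': "line l' k' x1 y1 x2 y2 x3' y3'"
  shows "q dvd l - l'" "q dvd k - k'" "q dvd x3 - x3'" "q dvd y3 - y3'"
proof -
  note P' = P[unfolded point_iff] and Q' = Q[unfolded point_iff]
  note h = L[unfolded line_def] and h' = L'[unfolded line_def]
  show ll: "q dvd l - l'"
  proof (cases "x1 = x2")
    case False
    then have "\<not> q dvd x1 - x2" using residue_unique P' Q' by blast
    moreover have eq: "(l - l') * (x1 - x2) = (l * x1 + k - y1) - (l * x2 + k - y2) - (l' * x1 + k' - y1) + (l' * x2 + k' - y2)"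
      by (simp add: algebra_simps)
    have "q dvd l * x1 + k - y1" "q dvd l * x2 + k - y2" "q dvd l' * x1 + k' - y1" "q dvd l' * x2 + k' - y2"
      using h h' by blast+
    then have "q dvd (l - l') * (x1 - x2)" unfolding eq by (intro dvd_add[OF dvd_diff[OF dvd_diff]])
    ultimately show ?thesis by (simp add: q_dvd_mult)
  next
    case x: True
    have nyy: "\<not> q dvd y1 + y2"
    proof
      assume "q dvd y1 + y2"
      then have "y2 mod q = (- y1) mod q" by (simp add: mod_eq_dvd_iff add.commute)
      then show False using ne x Q' by (simp add: neg_Point)
    qed
    have eq: "y1 - y2 = (l * x2 + k - y2) - (l * x1 + k - y1)" using x by simp
    have "q dvd l * x1 + k - y1" "q dvd l * x2 + k - y2" using h by blast+
    then have "q dvd y1 - y2" unfolding eq by (intro dvd_diff[of q "l * x2 + k - y2" "l * x1 + k - y1"])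
    then have y: "y1 = y2" using residue_unique P' Q' by blast
    have y1: "\<not> q dvd y1" using nyy y by auto
    have t: "q dvd 3 * x1 * x1 + A - 2 * l * y1" if "line l k x1 y1 x2 y2 x3 y3" for l k x3 y3
    proof -
      note g = that[unfolded line_def, folded x]
      have eq: "3 * x1 * x1 + A - 2 * l * y1 = 2 * l * (l * x1 + k - y1) + 2 * x1 * (x1 + x1 + x3 - l * l)
        - (x1 * x1 + x1 * x3 + x1 * x3 - (A - 2 * l * k))" by (simp add: algebra_simps)
      have "q dvd l * x1 + k - y1" "q dvd x1 + x1 + x3 - l * l" "q dvd x1 * x1 + x1 * x3 + x1 * x3 - (A - 2 * l * k)"
        using g by blast+
      then show ?thesis unfolding eq by (intro dvd_diff[OF dvd_add[OF dvd_mult dvd_mult]])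
    qed
    have eq: "2 * ((l - l') * y1) = (3 * x1 * x1 + A - 2 * l' * y1) - (3 * x1 * x1 + A - 2 * l * y1)" by (simp add: algebra_simps)
    have "q dvd 2 * ((l - l') * y1)" unfolding eq by (rule dvd_diff[OF t[OF L'] t[OF L]])
    then show ?thesis using y1 q_odd by (simp add: q_dvd_mult)
  qed
  have g: "q dvd l * x1 + k - y1" "q dvd l' * x1 + k' - y1" "q dvd x1 + x2 + x3 - l * l" "q dvd x1 + x2 + x3' - l' * l'"
    "q dvd l * x3 + k - y3" "q dvd l' * x3' + k' - y3'" using h h' by blast+
  have "k - k' = (l * x1 + k - y1) - (l' * x1 + k' - y1) - (l - l') * x1" by (simp add: algebra_simps)
  also have "q dvd \<dots>" by (rule dvd_diff[OF dvd_diff[OF g(1,2)] dvd_mult2[OF ll]])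
  finally show kk: "q dvd k - k'" .
  have "x3 - x3' = (x1 + x2 + x3 - l * l) - (x1 + x2 + x3' - l' * l') + (l + l') * (l - l')" by (simp add: algebra_simps)
  also have "q dvd \<dots>" by (rule dvd_add[OF dvd_diff[OF g(3,4)] dvd_mult[OF ll]])
  finally show xx: "q dvd x3 - x3'" .
  have "y3 - y3' = (l' * x3' + k' - y3') - (l * x3 + k - y3) + l * (x3 - x3') + x3' * (l - l') + (k - k')" by (simp add: algebra_simps)
  also have "q dvd \<dots>"
    by (rule dvd_add[OF dvd_add[OF dvd_add[OF dvd_diff[OF g(6,5)] dvd_mult[OF xx]] dvd_mult[OF ll]] kk])
  finally show "q dvd y3 - y3'" .
qed

lemma add_line:
  assumes P: "Point x1 y1 \<in> E" and Q: "Point x2 y2 \<in> E" and ne: "Point x2 y2 \<noteq> pneg (Point x1 y1)"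
  shows "\<exists>l k x3 y3. Point x3 y3 \<in> E \<and> padd (Point x1 y1) (Point x2 y2) = pneg (Point x3 y3) \<and> line l k x1 y1 x2 y2 x3 y3"
proof -
  note P' = P[unfolded point_iff] and Q' = Q[unfolded point_iff]
  have ne': "\<not> (x1 = x2 \<and> y1 = (- y2) mod q)"
  proof
    assume h: "x1 = x2 \<and> y1 = (- y2) mod q"
    then have "(- y1) mod q = y2" using Q' by (simp add: mod_simps)
    then show False using ne h by (simp add: neg_Point)
  qed
  obtain l where l: "padd (Point x1 y1) (Point x2 y2) =
      Point ((l * l - x1 - x2) mod q) ((- (l * (l * l - x1 - x2) + (y1 - l * x1))) mod q)"
    "x1 \<noteq> x2 \<longrightarrow> q dvd l * (x2 - x1) - (y2 - y1)"
    "x1 = x2 \<longrightarrow> y1 = y2 \<and> \<not> q dvd y1 \<and> q dvd 2 * y1 * l - (3 * x1 * x1 + A)"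
    using add_affine[OF P Q ne'] by blast
  have c: "\<not> q dvd x2 - x1 \<and> q dvd l * (x2 - x1) - (y2 - y1) \<or>
      x1 = x2 \<and> y1 = y2 \<and> q dvd 2 * y1 * l - (3 * x1 * x1 + A)"
    using l(2,3) residue_unique[of x2 x1] P' Q' by blast
  define k where "k = y1 - l * x1"
  define X where "X = l * l - x1 - x2"
  have LL: "line l k x1 y1 x2 y2 X (l * X + k)" "on X (l * X + k)"
    using line_chord[OF _ _ c] P' Q' unfolding k_def X_def by blast+
  define x3 where "x3 = X mod q"
  define y3 where "y3 = (l * X + k) mod q"
  have d: "q dvd x3 - X" "q dvd y3 - (l * X + k)" unfolding x3_def y3_def using mod_dvd by auto
  have "Point x3 y3 \<in> E" unfolding point_iff using on_mod[OF LL(2) d] q_pos by (simp add: x3_def y3_def)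
  moreover have "line l k x1 y1 x2 y2 x3 y3" by (rule line_cong[OF LL(1) d])
  moreover have "padd (Point x1 y1) (Point x2 y2) = pneg (Point x3 y3)"
    unfolding l(1) neg_Point x3_def y3_def X_def k_def by (simp add: mod_simps)
  ultimately show ?thesis by blast
qed

text \<open>Together with \<open>add_line\<close> this replaces slopes and inverses by the symmetric
  relation \<open>line\<close>: commutativity, negation and cancellation become permutations or sign
  changes in it.\<close>

lemma line_add:
  assumes P: "Point x1 y1 \<in> E" and Q: "Point x2 y2 \<in> E" and S: "Point x3 y3 \<in> E"
    and ne: "Point x2 y2 \<noteq> pneg (Point x1 y1)" and L: "line l k x1 y1 x2 y2 x3 y3"
  shows "padd (Point x1 y1) (Point x2 y2) = pneg (Point x3 y3)"
proof -
  obtain l' k' x3' y3' where h: "Point x3' y3' \<in> E" "padd (Point x1 y1) (Point x2 y2) = pneg (Point x3' y3')"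
    "line l' k' x1 y1 x2 y2 x3' y3'" using add_line[OF P Q ne] by blast
  have "x3 = x3'" "y3 = y3'"
    using line_slope(3,4)[OF P Q ne L h(3)] residue_unique S h(1) unfolding point_iff by blast+
  then show ?thesis using h(2) by simp
qed

lemma add_Inf [simp]: "padd Infinity P = P" "padd P Infinity = P"
  by (cases P; simp add: ell_add_def)+

lemma add_neg_self: "P \<in> E \<Longrightarrow> padd P (pneg P) = Infinity"
proof (cases P)
  case (Point x y)
  assume "P \<in> E"
  then have "\<ominus> ((- y) mod q) = y" unfolding Point point_iff res_neg_eq by (simp add: mod_simps)
  then show ?thesis by (simp add: Point neg_Point ell_add_def)
qed (simp add: pneg_def)

lemma add_closed: "P \<in> E \<Longrightarrow> Q \<in> E \<Longrightarrow> padd P Q \<in> E"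
proof (cases P; cases Q)
  fix x1 y1 x2 y2 assume h: "P \<in> E" "Q \<in> E" "P = Point x1 y1" "Q = Point x2 y2"
  show ?thesis
  proof (cases "Q = pneg P")
    case True then show ?thesis using add_neg_self h by simp
  next
    case False
    then show ?thesis using add_line[of x1 y1 x2 y2] h neg_in by metis
  qed
qed auto

lemma add_comm: "P \<in> E \<Longrightarrow> Q \<in> E \<Longrightarrow> padd P Q = padd Q P"
proof (cases P; cases Q)
  fix x1 y1 x2 y2 assume h: "P \<in> E" "Q \<in> E" "P = Point x1 y1" "Q = Point x2 y2"
  show ?thesis
  proof (cases "Q = pneg P")
    case True
    then have "P = pneg Q" using neg_neg h by simp
    then show ?thesis using add_neg_self True h by metis
  next
    case False
    then have F: "Point x2 y2 \<noteq> pneg (Point x1 y1)" "Point x1 y1 \<noteq> pneg (Point x2 y2)" using h neg_neg by metis+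
    obtain l k x3 y3 where L: "Point x3 y3 \<in> E" "padd (Point x1 y1) (Point x2 y2) = pneg (Point x3 y3)" "line l k x1 y1 x2 y2 x3 y3"
      using add_line[OF _ _ F(1)] h by blast
    have "padd (Point x2 y2) (Point x1 y1) = pneg (Point x3 y3)"
      using line_add[OF _ _ L(1) F(2) line_swap12[OF L(3)]] h by blast
    then show ?thesis using L(2) h by simp
  qed
qed auto

lemma neg_add: "P \<in> E \<Longrightarrow> Q \<in> E \<Longrightarrow> pneg (padd P Q) = padd (pneg P) (pneg Q)"
proof (cases P; cases Q)
  fix x1 y1 x2 y2 assume h: "P \<in> E" "Q \<in> E" "P = Point x1 y1" "Q = Point x2 y2"
  show ?thesis
  proof (cases "Q = pneg P")
    case True
    then show ?thesis using add_neg_self[of P] add_neg_self[of "pneg P"] neg_in h by (simp add: pneg_def)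
  next
    case False
    then have F: "Point x2 y2 \<noteq> pneg (Point x1 y1)" using h by simp
    obtain l k x3 y3 where L: "Point x3 y3 \<in> E" "padd (Point x1 y1) (Point x2 y2) = pneg (Point x3 y3)" "line l k x1 y1 x2 y2 x3 y3"
      using add_line[OF _ _ F] h by blast
    note g = L(3)[unfolded line_def]
    have md: "q dvd - (l * x) + - k - (- y) mod q" if "q dvd l * x + k - y" for x y
    proof -
      have "- (l * x) + - k - (- y) mod q = - (l * x + k - y) + (- y - (- y) mod q)" by simp
      then show ?thesis using that mod_dvd(2)[of "- y"] by (metis dvd_add dvd_minus_iff)
    qed
    have "line (- l) (- k) x1 ((- y1) mod q) x2 ((- y2) mod q) x3 ((- y3) mod q)"
      unfolding line_def using g md by simp
    moreover have "pneg (Point x2 y2) \<noteq> pneg (pneg (Point x1 y1))" using F neg_neg neg_in h by metis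
    moreover have "pneg (Point x1 y1) \<in> E" "pneg (Point x2 y2) \<in> E" "pneg (Point x3 y3) \<in> E" using neg_in h L(1) by auto
    ultimately have "padd (pneg (Point x1 y1)) (pneg (Point x2 y2)) = pneg (pneg (Point x3 y3))"
      using line_add unfolding neg_Point by blast
    then show ?thesis using L(2) h by simp
  qed
qed (auto simp: pneg_def)

text \<open>A Bezout identity between the cubic and its derivative whose value is the
  discriminant.\<close>

lemma nonsingular:
  assumes f: "q dvd x * x * x + A * x + B" and f': "q dvd 3 * x * x + A"
  shows False
proof -
  have "4 * A ^ 3 + 27 * B\<^sup>2 = 4 * A\<^sup>2 * (3 * x * x + A)
    - 3 * (2 * A * x - 3 * B) * (3 * (x * x * x + A * x + B) - x * (3 * x * x + A))"
    by (simp add: algebra_simps power2_eq_square power3_eq_cube)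
  also have "q dvd \<dots>"
    by (rule dvd_diff[OF dvd_mult[OF f'] dvd_mult[OF dvd_diff[OF dvd_mult[OF f] dvd_mult[OF f']]]])
  finally show False using disc by blast
qed

text \<open>If \<open>P + Q = Q\<close>, then \<open>Q\<close> would be a 2-torsion point at which the cubic has a double root.\<close>

lemma add_neq_self:
  assumes P: "Point x1 y1 \<in> E" and Q: "Point x2 y2 \<in> E" and L: "line l k x1 y1 x2 y2 x2 y3"
    and y: "q dvd y2 + y3"
  shows False
proof -
  note h = L[unfolded line_def]
  have g: "q dvd l * x2 + k - y2" "q dvd l * x2 + k - y3" "q dvd x1 + x2 + x2 - l * l"
    "q dvd x1 * x2 + x1 * x2 + x2 * x2 - (A - 2 * l * k)" using h by blast+
  have on: "q dvd y2 * y2 - (x2 * x2 * x2 + A * x2 + B)" using Q unfolding point_iff on_def by blast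
  have "2 * y2 = (l * x2 + k - y3) - (l * x2 + k - y2) + (y2 + y3)" by simp
  also have "q dvd \<dots>" by (rule dvd_add[OF dvd_diff[OF g(2,1)] y])
  finally have y2: "q dvd y2" by (simp only: q_dvd_double)
  have "3 * x2 * x2 + A = 2 * l * (l * x2 + k - y2) + 2 * l * y2 + 2 * x2 * (x1 + x2 + x2 - l * l)
    - (x1 * x2 + x1 * x2 + x2 * x2 - (A - 2 * l * k))" by (simp add: algebra_simps)
  also have "q dvd \<dots>"
    by (rule dvd_diff[OF dvd_add[OF dvd_add[OF dvd_mult[OF g(1)] dvd_mult[OF y2]] dvd_mult[OF g(3)]] g(4)])
  finally have f': "q dvd 3 * x2 * x2 + A" .
  have "x2 * x2 * x2 + A * x2 + B = y2 * y2 - (y2 * y2 - (x2 * x2 * x2 + A * x2 + B))" by simp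
  also have "q dvd \<dots>" by (rule dvd_diff[OF dvd_mult[OF y2] on])
  finally have f: "q dvd x2 * x2 * x2 + A * x2 + B" .
  show False by (rule nonsingular[OF f f'])
qed

text \<open>With \<open>P + Q = - S\<close>, the collinear points reordered give
  \<open>S + Q = - P\<close>, and negation finishes. Reading off that sum requires
  \<open>Q \<noteq> - S\<close>, that is \<open>P + Q \<noteq> Q\<close>, which is
  \<open>add_neq_self\<close>.\<close>

lemma add_cancel:
  assumes "P \<in> E" "Q \<in> E"
  shows "padd (padd P Q) (pneg Q) = P"
proof (cases P)
  case Infinity
  then show ?thesis using add_neg_self assms by simp
next
  case P: (Point x1 y1)
  show ?thesis
  proof (cases Q)
    case Infinity
    then show ?thesis by (simp add: pneg_def)
  next
    case Q: (Point x2 y2)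
    show ?thesis
    proof (cases "Q = pneg P")
      case True
      then show ?thesis using add_neg_self[OF assms(1)] neg_neg[OF assms(1)] by simp
    next
      case False
      then have F: "Point x2 y2 \<noteq> pneg (Point x1 y1)" using P Q by simp
      obtain l k x3 y3 where L: "Point x3 y3 \<in> E" "padd P Q = pneg (Point x3 y3)" "line l k x1 y1 x2 y2 x3 y3"
        using add_line[OF _ _ F] assms unfolding P Q by blast
      have ne: "Point x2 y2 \<noteq> pneg (Point x3 y3)"
      proof
        assume "Point x2 y2 = pneg (Point x3 y3)"
        then have x: "x3 = x2" and "y2 = (- y3) mod q" by (simp_all add: neg_Point)
        then have "q dvd y2 - - y3" using mod_dvd(1)[of "- y3"] by simp
        then have "q dvd y2 + y3" by simp
        then show False using add_neq_self[of x1 y1 x2 y2 l k y3] L(3) assms unfolding P Q x by blast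
      qed
      have "padd (Point x3 y3) (Point x2 y2) = pneg (Point x1 y1)"
      proof (rule line_add[OF L(1)])
        show "Point x2 y2 \<in> E" "Point x1 y1 \<in> E" using assms P Q by auto
        show "Point x2 y2 \<noteq> pneg (Point x3 y3)" by (rule ne)
        show "line l k x3 y3 x2 y2 x1 y1" by (rule line_swap12[OF line_swap23[OF line_swap12[OF L(3)]]])
      qed
      then have "pneg (padd (Point x3 y3) (Point x2 y2)) = P" using neg_neg[OF assms(1)] P by simp
      then show ?thesis using neg_add[OF L(1), of "Point x2 y2"] assms L(2) Q by simp
    qed
  qed
qed

text \<open>Associativity.  The product of the lines through \<open>P1, P2\<close> and through \<open>P1 + P2, P3\<close> is, modulo
  the curve, \<open>(x - x12) (x\<^sup>2 + q1 x + q0 - c y)\<close> with \<open>c = l + m\<close>.  The second factor is the unique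
  such function vanishing at \<open>P1, P2, P3\<close>, so its fourth zero \<open>S\<close> does not depend on the bracketing.\<close>

lemma parabola_through:
  assumes L: "line l k x1 y1 x2 y2 x12 y12" and M: "line m n x12 y12' x3 y3 xS yS" and y12: "q dvd y12 + y12'"
    and N: "line l' k' x2 y2 x3 y3 x23 y23"
    and P3: "\<not> q dvd x2 - x3 \<or> x2 = x3 \<and> y2 = y3 \<and> \<not> q dvd y2"
  shows "q dvd ((l + m) * l - x1 - x2) - ((l + m) * m - x3 - xS)" (is ?a)
    and "q dvd ((l + m) * k + x1 * x2) - ((l + m) * n + x3 * xS)" (is ?b)
    and "q dvd ((l + m) * l - x1 - x2) - ((l + m) * l' - x2 - x3)" (is ?c)
    and "q dvd ((l + m) * k + x1 * x2) - ((l + m) * k' + x2 * x3)" (is ?d)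
proof -
  have l: "q dvd l * x1 + k - y1" "q dvd l * x2 + k - y2" "q dvd l * x12 + k - y12" "q dvd x1 + x2 + x12 - l * l"
    "q dvd x1 * x2 + x1 * x12 + x2 * x12 - (A - 2 * l * k)" "q dvd x1 * x2 * x12 - (k * k - B)"
    using L unfolding line_def by blast+
  have m: "q dvd m * x12 + n - y12'" "q dvd m * x3 + n - y3" "q dvd m * xS + n - yS" "q dvd x12 + x3 + xS - m * m"
    "q dvd x12 * x3 + x12 * xS + x3 * xS - (A - 2 * m * n)"
    using M unfolding line_def by blast+
  have n: "q dvd l' * x2 + k' - y2" "q dvd l' * x3 + k' - y3" "q dvd x2 + x3 + x23 - l' * l'"
    "q dvd x2 * x3 + x2 * x23 + x3 * x23 - (A - 2 * l' * k')"
    using N unfolding line_def by blast+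
  have "(l + m) * x12 + k + n = (l * x12 + k - y12) + (m * x12 + n - y12') + (y12 + y12')" by (simp add: algebra_simps)
  also have "q dvd \<dots>" by (rule dvd_add[OF dvd_add[OF l(3) m(1)] y12])
  finally have F: "q dvd (l + m) * x12 + k + n" .
  have "((l + m) * l - x1 - x2) - ((l + m) * m - x3 - xS) = (x12 + x3 + xS - m * m) - (x1 + x2 + x12 - l * l)"
    by (simp add: algebra_simps)
  also have "q dvd \<dots>" by (rule dvd_diff[OF m(4) l(4)])
  finally show a: ?a .
  have "((l + m) * k + x1 * x2) - ((l + m) * n + x3 * xS) =
    (x1 * x2 + x1 * x12 + x2 * x12 - (A - 2 * l * k)) - (x12 * x3 + x12 * xS + x3 * xS - (A - 2 * m * n))
    - x12 * (x1 + x2 + x12 - l * l) + x12 * (x12 + x3 + xS - m * m) + (m - l) * ((l + m) * x12 + k + n)"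
    by (simp add: algebra_simps)
  also have "q dvd \<dots>"
    by (rule dvd_add[OF dvd_add[OF dvd_diff[OF dvd_diff[OF l(5) m(5)] dvd_mult[OF l(4)]] dvd_mult[OF m(4)]] dvd_mult[OF F]])
  finally show b: ?b .
  define u where "u = ((l + m) * l - x1 - x2) - ((l + m) * l' - x2 - x3)"
  define v where "v = ((l + m) * k + x1 * x2) - ((l + m) * k' + x2 * x3)"
  have "u * x2 + v = (l + m) * (l * x2 + k - y2) - (l + m) * (l' * x2 + k' - y2)"
    unfolding u_def v_def by (simp add: algebra_simps)
  also have "q dvd \<dots>" by (rule dvd_diff[OF dvd_mult[OF l(2)] dvd_mult[OF n(1)]])
  finally have 2: "q dvd u * x2 + v" .
  have "u * x3 + v = x3 * (((l + m) * l - x1 - x2) - ((l + m) * m - x3 - xS))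
    + (((l + m) * k + x1 * x2) - ((l + m) * n + x3 * xS)) + (l + m) * (m * x3 + n - y3) - (l + m) * (l' * x3 + k' - y3)"
    unfolding u_def v_def by (simp add: algebra_simps)
  also have "q dvd \<dots>"
    by (rule dvd_diff[OF dvd_add[OF dvd_add[OF dvd_mult[OF a] b] dvd_mult[OF m(2)]] dvd_mult[OF n(2)]])
  finally have 3: "q dvd u * x3 + v" .
  have u: "q dvd u"
    using P3
  proof
    assume ne: "\<not> q dvd x2 - x3"
    have "u * (x2 - x3) = (u * x2 + v) - (u * x3 + v)" by (simp add: algebra_simps)
    also have "q dvd \<dots>" by (rule dvd_diff[OF 2 3])
    finally show ?thesis using ne by (simp add: q_dvd_mult)
  next
    assume eq: "x2 = x3 \<and> y2 = y3 \<and> \<not> q dvd y2"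
    then have x: "x3 = x2" "y3 = y2" by auto
    have "2 * y2 - (l + m) * (x2 - x12) = (l * x12 + k - y12) + (m * x12 + n - y12') + (y12 + y12')
       - (l * x2 + k - y2) - (m * x2 + n - y2)" by (simp add: algebra_simps)
    also have "q dvd \<dots>"
      by (rule dvd_diff[OF dvd_diff[OF dvd_add[OF dvd_add[OF l(3) m(1)] y12] l(2)] m(2)[unfolded x]])
    finally have 4: "q dvd 2 * y2 - (l + m) * (x2 - x12)" .
    have "2 * (l' - l) * y2 - (x2 - x1) * (x2 - x12) = 2 * x2 * (x1 + x2 + x12 - l * l)
      - (x1 * x2 + x1 * x12 + x2 * x12 - (A - 2 * l * k)) + 2 * l * (l * x2 + k - y2)
      - (2 * x2 * (x2 + x2 + x23 - l' * l')
      - (x2 * x2 + x2 * x23 + x2 * x23 - (A - 2 * l' * k')) + 2 * l' * (l' * x2 + k' - y2))"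
      by (simp add: algebra_simps)
    also have "q dvd \<dots>"
      by (rule dvd_diff[OF dvd_add[OF dvd_diff[OF dvd_mult[OF l(4)] l(5)] dvd_mult[OF l(2)]]
            dvd_add[OF dvd_diff[OF dvd_mult[OF n(3)[unfolded x]] n(4)[unfolded x]] dvd_mult[OF n(1)]]])
    finally have 5: "q dvd 2 * (l' - l) * y2 - (x2 - x1) * (x2 - x12)" .
    have x12: "\<not> q dvd x2 - x12"
    proof
      assume h: "q dvd x2 - x12"
      have "2 * y2 = (2 * y2 - (l + m) * (x2 - x12)) + (l + m) * (x2 - x12)" by simp
      also have "q dvd \<dots>" by (rule dvd_add[OF 4 dvd_mult[OF h]])
      finally show False using eq q_dvd_double by blast
    qed
    have "u * (x2 - x12) = (l' - l) * (2 * y2 - (l + m) * (x2 - x12)) - (2 * (l' - l) * y2 - (x2 - x1) * (x2 - x12))"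
      unfolding u_def x by (simp add: algebra_simps)
    also have "q dvd \<dots>" by (rule dvd_diff[OF dvd_mult[OF 4] 5])
    finally show ?thesis using x12 by (simp add: q_dvd_mult)
  qed
  then show ?c by (simp add: u_def)
  have "v = (u * x2 + v) - u * x2" by simp
  also have "q dvd \<dots>" by (rule dvd_diff[OF 2 dvd_mult2[OF u]])
  finally show ?d by (simp add: v_def)
qed

text \<open>Both bracketings give \<open>c (l - l') = x1 - x3\<close> for their coefficient
  \<open>c\<close>. As \<open>x1\<close> and \<open>x3\<close> differ, \<open>l - l'\<close> is
  invertible, so the two coefficients agree, and then so do \<open>q1\<close> and
  \<open>q0\<close>.\<close>

lemma fourth_point:
  assumes L: "line l k x1 y1 x2 y2 x12 y12" and M: "line m n x12 y12' x3 y3 xS yS" and y12: "q dvd y12 + y12'"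
    and L': "line l' k' x2 y2 x3 y3 x23 y23" and M': "line m' n' x23 y23' x1 y1 xT yT" and y23: "q dvd y23 + y23'"
    and c3: "\<not> q dvd x2 - x3 \<or> x2 = x3 \<and> y2 = y3 \<and> \<not> q dvd y2"
    and c1: "\<not> q dvd x2 - x1 \<or> x2 = x1 \<and> y2 = y1 \<and> \<not> q dvd y2"
    and c13: "\<not> q dvd x1 - x3"
  shows "q dvd xS - xT" "q dvd yS - yT"
proof -
  define c where "c = l + m"
  define c' where "c' = l' + m'"
  define q1 where "q1 = c * l - x1 - x2"
  define q0 where "q0 = c * k + x1 * x2"
  define q1' where "q1' = c' * l' - x3 - x2"
  define q0' where "q0' = c' * k' + x3 * x2"
  have a: "q dvd q1 - (c * m - x3 - xS)" "q dvd q0 - (c * n + x3 * xS)" "q dvd q1 - (c * l' - x2 - x3)"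
    "q dvd q0 - (c * k' + x2 * x3)"
    using parabola_through[OF L M y12 L' c3] by (simp_all add: c_def q1_def q0_def)
  have L'': "line l' k' x3 y3 x2 y2 x23 y23" by (rule line_swap12[OF L'])
  have L2: "line l k x2 y2 x1 y1 x12 y12" by (rule line_swap12[OF L])
  have a': "q dvd q1' - (c' * m' - x1 - xT)" "q dvd q0' - (c' * n' + x1 * xT)" "q dvd q1' - (c' * l - x2 - x1)"
    "q dvd q0' - (c' * k + x2 * x1)"
    using parabola_through[OF L'' M' y23 L2 c1] by (simp_all add: c'_def q1'_def q0'_def)
  have "c * (l - l') - (x1 - x3) = q1 - (c * l' - x2 - x3)" by (simp add: q1_def algebra_simps)
  then have d: "q dvd c * (l - l') - (x1 - x3)" using a(3) by (simp only:)
  have "c' * (l - l') - (x1 - x3) = - (q1' - (c' * l - x2 - x1))" by (simp add: q1'_def algebra_simps)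
  then have d': "q dvd c' * (l - l') - (x1 - x3)" using a'(3) by (simp only: dvd_minus_iff)
  have cl: "\<not> q dvd c * (l - l')"
  proof
    assume h: "q dvd c * (l - l')"
    have "x1 - x3 = c * (l - l') - (c * (l - l') - (x1 - x3))" by simp
    also have "q dvd \<dots>" by (rule dvd_diff[OF h d])
    finally show False using c13 by blast
  qed
  then have c0: "\<not> q dvd c" and ll: "\<not> q dvd l - l'" by (auto simp: q_dvd_mult)
  have "(c - c') * (l - l') = (c * (l - l') - (x1 - x3)) - (c' * (l - l') - (x1 - x3))" by (simp add: algebra_simps)
  also have "q dvd \<dots>" by (rule dvd_diff[OF d d'])
  finally have cc: "q dvd c - c'" using ll by (simp add: q_dvd_mult)
  have "q1 - q1' = (q1 - (c * l' - x2 - x3)) + (c - c') * l'" by (simp add: q1'_def algebra_simps)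
  also have "q dvd \<dots>" by (rule dvd_add[OF a(3) dvd_mult2[OF cc]])
  finally have qq1: "q dvd q1 - q1'" .
  have "q0 - q0' = (q0 - (c * k' + x2 * x3)) + (c - c') * k'" by (simp add: q0'_def algebra_simps)
  also have "q dvd \<dots>" by (rule dvd_add[OF a(4) dvd_mult2[OF cc]])
  finally have qq0: "q dvd q0 - q0'" .
  \<comment> \<open>Behind this is the sum of the four zeros: \<open>x1 + x2 + x3 + xS\<close> is
    \<open>c\<^sup>2 - 2 q1\<close> modulo \<open>q\<close>. The ordinate is then recovered from
    \<open>c y = x\<^sup>2 + q1 x + q0\<close>, where \<open>c\<close> is invertible.\<close>
  have "xS - xT = (q1 - (c * m - x3 - xS)) - (q1' - (c' * m' - x1 - xT)) - 2 * (q1 - q1') + (c + c') * (c - c')"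
    unfolding c_def c'_def q1_def q1'_def by (simp add: algebra_simps)
  also have "q dvd \<dots>"
    by (rule dvd_add[OF dvd_diff[OF dvd_diff[OF a(1) a'(1)] dvd_mult[OF qq1]] dvd_mult[OF cc]])
  finally show xx: "q dvd xS - xT" .
  have yS: "q dvd m * xS + n - yS" and yT: "q dvd m' * xT + n' - yT" using M M' unfolding line_def by blast+
  have "c * yS - (xS * xS + q1 * xS + q0) = - (xS * (q1 - (c * m - x3 - xS))) - (q0 - (c * n + x3 * xS)) - c * (m * xS + n - yS)"
    by (simp add: algebra_simps)
  also have "q dvd \<dots>" by (rule dvd_diff[OF dvd_diff[OF iffD2[OF dvd_minus_iff dvd_mult[OF a(1)]] a(2)] dvd_mult[OF yS]])
  finally have hS: "q dvd c * yS - (xS * xS + q1 * xS + q0)" .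
  have "c' * yT - (xT * xT + q1' * xT + q0') = - (xT * (q1' - (c' * m' - x1 - xT))) - (q0' - (c' * n' + x1 * xT)) - c' * (m' * xT + n' - yT)"
    by (simp add: algebra_simps)
  also have "q dvd \<dots>" by (rule dvd_diff[OF dvd_diff[OF iffD2[OF dvd_minus_iff dvd_mult[OF a'(1)]] a'(2)] dvd_mult[OF yT]])
  finally have hT: "q dvd c' * yT - (xT * xT + q1' * xT + q0')" .
  have "c * (yS - yT) = (c * yS - (xS * xS + q1 * xS + q0)) - (c' * yT - (xT * xT + q1' * xT + q0'))
    + (xS + xT + q1) * (xS - xT) + xT * (q1 - q1') + (q0 - q0') - yT * (c - c')" by (simp add: algebra_simps)
  also have "q dvd \<dots>"
    by (rule dvd_diff[OF dvd_add[OF dvd_add[OF dvd_add[OF dvd_diff[OF hS hT] dvd_mult[OF xx]] dvd_mult[OF qq1]] qq0] dvd_mult[OF cc]])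
  finally show "q dvd yS - yT" using c0 by (simp add: q_dvd_mult)
qed

lemma same_abscissa:
  assumes "Point x y \<in> E" "Point x y' \<in> E"
  shows "y' = y \<or> Point x y' = pneg (Point x y)"
proof -
  have on: "q dvd y * y - (x * x * x + A * x + B)" "q dvd y' * y' - (x * x * x + A * x + B)"
    and b: "0 \<le> y" "y < q" "0 \<le> y'" "y' < q" using assms unfolding point_iff on_def by auto
  have "(y' - y) * (y' - - y) = (y' * y' - (x * x * x + A * x + B)) - (y * y - (x * x * x + A * x + B))"
    by (simp add: algebra_simps)
  also have "q dvd \<dots>" by (rule dvd_diff[OF on(2,1)])
  finally consider "q dvd y' - y" | "q dvd y' - - y" unfolding q_dvd_mult by blast
  then show ?thesis
  proof cases
    case 1 then show ?thesis using residue_unique b by blast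
  next
    case 2
    then have "y' mod q = (- y) mod q" by (simp only: mod_eq_dvd_iff)
    then show ?thesis using b by (simp add: neg_Point)
  qed
qed

lemma double_condition:
  assumes "Point x y \<in> E" "Point x' y' \<in> E" "Point x' y' \<noteq> pneg (Point x y)"
  shows "\<not> q dvd x - x' \<or> x = x' \<and> y = y' \<and> \<not> q dvd y"
proof (cases "x = x'")
  case False
  then show ?thesis using residue_unique[of x x'] assms unfolding point_iff by blast
next
  case True
  then have y: "y' = y" using same_abscissa[of x y y'] assms by auto
  have "\<not> q dvd y"
  proof
    assume "q dvd y"
    then have "y = 0" using residue_unique[of y 0] assms(1) q_pos unfolding point_iff by simp
    then show False using assms(3) True y by (simp add: neg_Point)
  qed
  with True y show ?thesis by blast
qed

lemma add_cancel_left: "P \<in> E \<Longrightarrow> Q \<in> E \<Longrightarrow> padd P (padd (pneg P) Q) = Q"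
proof -
  assume P: "P \<in> E" and Q: "Q \<in> E"
  have "padd (padd Q (pneg P)) (pneg (pneg P)) = Q" by (rule add_cancel[OF Q neg_in[OF P]])
  then have "padd (padd (pneg P) Q) P = Q" using neg_neg[OF P] add_comm[OF Q neg_in[OF P]] by simp
  then show ?thesis using add_comm[OF P add_closed[OF neg_in[OF P] Q]] by simp
qed

lemma add_assoc_generic:
  assumes P1: "Point x1 y1 \<in> E" and P2: "Point x2 y2 \<in> E" and P3: "Point x3 y3 \<in> E"
    and n12: "Point x2 y2 \<noteq> pneg (Point x1 y1)" and n23: "Point x3 y3 \<noteq> pneg (Point x2 y2)"
    and n123: "Point x3 y3 \<noteq> pneg (padd (Point x1 y1) (Point x2 y2))"
    and n231: "Point x1 y1 \<noteq> pneg (padd (Point x2 y2) (Point x3 y3))"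
    and n13: "\<not> q dvd x1 - x3"
  shows "padd (padd (Point x1 y1) (Point x2 y2)) (Point x3 y3) = padd (Point x1 y1) (padd (Point x2 y2) (Point x3 y3))"
proof -
  have opp: "q dvd y + (- y) mod q" for y
  proof -
    have "y + (- y) mod q = (- y) mod q - (- y)" by simp
    then show ?thesis using mod_dvd(1)[of "- y"] by (simp only:)
  qed
  obtain l k x12 y12 where L: "Point x12 y12 \<in> E" "padd (Point x1 y1) (Point x2 y2) = pneg (Point x12 y12)"
    "line l k x1 y1 x2 y2 x12 y12" using add_line[OF P1 P2 n12] by blast
  obtain l' k' x23 y23 where L': "Point x23 y23 \<in> E" "padd (Point x2 y2) (Point x3 y3) = pneg (Point x23 y23)"
    "line l' k' x2 y2 x3 y3 x23 y23" using add_line[OF P2 P3 n23] by blast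
  have P12: "Point x12 ((- y12) mod q) \<in> E" using neg_in[OF L(1)] by (simp add: neg_Point)
  have P23: "Point x23 ((- y23) mod q) \<in> E" using neg_in[OF L'(1)] by (simp add: neg_Point)
  obtain m n xS yS where M: "Point xS yS \<in> E" "padd (Point x12 ((- y12) mod q)) (Point x3 y3) = pneg (Point xS yS)"
    "line m n x12 ((- y12) mod q) x3 y3 xS yS" using add_line[OF P12 P3] n123 L(2) by (auto simp: neg_Point)
  obtain m' n' xT yT where M': "Point xT yT \<in> E" "padd (Point x23 ((- y23) mod q)) (Point x1 y1) = pneg (Point xT yT)"
    "line m' n' x23 ((- y23) mod q) x1 y1 xT yT" using add_line[OF P23 P1] n231 L'(2) by (auto simp: neg_Point)
  have c3: "\<not> q dvd x2 - x3 \<or> x2 = x3 \<and> y2 = y3 \<and> \<not> q dvd y2" by (rule double_condition[OF P2 P3 n23])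
  have n21: "Point x1 y1 \<noteq> pneg (Point x2 y2)" using n12 neg_neg[OF P2] by auto
  have c1: "\<not> q dvd x2 - x1 \<or> x2 = x1 \<and> y2 = y1 \<and> \<not> q dvd y2" by (rule double_condition[OF P2 P1 n21])
  have "xS = xT" "yS = yT"
    using fourth_point[OF L(3) M(3) opp L'(3) M'(3) opp c3 c1 n13] residue_unique M(1) M'(1) unfolding point_iff by blast+
  then have "padd (Point x12 ((- y12) mod q)) (Point x3 y3) = padd (Point x1 y1) (Point x23 ((- y23) mod q))"
    using M(2) M'(2) add_comm[OF P23 P1] by simp
  then show ?thesis using L(2) L'(2) by (simp add: neg_Point)
qed

text \<open>The degenerate configurations follow from cancellation and commutativity. Treating
  \<open>S = P\<close> and \<open>S = - P\<close> among them leaves points \<open>P\<close> and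
  \<open>S\<close> with distinct abscissae, as \<open>fourth_point\<close> demands.\<close>

lemma add_assoc:
  assumes P: "P \<in> E" and Q: "Q \<in> E" and S: "S \<in> E"
  shows "padd (padd P Q) S = padd P (padd Q S)"
proof -
  note nP = neg_in[OF P] and nQ = neg_in[OF Q] and nS = neg_in[OF S]
  have PQ: "padd P Q \<in> E" and QS: "padd Q S \<in> E" by (intro add_closed P Q S)+
  consider "P = Infinity \<or> Q = Infinity \<or> S = Infinity" | "Q = pneg P" | "S = pneg Q" | "S = pneg (padd P Q)"
    | "P = pneg (padd Q S)" | "S = P" | "S = pneg P"
    | x1 y1 x2 y2 x3 y3 where "P = Point x1 y1" "Q = Point x2 y2" "S = Point x3 y3" "Q \<noteq> pneg P" "S \<noteq> pneg Q"
      "S \<noteq> pneg (padd P Q)" "P \<noteq> pneg (padd Q S)" "S \<noteq> P" "S \<noteq> pneg P"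
    by (metis point.exhaust)
  then show ?thesis
  proof cases
    case 1 then show ?thesis by auto
  next
    case 2 then show ?thesis using add_neg_self[OF P] add_cancel_left[OF P S] by simp
  next
    case 3 then show ?thesis using add_neg_self[OF Q] add_cancel[OF P Q] by simp
  next
    case 4
    then have "S = padd (pneg Q) (pneg P)" using neg_add[OF P Q] add_comm[OF nP nQ] by simp
    then have "padd Q S = pneg P" using add_cancel_left[OF Q nP] by simp
    then show ?thesis using 4 add_neg_self[OF PQ] add_neg_self[OF P] by simp
  next
    case 5
    then have "P = padd (pneg S) (pneg Q)" using neg_add[OF Q S] add_comm[OF nQ nS] by simp
    then have "padd P Q = pneg S" using add_cancel[OF nS nQ] neg_neg[OF Q] by simp
    moreover have "padd (pneg S) S = Infinity" using add_neg_self[OF S] add_comm[OF S nS] by simp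
    moreover have "padd P (padd Q S) = Infinity"
      using 5 add_neg_self[OF QS] add_comm[OF QS P] by simp
    ultimately show ?thesis by simp
  next
    case 6 then show ?thesis using add_comm[OF PQ P] add_comm[OF P Q] by simp
  next
    case 7
    have "padd (padd P Q) (pneg P) = Q" using add_cancel[OF Q P] add_comm[OF P Q] by simp
    moreover have "padd P (padd Q (pneg P)) = Q" using add_cancel_left[OF P Q] add_comm[OF Q nP] by simp
    ultimately show ?thesis using 7 by simp
  next
    case 8
    have "x1 \<noteq> x3"
    proof
      assume "x1 = x3"
      then show False using same_abscissa[of x1 y1 y3] P S 8 by auto
    qed
    then have "\<not> q dvd x1 - x3" using residue_unique[of x1 x3] P S 8(1,3) unfolding point_iff by (auto simp: point_iff)
    then show ?thesis using add_assoc_generic[of x1 y1 x2 y2 x3 y3] P Q S 8 by simp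
  qed
qed

abbreviation "G \<equiv> ell_group R (A mod q) (B mod q)"

lemma G_simps: "carrier G = E" "x \<otimes>\<^bsub>G\<^esub> y = padd x y" "\<one>\<^bsub>G\<^esub> = Infinity"
  by (simp_all add: ell_group_def)

lemma comm_group_G: "comm_group G"
proof (rule comm_groupI; unfold G_simps)
  fix x assume "x \<in> E"
  then show "\<exists>y\<in>E. padd y x = Infinity"
    using neg_in add_neg_self add_comm by metis
qed (auto intro: add_closed add_comm add_assoc)

end

text \<open>If \<open>Q\<close> has odd order, multiplying by an involution gives twice the order of \<open>Q\<close>.\<close>

lemma square_not_maximal_order:
  assumes "comm_group G" "finite (carrier G)" and Q: "Q \<in> carrier G" and T: "T \<in> carrier G"
    "T \<noteq> \<one>\<^bsub>G\<^esub>" "T \<otimes>\<^bsub>G\<^esub> T = \<one>\<^bsub>G\<^esub>"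
  shows "\<exists>X\<in>carrier G. group.ord G (Q \<otimes>\<^bsub>G\<^esub> Q) < group.ord G X"
proof -
  interpret G: comm_group G by fact
  have ordQ: "G.ord Q \<ge> 1" using G.ord_ge_1[OF assms(2) Q] .
  have sq: "Q \<otimes>\<^bsub>G\<^esub> Q = Q [^]\<^bsub>G\<^esub> (2::nat)" using Q by (simp add: numeral_2_eq_2)
  show ?thesis
  proof (cases "even (G.ord Q)")
    case True
    then have "G.ord (Q \<otimes>\<^bsub>G\<^esub> Q) = G.ord Q div 2" unfolding sq using G.ord_pow[OF Q, of 2] by simp
    then have "G.ord (Q \<otimes>\<^bsub>G\<^esub> Q) < G.ord Q" using ordQ by simp
    then show ?thesis using Q by blast
  next
    case False
    define X where "X = Q \<otimes>\<^bsub>G\<^esub> T"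
    have X: "X \<in> carrier G" unfolding X_def using Q T by simp
    define m where "m = G.ord X"
    have pd: "X [^]\<^bsub>G\<^esub> k = Q [^]\<^bsub>G\<^esub> k \<otimes>\<^bsub>G\<^esub> T [^]\<^bsub>G\<^esub> k" for k :: nat
      unfolding X_def using Q T(1) by (rule G.nat_pow_distrib)
    have m1: "m \<ge> 1" unfolding m_def using G.ord_ge_1[OF assms(2) X] .
    have T2: "T [^]\<^bsub>G\<^esub> (2::nat) = \<one>\<^bsub>G\<^esub>" using T by (simp add: numeral_2_eq_2)
    have Xm: "Q [^]\<^bsub>G\<^esub> m \<otimes>\<^bsub>G\<^esub> T [^]\<^bsub>G\<^esub> m = \<one>\<^bsub>G\<^esub>"
      using G.pow_ord_eq_1[OF X] pd[of m] by (simp add: m_def)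
    have "X [^]\<^bsub>G\<^esub> (m * 2) = \<one>\<^bsub>G\<^esub>" unfolding m_def using X by (simp add: G.pow_eq_id)
    then have "Q [^]\<^bsub>G\<^esub> (m * 2) \<otimes>\<^bsub>G\<^esub> T [^]\<^bsub>G\<^esub> (m * 2) = \<one>\<^bsub>G\<^esub>"
      using pd[of "m * 2"] by simp
    moreover have "T [^]\<^bsub>G\<^esub> (m * 2) = \<one>\<^bsub>G\<^esub>"
      using T(1) T2 by (metis G.nat_pow_pow G.nat_pow_one mult.commute)
    ultimately have "Q [^]\<^bsub>G\<^esub> (m * 2) = \<one>\<^bsub>G\<^esub>" using Q by simp
    then have "G.ord Q dvd m * 2" using G.pow_eq_id[OF Q] by blast
    then have d: "G.ord Q dvd m" using False by (metis coprime_dvd_mult_left_iff coprime_right_2_iff_odd)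
    then have "Q [^]\<^bsub>G\<^esub> m = \<one>\<^bsub>G\<^esub>" using G.pow_eq_id[OF Q] by blast
    then have "T [^]\<^bsub>G\<^esub> m = \<one>\<^bsub>G\<^esub>" using Xm T(1) by simp
    then have "G.ord T dvd m" using G.pow_eq_id[OF T(1)] by blast
    moreover have "G.ord T dvd 2" using G.pow_eq_id[OF T(1)] T2 by blast
    then have "G.ord T = 2" using G.ord_eq_1[OF T(1)] T(2) two_is_prime_nat prime_nat_iff by metis
    ultimately have "even m" by simp
    then have "m \<noteq> G.ord Q" using False by auto
    then have "G.ord Q < m" using dvd_imp_le[OF d] m1 by linarith
    moreover have "G.ord (Q \<otimes>\<^bsub>G\<^esub> Q) dvd G.ord Q"
    proof -
      have "(Q \<otimes>\<^bsub>G\<^esub> Q) [^]\<^bsub>G\<^esub> G.ord Q = \<one>\<^bsub>G\<^esub>"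
        using Q by (simp add: G.nat_pow_distrib)
      then show ?thesis using G.pow_eq_id[of "Q \<otimes>\<^bsub>G\<^esub> Q"] Q by simp
    qed
    then have "G.ord (Q \<otimes>\<^bsub>G\<^esub> Q) \<le> G.ord Q" using ordQ by (intro dvd_imp_le) auto
    ultimately have "G.ord (Q \<otimes>\<^bsub>G\<^esub> Q) < G.ord X" unfolding m_def by linarith
    then show ?thesis using X by blast
  qed
qed

section \<open>Curves with rational 2-torsion modulo p\<close>

locale split_elliptic_mod = elliptic_mod p R A B for p :: nat and R (structure) and A B :: int +
  fixes e1 e2 e3 :: int
  assumes sum_e: "q dvd e1 + e2 + e3" and pair_e: "q dvd e1 * e2 + e1 * e3 + e2 * e3 - A"
    and prod_e: "q dvd e1 * e2 * e3 + B"
begin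

lemma cubic_split: "q dvd (x * x * x + A * x + B) - (x - e1) * (x - e2) * (x - e3)"
proof -
  have "(x * x * x + A * x + B) - (x - e1) * (x - e2) * (x - e3) =
    x * x * (e1 + e2 + e3) - x * (e1 * e2 + e1 * e3 + e2 * e3 - A) + (e1 * e2 * e3 + B)" by (simp add: algebra_simps)
  also have "q dvd \<dots>" by (rule dvd_add[OF dvd_diff[OF dvd_mult[OF sum_e] dvd_mult[OF pair_e]] prod_e])
  finally show ?thesis .
qed

lemma cubic_deriv_split: "q dvd (3 * x * x + A) - ((x - e1) * (x - e2) + (x - e1) * (x - e3) + (x - e2) * (x - e3))"
proof -
  have "(3 * x * x + A) - ((x - e1) * (x - e2) + (x - e1) * (x - e3) + (x - e2) * (x - e3)) =
    2 * x * (e1 + e2 + e3) - (e1 * e2 + e1 * e3 + e2 * e3 - A)" by (simp add: algebra_simps)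
  also have "q dvd \<dots>" by (rule dvd_diff[OF dvd_mult[OF sum_e] pair_e])
  finally show ?thesis .
qed

lemma distinct_e: "\<not> q dvd e1 - e2" "\<not> q dvd e1 - e3" "\<not> q dvd e2 - e3"
proof -
  have *: False if f: "q dvd (x - e1) * (x - e2) * (x - e3)"
    and f': "q dvd (x - e1) * (x - e2) + (x - e1) * (x - e3) + (x - e2) * (x - e3)" for x
  proof (rule nonsingular)
    show "q dvd x * x * x + A * x + B" using dvd_add[OF cubic_split[of x] f] by simp
    show "q dvd 3 * x * x + A" using dvd_add[OF cubic_deriv_split[of x] f'] by simp
  qed
  show "\<not> q dvd e1 - e2" using *[of e1] by auto
  show "\<not> q dvd e1 - e3" using *[of e1] by auto
  show "\<not> q dvd e2 - e3" using *[of e2] by auto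
qed

definition torsion_point :: "int point" where "torsion_point = Point (e1 mod q) 0"

lemma torsion_point: "torsion_point \<in> E" "torsion_point \<noteq> Infinity" "padd torsion_point torsion_point = Infinity"
proof -
  have "q dvd e1 * e1 * e1 + A * e1 + B" using cubic_split[of e1] by simp
  then have "on e1 0" unfolding on_def mult_zero_left diff_0 dvd_minus_iff .
  then have "on (e1 mod q) 0" by (rule on_mod) (simp_all only: mod_dvd diff_self dvd_0_right)
  then show t: "torsion_point \<in> E" unfolding torsion_point_def point_iff using q_pos by simp
  show "torsion_point \<noteq> Infinity" by (simp add: torsion_point_def)
  have "pneg torsion_point = torsion_point" by (simp add: torsion_point_def neg_Point)
  then show "padd torsion_point torsion_point = Infinity" using add_neg_self[OF t] by simp
qed

text \<open>With \<open>s\<^sub>i\<^sup>2 = x - e\<^sub>i\<close> and \<open>y = s1 s2 s3\<close>, the point \<open>(x, y)\<close> is the double of the point with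
  abscissa \<open>x + s1 s2 + s1 s3 + s2 s3\<close>, where the tangent has slope \<open>s1 + s2 + s3\<close>.\<close>

lemma halving:
  assumes P: "Point x y \<in> E" and y0: "\<not> q dvd y"
    and s1: "q dvd x - e1 - s1 * s1" and s2: "q dvd x - e2 - s2 * s2"
  shows "\<exists>Q\<in>E. padd Q Q = Point x y"
proof -
  have onP: "q dvd y * y - (x * x * x + A * x + B)" using P unfolding point_iff on_def by blast
  have yy: "q dvd y * y - (x - e1) * (x - e2) * (x - e3)" using dvd_add[OF onP cubic_split[of x]] by simp
  \<comment> \<open>\<open>y\<^sup>2\<close> is \<open>s1\<^sup>2 s2\<^sup>2 (x - e3)\<close> modulo
    \<open>q\<close>, and \<open>y\<close> is nonzero there.\<close>
  have n12: "\<not> q dvd s1 * s2"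
  proof
    assume h: "q dvd s1 * s2"
    have "y * y = (y * y - (x - e1) * (x - e2) * (x - e3)) + (x - e2) * (x - e3) * (x - e1 - s1 * s1)
       + s1 * s1 * (x - e3) * (x - e2 - s2 * s2) + s1 * s2 * (x - e3) * (s1 * s2)" by (simp add: algebra_simps)
    also have "q dvd \<dots>" by (rule dvd_add[OF dvd_add[OF dvd_add[OF yy dvd_mult[OF s1]] dvd_mult[OF s2]] dvd_mult[OF h]])
    finally show False using y0 by (simp add: q_dvd_mult)
  qed
  then have "coprime (s1 * s2) q" using q_prime by (metis coprime_commute prime_imp_coprime)
  then obtain z w where "z * (s1 * s2) + w * q = 1" by (metis bezout_int coprime_imp_gcd_eq_1)
  then have z: "q dvd s1 * s2 * z - 1" by (metis add_diff_cancel_left' diff_add_cancel dvd_minus_iff dvd_triv_right minus_diff_eq mult.commute)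
  \<comment> \<open>This is \<open>y / (s1 s2)\<close>: the third difference \<open>x - e3\<close>
    is automatically a square, and the sign is fixed by \<open>y = s1 s2 s3\<close>.\<close>
  define s3 where "s3 = y * z"
  have "s1 * s2 * s3 - y = y * (s1 * s2 * z - 1)" unfolding s3_def by (simp add: algebra_simps)
  also have "q dvd \<dots>" by (rule dvd_mult[OF z])
  finally have sy: "q dvd s1 * s2 * s3 - y" .
  have "(s1 * s2) * ((s1 * s2) * (x - e3 - s3 * s3)) =
    - (s1 * s2 * s3 + y) * (s1 * s2 * s3 - y) - (y * y - (x - e1) * (x - e2) * (x - e3))
    - (x - e2) * (x - e3) * (x - e1 - s1 * s1) - s1 * s1 * (x - e3) * (x - e2 - s2 * s2)" by (simp add: algebra_simps)
  also have "q dvd \<dots>" by (rule dvd_diff[OF dvd_diff[OF dvd_diff[OF dvd_mult[OF sy] yy] dvd_mult[OF s1]] dvd_mult[OF s2]])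
  finally have s3: "q dvd x - e3 - s3 * s3" using n12 q_dvd_mult by blast
  define X where "X = x + s1 * s2 + s1 * s3 + s2 * s3"
  define a where "a = s1 + s2"
  define b where "b = s1 + s3"
  define c where "c = s2 + s3"
  define Y where "Y = a * b * c"
  define l where "l = s1 + s2 + s3"
  \<comment> \<open>For instance, replacing \<open>x - e1\<close> by \<open>s1\<^sup>2\<close> turns
    \<open>X - e1\<close> into \<open>(s1 + s2) (s1 + s3)\<close>. The product of the three
    differences is therefore the square of \<open>Y\<close>.\<close>
  have d: "q dvd X - e1 - a * b" "q dvd X - e2 - a * c" "q dvd X - e3 - b * c"
    using s1 s2 s3 unfolding X_def a_def b_def c_def by (simp_all add: algebra_simps)
  have "Y * Y - (X * X * X + A * X + B) = - (((X * X * X + A * X + B) - (X - e1) * (X - e2) * (X - e3))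
    + (X - e2) * (X - e3) * (X - e1 - a * b) + a * b * (X - e3) * (X - e2 - a * c) + a * b * (a * c) * (X - e3 - b * c))"
    unfolding Y_def by (simp add: algebra_simps)
  also have "q dvd \<dots>" by (rule iffD2[OF dvd_minus_iff
    dvd_add[OF dvd_add[OF dvd_add[OF cubic_split dvd_mult[OF d(1)]] dvd_mult[OF d(2)]] dvd_mult[OF d(3)]]])
  finally have onQ: "on X Y" unfolding on_def .
  have "2 * Y * l - (3 * X * X + A) = - (((3 * X * X + A) - ((X - e1) * (X - e2) + (X - e1) * (X - e3) + (X - e2) * (X - e3)))
    + ((X - e2) + (X - e3)) * (X - e1 - a * b) + ((X - e3) + a * b) * (X - e2 - a * c) + (a * b + a * c) * (X - e3 - b * c))"
  proof -
    have "2 * l = a + b + c" unfolding l_def a_def b_def c_def by simp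
    then have "2 * Y * l = Y * (a + b + c)" by (metis mult.assoc mult.commute)
    then show ?thesis unfolding Y_def by (simp add: algebra_simps)
  qed
  also have "q dvd \<dots>" by (rule iffD2[OF dvd_minus_iff
    dvd_add[OF dvd_add[OF dvd_add[OF cubic_deriv_split dvd_mult[OF d(1)]] dvd_mult[OF d(2)]] dvd_mult[OF d(3)]]])
  finally have tan: "q dvd 2 * Y * l - (3 * X * X + A)" .
  \<comment> \<open>A vanishing factor such as \<open>s1 + s2\<close> would give
    \<open>s1\<^sup>2 = s2\<^sup>2\<close> and so \<open>e1 = e2\<close> modulo
    \<open>q\<close>.\<close>
  have ny: "\<not> q dvd Y"
  proof
    assume "q dvd Y"
    then consider "q dvd a" | "q dvd b" | "q dvd c" unfolding Y_def q_dvd_mult by blast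
    then show False
    proof cases
      case 1
      have "e1 - e2 = (x - e2 - s2 * s2) - (x - e1 - s1 * s1) - (s1 - s2) * a" by (simp add: a_def algebra_simps)
      also have "q dvd \<dots>" by (rule dvd_diff[OF dvd_diff[OF s2 s1] dvd_mult[OF 1]])
      finally show False using distinct_e by blast
    next
      case 2
      have "e1 - e3 = (x - e3 - s3 * s3) - (x - e1 - s1 * s1) - (s1 - s3) * b" by (simp add: b_def algebra_simps)
      also have "q dvd \<dots>" by (rule dvd_diff[OF dvd_diff[OF s3 s1] dvd_mult[OF 2]])
      finally show False using distinct_e by blast
    next
      case 3
      have "e2 - e3 = (x - e3 - s3 * s3) - (x - e2 - s2 * s2) - (s2 - s3) * c" by (simp add: c_def algebra_simps)
      also have "q dvd \<dots>" by (rule dvd_diff[OF dvd_diff[OF s3 s2] dvd_mult[OF 3]])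
      finally show False using distinct_e by blast
    qed
  qed
  define X' where "X' = X mod q"
  define Y' where "Y' = Y mod q"
  have m: "q dvd X' - X" "q dvd Y' - Y" unfolding X'_def Y'_def by (rule mod_dvd)+
  have onQ': "on X' Y'" by (rule on_mod[OF onQ m])
  have Q: "Point X' Y' \<in> E" unfolding point_iff using onQ' q_pos by (simp add: X'_def Y'_def)
  have "2 * Y' * l - (3 * X' * X' + A) = (2 * Y * l - (3 * X * X + A)) + 2 * l * (Y' - Y) - 3 * (X' + X) * (X' - X)"
    by (simp add: algebra_simps)
  also have "q dvd \<dots>" by (rule dvd_diff[OF dvd_add[OF tan dvd_mult[OF m(2)]] dvd_mult[OF m(1)]])
  finally have tan': "q dvd 2 * Y' * l - (3 * X' * X' + A)" .
  define k where "k = Y' - l * X'"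
  have "line l k X' Y' X' Y' (l * l - X' - X') (l * (l * l - X' - X') + k)"
    unfolding k_def by (rule line_chord(1)[OF onQ' onQ']) (use tan' in blast)
  moreover have "x - (l * l - X' - X') = (x - e1 - s1 * s1) + (x - e2 - s2 * s2) + (x - e3 - s3 * s3) + (e1 + e2 + e3) + 2 * (X' - X)"
    unfolding l_def X_def by (simp add: algebra_simps)
  then have xx: "q dvd x - (l * l - X' - X')"
    using dvd_add[OF dvd_add[OF dvd_add[OF dvd_add[OF s1 s2] s3] sum_e] dvd_mult[OF m(1)]] by (simp only:)
  moreover have "(- y) mod q - (l * (l * l - X' - X') + k) = ((- y) mod q - (- y)) + (s1 * s2 * s3 - y)
      + l * (x - (l * l - X' - X')) + l * (X' - X) - (Y' - Y)"
    unfolding k_def Y_def X_def a_def b_def c_def l_def by (simp add: algebra_simps)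
  then have "q dvd (- y) mod q - (l * (l * l - X' - X') + k)"
    using dvd_diff[OF dvd_add[OF dvd_add[OF dvd_add[OF mod_dvd(1) sy] dvd_mult[OF xx]] dvd_mult[OF m(1)]] m(2)] by (simp only:)
  ultimately have L: "line l k X' Y' X' Y' x ((- y) mod q)" by (rule line_cong)
  have "Point X' Y' \<noteq> pneg (Point X' Y')"
  proof
    assume "Point X' Y' = pneg (Point X' Y')"
    then have "Y' = (- Y') mod q" by (simp add: neg_Point)
    then have "q dvd Y' - - Y'" using mod_dvd(1)[of "- Y'"] by simp
    then have "q dvd Y'" using q_dvd_double[of Y'] by simp
    then have "q dvd Y" unfolding Y'_def by (simp add: dvd_mod_iff)
    then show False using ny by blast
  qed
  then have "padd (Point X' Y') (Point X' Y') = pneg (Point x ((- y) mod q))"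
    using neg_in[OF P] by (intro line_add[OF Q Q _ _ L]) (auto simp: neg_Point)
  also have "\<dots> = Point x y" using neg_neg[OF P] by (simp add: neg_Point)
  finally show ?thesis using Q by blast
qed

lemma least_maximal_x_gt:
  assumes sq: "\<And>n. n \<le> N \<Longrightarrow> \<not> q dvd int n ^ 3 + A * int n + B \<Longrightarrow>
      (\<exists>s. q dvd int n - e1 - s * s) \<and> (\<exists>s. q dvd int n - e2 - s * s)"
    and n0: "n0 \<le> N" "\<not> q dvd int n0 ^ 3 + A * int n0 + B" "q dvd int n0 - e3 - s3 * s3"
    and R: "R = residue_ring (int p)"
  shows "least_maximal_x A B p > N"
proof -
  have G: "ell_Fp A B p = G" by (simp add: ell_Fp_def R)
  interpret G: comm_group G by (rule comm_group_G)
  have fin: "finite (carrier G)" using finite_E by (simp add: G_simps)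
  have max: "\<not> maximal_order_point G P" if "X \<in> E" "G.ord P < G.ord X" for P X
  proof
    assume "maximal_order_point G P"
    then have "G.ord P = Max (G.ord ` carrier G)" by (simp add: maximal_order_point_def)
    moreover have "G.ord X \<le> Max (G.ord ` carrier G)" using fin that(1) by (intro Max_ge) (auto simp: G_simps)
    ultimately show False using that(2) by simp
  qed
  \<comment> \<open>A point that is not 2-torsion, with abscissa \<open>n0\<close>; it keeps
    2-torsion points of small abscissa from having maximal order.\<close>
  obtain P0 where P0: "P0 \<in> E" "padd P0 P0 \<noteq> Infinity"
  proof -
    obtain s1 s2 where s: "q dvd int n0 - e1 - s1 * s1" "q dvd int n0 - e2 - s2 * s2" using sq[OF n0(1,2)] by blast
    define x where "x = int n0"
    note s' = s[folded x_def] n0(3)[folded x_def]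
    define y where "y = s1 * s2 * s3"
    have "y * y - (x * x * x + A * x + B) = - (((x * x * x + A * x + B) - (x - e1) * (x - e2) * (x - e3))
      + (x - e2) * (x - e3) * (x - e1 - s1 * s1) + s1 * s1 * (x - e3) * (x - e2 - s2 * s2) + s1 * s1 * (s2 * s2) * (x - e3 - s3 * s3))"
      unfolding y_def by (simp add: algebra_simps)
    also have "q dvd \<dots>" by (rule iffD2[OF dvd_minus_iff
      dvd_add[OF dvd_add[OF dvd_add[OF cubic_split dvd_mult[OF s'(1)]] dvd_mult[OF s'(2)]] dvd_mult[OF s'(3)]]])
    finally have on: "on x y" unfolding on_def .
    have y0: "\<not> q dvd y"
    proof
      assume h: "q dvd y"
      have "x * x * x + A * x + B = y * y - (y * y - (x * x * x + A * x + B))" by simp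
      also have "q dvd \<dots>" by (rule dvd_diff[OF dvd_mult[OF h] on[unfolded on_def]])
      finally show False using n0(2) by (simp add: x_def power3_eq_cube)
    qed
    define P where "P = Point (x mod q) (y mod q)"
    have P: "P \<in> E" unfolding P_def point_iff using on_mod[OF on mod_dvd(1) mod_dvd(1)] q_pos by simp
    have "padd P P \<noteq> Infinity"
    proof
      assume "padd P P = Infinity"
      then have "pneg P = P" using add_cancel[OF P P] by simp
      then have "(- (y mod q)) mod q = y mod q" by (simp add: P_def neg_Point)
      then have "q dvd - (y mod q) - y" by (simp only: mod_eq_dvd_iff)
      then have "q dvd (y mod q - y) + (- (y mod q) - y)" using mod_dvd(1) by (rule dvd_add[rotated])
      then have "q dvd - (2 * y)" by simp
      then show False using y0 q_dvd_double by (simp only: dvd_minus_iff)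
    qed
    then show ?thesis using that P by blast
  qed
  have ord0: "G.ord P0 > 2"
  proof -
    have "P0 [^]\<^bsub>G\<^esub> (2::nat) \<noteq> \<one>\<^bsub>G\<^esub>" using P0 by (simp add: numeral_2_eq_2 G_simps)
    then have "\<not> G.ord P0 dvd 2" using G.pow_eq_id[of P0 2] P0(1) by (simp add: G_simps)
    moreover have "G.ord P0 \<ge> 1" using G.ord_ge_1[OF fin] P0(1) by (simp add: G_simps)
    moreover have "G.ord P0 \<noteq> 1" "G.ord P0 \<noteq> 2" using calculation(1) by auto
    ultimately show ?thesis by linarith
  qed
  have small: "\<not> maximal_order_point G (Point x y)" if n: "n \<le> N" and x: "[x = int n] (mod q)" for n x y
  proof (cases "Point x y \<in> E")
    case False
    then show ?thesis by (simp add: maximal_order_point_def G_simps)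
  next
    case P: True
    have onP: "q dvd y * y - (x * x * x + A * x + B)" using P unfolding point_iff on_def by blast
    have xn: "q dvd x - int n" using x by (simp add: cong_iff_dvd_diff)
    show ?thesis
    proof (cases "q dvd y")
      case True
      then have "y = 0" using residue_unique[of y 0] P q_pos unfolding point_iff by simp
      then have "padd (Point x y) (Point x y) = Infinity" using add_neg_self[OF P] by (simp add: neg_Point)
      then have "Point x y [^]\<^bsub>G\<^esub> (2::nat) = \<one>\<^bsub>G\<^esub>" using P by (simp add: numeral_2_eq_2 G_simps)
      then have "G.ord (Point x y) dvd 2" using G.pow_eq_id[of "Point x y" 2] P by (simp add: G_simps)
      then have "G.ord (Point x y) < G.ord P0" using dvd_imp_le[of "G.ord (Point x y)" 2] ord0 by simp
      then show ?thesis by (rule max[OF P0(1)])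
    next
      case False
      have "\<not> q dvd int n ^ 3 + A * int n + B"
      proof
        assume h: "q dvd int n ^ 3 + A * int n + B"
        have "y * y = (y * y - (x * x * x + A * x + B)) + (int n ^ 3 + A * int n + B)
          + (x * x + x * int n + int n * int n + A) * (x - int n)" by (simp add: algebra_simps power3_eq_cube)
        also have "q dvd \<dots>" by (rule dvd_add[OF dvd_add[OF onP h] dvd_mult[OF xn]])
        finally show False using False by (simp add: q_dvd_mult)
      qed
      then obtain s1 s2 where s: "q dvd int n - e1 - s1 * s1" "q dvd int n - e2 - s2 * s2" using sq[OF n] by blast
      have s': "q dvd x - e1 - s1 * s1" "q dvd x - e2 - s2 * s2"
        using dvd_add[OF xn s(1)] dvd_add[OF xn s(2)] by (simp_all add: algebra_simps)
      obtain Q where Q: "Q \<in> E" "padd Q Q = Point x y" using halving[OF P False s'] by blast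
      have "\<exists>X\<in>carrier G. G.ord (Q \<otimes>\<^bsub>G\<^esub> Q) < G.ord X"
        using square_not_maximal_order[OF comm_group_G fin] Q(1) torsion_point by (simp add: G_simps)
      then obtain X where "X \<in> E" "G.ord (Point x y) < G.ord X" unfolding G_simps Q(2) by blast
      then show ?thesis by (rule max)
    qed
  qed
  \<comment> \<open>A point of maximal order exists and is not the neutral element, so the least
    number in the definition is attained.\<close>
  have "Max (G.ord ` carrier G) \<in> G.ord ` carrier G" using fin by (intro Max_in) auto
  then obtain P where P: "P \<in> E" "maximal_order_point G P" by (auto simp: maximal_order_point_def G_simps)
  have "P \<noteq> Infinity"
  proof
    assume "P = Infinity"
    then have "G.ord P < G.ord P0" using ord0 G.ord_id by (simp add: G_simps)
    then show False using max P0(1) P(2) by blast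
  qed
  then obtain x y where xy: "P = Point x y" by (cases P) auto
  have "[x = int (nat x)] (mod q)" using P(1) unfolding xy point_iff by simp
  then have "\<exists>x' y. maximal_order_point (ell_Fp A B p) (Point x' y) \<and> [x' = int (nat x)] (mod int p)"
    using P(2) unfolding xy G by blast
  then have "\<exists>x y. maximal_order_point (ell_Fp A B p) (Point x y) \<and> [x = int (least_maximal_x A B p)] (mod int p)"
    unfolding least_maximal_x_def by (rule LeastI)
  then show ?thesis using small unfolding G by (meson not_le)
qed

end

section \<open>The size of the prime\<close>

lemma exp_ge_partial_sum:
  fixes x :: real
  assumes "x \<ge> 0"
  shows "(\<Sum>n<k. x ^ n / fact n) \<le> exp x"
proof -
  have s: "(\<lambda>n. x ^ n / fact n) sums exp x"
    using exp_converges[of x] by (simp add: divide_inverse mult.commute)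
  have "(\<Sum>n<k. x ^ n / fact n) \<le> (\<Sum>n. x ^ n / fact n)"
    using assms by (intro sum_le_suminf sums_summable[OF s]) auto
  then show ?thesis using sums_unique[OF s] by simp
qed

text \<open>The bound is sharp enough for the final constant:
  \<open>0.72 * 2 * 0.694 = 0.99936\<close>.\<close>

lemma ln_2_less: "ln (2 :: real) < 0.694"
proof -
  have "(2 :: real) < (\<Sum>n<6. 0.694 ^ n / fact n)"
    by (simp add: eval_nat_numeral fact_Suc)
  also have "\<dots> \<le> exp 0.694" by (rule exp_ge_partial_sum) simp
  finally have "ln 2 < ln (exp (0.694 :: real))" by (subst ln_less_cancel_iff) auto
  then show ?thesis by simp
qed

context cubic_roots
begin

lemma Delta_le:
  "\<exists>c > 0. \<forall>N. Delta N \<le> c * (N + c) ^ (4 * (N + 1))"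
proof -
  define c where "c = nat (1 + \<bar>A\<bar> + \<bar>B\<bar>) + nat \<bar>2 * (4 * A ^ 3 + 27 * B\<^sup>2)\<bar>"
  have c1: "c \<ge> 1" by (simp add: c_def)
  have F: "nat \<bar>F (int n)\<bar> \<le> (N + c) ^ 4" if n: "n \<le> N" for n N
  proof -
    have "\<bar>F (int n)\<bar> \<le> int n ^ 3 + \<bar>A\<bar> * int n + \<bar>B\<bar>"
      unfolding F_def by (rule order_trans[OF abs_triangle_ineq] add_mono)+ (auto simp: abs_mult power_abs intro: order_trans[OF abs_triangle_ineq])
    also have "\<dots> \<le> (1 + \<bar>A\<bar> + \<bar>B\<bar>) * (int N + int c) ^ 3"
    proof -
      define M where "M = (int N + int c) ^ 3"
      have M1: "int N + int c \<le> M" unfolding M_def using c1 by (simp add: self_le_power)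
      have "int n ^ 3 \<le> M" unfolding M_def using n by (intro power_mono) auto
      moreover have "\<bar>A\<bar> * int n \<le> \<bar>A\<bar> * M" using M1 n by (intro mult_left_mono) auto
      moreover have "\<bar>B\<bar> * 1 \<le> \<bar>B\<bar> * M" using M1 c1 by (intro mult_left_mono) auto
      ultimately show ?thesis unfolding M_def[symmetric] by (simp add: distrib_right)
    qed
    also have "\<dots> \<le> (int N + int c) * (int N + int c) ^ 3"
      by (intro mult_right_mono) (auto simp: c_def)
    also have "\<dots> = int ((N + c) ^ 4)" by (simp add: power_numeral_reduce)
    finally show ?thesis by linarith
  qed
  have "Delta N \<le> c * (N + c) ^ (4 * (N + 1))" for N
  proof -
    define S where "S = {n. n \<le> N \<and> F (int n) \<noteq> 0}"
    have "(\<Prod>n\<in>S. nat \<bar>F (int n)\<bar>) \<le> (\<Prod>n\<in>S. (N + c) ^ 4)"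
      using F by (intro prod_mono) (auto simp: S_def)
    also have "\<dots> = (N + c) ^ (4 * card S)" by (simp add: power_mult)
    also have "\<dots> \<le> (N + c) ^ (4 * (N + 1))"
    proof (rule power_increasing)
      have "card S \<le> card {..N}" by (rule card_mono) (auto simp: S_def)
      then show "4 * card S \<le> 4 * (N + 1)" by simp
      show "1 \<le> N + c" using c1 by simp
    qed
    finally show ?thesis unfolding Delta_def S_def[symmetric] by (intro mult_le_mono) (auto simp: c_def)
  qed
  then show ?thesis using c1 by (intro exI[of _ c]) auto
qed

text \<open>The exponent of \<open>prime_bound\<close> is \<open>48 * 4 ^ N\<close>. The logarithm
  of its base is bounded quadratically in \<open>N\<close> through the crude
  \<open>ln x \<le> x\<close>, and the cube with large \<open>C\<close> absorbs all
  constants.\<close>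

lemma ln_prime_bound_le:
  assumes disc: "4 * A ^ 3 + 27 * B\<^sup>2 \<noteq> 0"
  shows "\<exists>C \<ge> 1. \<forall>N. ln (real (prime_bound N)) \<le> 48 * 4 ^ N * (real N + C) ^ 3"
proof -
  obtain c where c: "c > 0" "\<And>N. Delta N \<le> c * (N + c) ^ (4 * (N + 1))" using Delta_le by blast
  define c1 where "c1 = base.K3 * (\<kappa>0 + 2)"
  define c2 where "c2 = 2 * \<kappa>0 + 4"
  define b where "b = 13 * box_const"
  have "base.K3 > 0" by (simp add: base.K3_def)
  then have pos: "c1 > 0" "c2 > 0" "b > 0" using box_const_pos by (simp_all add: c1_def c2_def b_def)
  define C where "C = real b + 4 * real c1 + 4 * real c + real c2 + 100"
  have C: "C \<ge> 100" by (simp add: C_def)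
  have "ln (real (prime_bound N)) \<le> 48 * 4 ^ N * (real N + C) ^ 3" for N
  proof -
    have D0: "Delta N > 0" unfolding Delta_def using disc by (simp add: prod_pos)
    define K where "K = c1 * (N + c2) ^ (2 * N + 3)"
    have K: "prime_bound N = (b * (K * Delta N) ^ 4) ^ (6 * 2 ^ (2 * N + 3))"
      unfolding prime_bound_def K_def c1_def c2_def b_def by (simp only: add.assoc)
    have K0: "K > 0" using pos by (simp add: K_def)
    have d: "real (6 * 2 ^ (2 * N + 3)) = 48 * 4 ^ N" by (simp add: power_add power_mult)
    have lnle: "ln (real x) \<le> real x" if "x > 0" for x :: nat using that ln_bound[of "real x"] by simp
    have "ln (real (Delta N)) \<le> ln (real (c * (N + c) ^ (4 * (N + 1))))"
      using D0 of_nat_mono[OF c(2)[of N]] by (subst ln_le_cancel_iff) auto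
    also have "\<dots> = ln (real c) + real (4 * (N + 1)) * ln (real (N + c))"
      using c(1) by (simp add: ln_mult ln_realpow del: of_nat_add)
    also have "\<dots> \<le> real c + real (4 * (N + 1)) * real (N + c)"
      using c(1) by (intro add_mono mult_left_mono lnle) auto
    finally have 1: "ln (real (Delta N)) \<le> real c + real (4 * (N + 1)) * real (N + c)" .
    have "ln (real K) = ln (real c1) + real (2 * N + 3) * ln (real (N + c2))"
      using pos by (simp add: K_def ln_mult ln_realpow del: of_nat_add)
    also have "\<dots> \<le> real c1 + real (2 * N + 3) * real (N + c2)"
      using pos by (intro add_mono mult_left_mono lnle) auto
    finally have 2: "ln (real K) \<le> real c1 + real (2 * N + 3) * real (N + c2)" .
    have "ln (real (b * (K * Delta N) ^ 4)) = ln (real b) + 4 * (ln (real K) + ln (real (Delta N)))"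
      using pos K0 D0 by (simp add: ln_mult ln_realpow)
    also have "\<dots> \<le> real b + 4 * ((real c1 + real (2 * N + 3) * real (N + c2)) + (real c + real (4 * (N + 1)) * real (N + c)))"
      using lnle[OF pos(3)] 1 2 by (intro add_mono mult_left_mono) auto
    also have "\<dots> \<le> (real N + C) ^ 3"
    proof -
      define x where "x = real N + C"
      have x: "x \<ge> 100" "real N + real c2 \<le> x" "real N + real c \<le> x" "real N \<le> x" using C by (auto simp: x_def C_def)
      have "real (2 * N + 3) * real (N + c2) \<le> (2 * x + 3) * x" using x by (intro mult_mono) auto
      moreover have "real (4 * (N + 1)) * real (N + c) \<le> (4 * x + 4) * x" using x by (intro mult_mono) auto
      moreover have "real b + 4 * real c1 + 4 * real c \<le> x" by (simp add: x_def C_def)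
      moreover have "29 * x + 24 * (x * x) \<le> x ^ 3"
      proof -
        have "29 * x \<le> x * x" using x(1) by (intro mult_right_mono) auto
        moreover have "25 * (x * x) \<le> x * (x * x)" using x(1) by (intro mult_right_mono) auto
        ultimately show ?thesis by (simp add: power3_eq_cube mult.assoc)
      qed
      ultimately show ?thesis unfolding x_def[symmetric] by (simp add: algebra_simps)
    qed
    finally have 3: "ln (real (b * (K * Delta N) ^ 4)) \<le> (real N + C) ^ 3" .
    have "ln (real (prime_bound N)) = real (6 * 2 ^ (2 * N + 3)) * ln (real (b * (K * Delta N) ^ 4))"
      unfolding K using pos K0 D0 by (simp add: ln_realpow)
    also have "\<dots> \<le> (48 * 4 ^ N) * (real N + C) ^ 3" unfolding d using 3 by (intro mult_left_mono) auto
    finally show ?thesis .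
  qed
  then show ?thesis using C by (intro exI[of _ C]) auto
qed

text \<open>The linear term has coefficient \<open>0.72 * 1.388 < 1\<close> and the remaining terms
  are logarithmic. For \<open>p \<ge> 3\<close> the inner logarithm exceeds 1, so the bound can be
  passed through the outer one.\<close>

lemma eventually_ln_ln_prime_bound:
  assumes disc: "4 * A ^ 3 + 27 * B\<^sup>2 \<noteq> 0"
  shows "eventually (\<lambda>N. \<forall>p. 3 \<le> p \<and> p \<le> prime_bound N \<longrightarrow> 0.72 * ln (ln (real p)) < real N) sequentially"
proof -
  obtain C where C: "C \<ge> 1" "\<And>N. ln (real (prime_bound N)) \<le> 48 * 4 ^ N * (real N + C) ^ 3"
    using ln_prime_bound_le[OF disc] by blast
  have "eventually (\<lambda>N. 0.72 * (ln 48 + 1.388 * real N + 3 * ln (real N + C)) < real N) sequentially"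
    by real_asymp
  then show ?thesis
  proof eventually_elim
    case (elim N)
    show ?case
    proof (intro allI impI)
      fix p assume p: "3 \<le> p \<and> p \<le> prime_bound N"
      have "1 < ln (3 :: real)" using ln_272_gt_1 by (rule less_le_trans) simp
      also have "\<dots> \<le> ln (real p)" using p by simp
      finally have lp: "1 < ln (real p)" .
      have "ln (real p) \<le> ln (real (prime_bound N))" using p by simp
      also note C(2)
      finally have "ln (ln (real p)) \<le> ln (48 * 4 ^ N * (real N + C) ^ 3)" using lp by (subst ln_le_cancel_iff) auto
      also have "\<dots> = ln 48 + real N * ln 4 + 3 * ln (real N + C)"
        using C(1) by (simp add: ln_mult ln_realpow)
      also have "ln (4 :: real) = 2 * ln 2" using ln_realpow[of 2 2] by simp
      also have "ln 48 + real N * (2 * ln 2) + 3 * ln (real N + C) \<le> ln 48 + real N * 1.388 + 3 * ln (real N + C)"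
        using ln_2_less by (intro add_mono mult_left_mono) auto
      finally show "0.72 * ln (ln (real p)) < real N" using elim by simp
    qed
  qed
qed

end

theorem theorem1:
  fixes A B :: int
  assumes "4 * A ^ 3 + 27 * B ^ 2 \<noteq> 0"
  shows "infinite {p :: nat. good_reduction A B p \<and>
           real (least_maximal_x A B p) > 0.72 * ln (ln (real p))}"
proof
  define S where "S = {p :: nat. good_reduction A B p \<and> real (least_maximal_x A B p) > 0.72 * ln (ln (real p))}"
  assume "finite {p :: nat. good_reduction A B p \<and> real (least_maximal_x A B p) > 0.72 * ln (ln (real p))}"
  then have fin: "finite S" by (simp add: S_def)
  obtain r0 r1 r2 where "cubic_roots A B r0 r1 r2" using cubic_roots_exist[OF assms] by blast
  then interpret cubic_roots A B r0 r1 r2 .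
  \<comment> \<open>Large enough for the cubic to be positive: the square of this number already
    dominates \<open>\<bar>A\<bar> n + \<bar>B\<bar>\<close>.\<close>
  define n0 where "n0 = nat (\<bar>A\<bar> + \<bar>B\<bar> + 1)"
  have F0: "F (int n0) \<noteq> 0"
  proof -
    define n where "n = \<bar>A\<bar> + \<bar>B\<bar> + 1"
    have "n \<ge> 1" by (simp add: n_def)
    then have "1 * n * n \<le> n * n * n" by (intro mult_right_mono) auto
    moreover have "n * n = \<bar>A\<bar> * n + \<bar>B\<bar> * n + n" by (simp add: n_def algebra_simps)
    moreover have "- (A * n) \<le> \<bar>A\<bar> * n" using \<open>n \<ge> 1\<close> mult_right_mono[of "- A" "\<bar>A\<bar>" n] by simp
    moreover have "- B \<le> \<bar>B\<bar> * n" using \<open>n \<ge> 1\<close> mult_left_mono[of 1 n "\<bar>B\<bar>"] by linarith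
    ultimately have "n * n * n + A * n + B > 0" using \<open>n \<ge> 1\<close> by linarith
    then show ?thesis by (simp add: F_def n0_def n_def power3_eq_cube)
  qed
  obtain N1 where N1: "\<And>N p. N \<ge> N1 \<Longrightarrow> 3 \<le> p \<Longrightarrow> p \<le> prime_bound N \<Longrightarrow> 0.72 * ln (ln (real p)) < real N"
    using eventually_ln_ln_prime_bound[OF assms] unfolding eventually_sequentially by blast
  \<comment> \<open>\<open>N\<close> is at least \<open>r(E, p)\<close> for every \<open>p\<close>
    in the supposedly finite set, while the prime found for this \<open>N\<close> belongs to the set
    and has \<open>r(E, p) > N\<close>.\<close>
  define N where "N = Max (insert 0 (least_maximal_x A B ` S)) + N1 + n0"
  obtain p e1 e2 e3 where p: "prime p" "\<not> int p dvd 2 * (4 * A ^ 3 + 27 * B\<^sup>2)" "p \<le> prime_bound N"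
    "[e1 + e2 + e3 = 0] (mod int p)" "[e1 * e2 + e1 * e3 + e2 * e3 = A] (mod int p)" "[e1 * e2 * e3 = - B] (mod int p)"
    and sq: "\<And>n. n \<le> N \<Longrightarrow> F (int n) \<noteq> 0 \<Longrightarrow> \<not> int p dvd F (int n) \<and> (\<exists>s. [s * s = int n - e1] (mod int p)) \<and> (\<exists>s. [s * s = int n - e2] (mod int p))"
    and sq3: "\<exists>s. [s * s = int n0 - e3] (mod int p)"
    by (rule split_prime[OF assms, of n0 N]) (use F0 in \<open>auto simp: N_def\<close>)
  interpret S: split_elliptic_mod p "residue_ring (int p)" A B e1 e2 e3
    using p by unfold_locales (auto simp: cong_iff_dvd_diff)
  have "\<not> p dvd 2" using S.q_odd by (metis int_dvd_int_iff of_nat_numeral)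
  then have p3: "3 \<le> p" using prime_ge_2_nat[OF p(1)] by (cases "p = 2") auto
  have conv: "int p dvd x - e - s * s" if "[s * s = x - e] (mod int p)" for x e s
    using that by (simp add: cong_iff_dvd_diff dvd_diff_commute)
  obtain s3 where s3: "int p dvd int n0 - e3 - s3 * s3" using sq3 conv by blast
  have "least_maximal_x A B p > N"
  proof (rule S.least_maximal_x_gt[OF _ _ _ s3 refl])
    show "n0 \<le> N" by (simp add: N_def)
    then show "\<not> int p dvd int n0 ^ 3 + A * int n0 + B" using sq F0 unfolding F_def by blast
    fix n assume n: "n \<le> N" "\<not> int p dvd int n ^ 3 + A * int n + B"
    then have "F (int n) \<noteq> 0" by (auto simp: F_def)
    then show "(\<exists>s. int p dvd int n - e1 - s * s) \<and> (\<exists>s. int p dvd int n - e2 - s * s)"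
      using sq[OF n(1)] conv by blast
  qed
  moreover have "0.72 * ln (ln (real p)) < real N" using N1[OF _ p3 p(3)] by (simp add: N_def)
  ultimately have "p \<in> S" using p(1,2) by (simp add: S_def good_reduction_def)
  then have "least_maximal_x A B p \<le> N" using fin by (auto simp: N_def intro!: trans_le_add1 Max_ge)
  with \<open>least_maximal_x A B p > N\<close> show False by simp
qed

end
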